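(* Let $G=(\mathbb{Z},E)\in\mathcal{G}$. Then the $I(G,1/2)$-model is of Type $\mathcal{I}$ if and only if $G$ has the shrink property.
   Context: $\mathcal{G}$ is the collection of connected graphs $G=(\mathbb{Z},E)$ such that: (A1) there exists an integer $L\ge 1$ with $\{x,y\}\in E \iff \{x+L,y+L\}\in E$ for all $x,y\in\mathbb{Z}$; (A2) the maximal degree of $G$ is finite. For a graph $G=(V,E)$, $S\subset V$ and $u\in V$, write $\deg_S(u)=|\{v\in S:\{u,v\}\in E\}|$. $G$ has the shrink property if for each nonempty finite $S\subset V$ there exists $u\in S$ with $\deg_{V\setminus S}(u)\ge \deg_S(u)$. The $I(G,p)$-model is the continuous-time Markov process $(\sigma_t)_{t\ge0}$ on $\{+1,-1\}^V$ whose initial spins $\sigma_0(v)$, $v\in V$, are i.i.d. with $P(\sigma_0(v)=+1)=p$ and $P(\sigma_0(v)=-1)=1-p$, and in which the spin at $v$ flips at rate $c(v,\sigma_t)$, where $c(v,\sigma)=0$ if $\Delta\mathcal{H}_v(\sigma)>0$, $c(v,\sigma)=1/2$ if $\Delta\mathcal{H}_v(\sigma)=0$, $c(v,\sigma)=1$ if $\Delta\mathcal{H}_v(\sigma)<0$, with $\Delta\mathcal{H}_v(\sigma)=2\sum_{u:\{u,v\}\in E}\sigma(u)\sigma(v)$. A vertex fixates if its spin flips only finitely many times. The model is of Type $\mathcal{I}$ if almost surely no vertex fixates, i.e. almost surely every vertex flips infinitely often. *)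

theory Defs
  imports "HOL-Probability.Probability"
begin

section \<open>Graphs\<close>

text \<open>A simple graph is given by its set \<open>E\<close> of edges; its vertex set is the whole type \<open>'v\<close>.\<close>

definition simple_graph :: "'v set set \<Rightarrow> bool" where
  "simple_graph E \<longleftrightarrow> (\<forall>e\<in>E. \<exists>x y. x \<noteq> y \<and> e = {x, y})"

definition connected_graph :: "'v set set \<Rightarrow> bool" where
  "connected_graph E \<longleftrightarrow> (\<forall>x y. (x, y) \<in> {(u, v). {u, v} \<in> E}\<^sup>*)"

definition periodic_graph :: "int set set \<Rightarrow> bool" where
  "periodic_graph E \<longleftrightarrow> (\<exists>L\<ge>1. \<forall>x y. {x, y} \<in> E \<longleftrightarrow> {x + L, y + L} \<in> E)"

definition bounded_degree :: "'v set set \<Rightarrow> bool" where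
  "bounded_degree E \<longleftrightarrow> (\<exists>D. \<forall>u. finite {v. {u, v} \<in> E} \<and> card {v. {u, v} \<in> E} \<le> D)"

definition graph_class :: "int set set set" where
  "graph_class = {E. simple_graph E \<and> connected_graph E \<and> periodic_graph E \<and> bounded_degree E}"

text \<open>As \<open>card\<close> is \<open>0\<close> on infinite sets, \<open>deg_in\<close> is only meaningful for locally finite graphs.\<close>

definition deg_in :: "'v set set \<Rightarrow> 'v set \<Rightarrow> 'v \<Rightarrow> nat" where
  "deg_in E S u = card {v \<in> S. {u, v} \<in> E}"

definition shrink_property :: "'v set set \<Rightarrow> bool" where
  "shrink_property E \<longleftrightarrow>
     (\<forall>S. finite S \<and> S \<noteq> {} \<longrightarrow> (\<exists>u\<in>S. deg_in E (- S) u \<ge> deg_in E S u))"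


section \<open>Markov processes in continuous time\<close>

definition natural_filtration ::
    "'w measure \<Rightarrow> 's measure \<Rightarrow> (real \<Rightarrow> 'w \<Rightarrow> 's) \<Rightarrow> real \<Rightarrow> 'w measure" where
  "natural_filtration M S X t =
     sigma (space M) {X u -` A \<inter> space M | u A. 0 \<le> u \<and> u \<le> t \<and> A \<in> sets S}"

definition transition_semigroup :: "'s measure \<Rightarrow> (real \<Rightarrow> 's \<Rightarrow> 's measure) \<Rightarrow> bool" where
  "transition_semigroup S K \<longleftrightarrow>
     (\<forall>t\<ge>0. K t \<in> S \<rightarrow>\<^sub>M prob_algebra S) \<and>
     (\<forall>x\<in>space S. K 0 x = return S x) \<and>
     (\<forall>s\<ge>0. \<forall>t\<ge>0. \<forall>x\<in>space S. K (s + t) x = K s x \<bind> K t)"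

definition markov_process ::
    "'w measure \<Rightarrow> 's measure \<Rightarrow> (real \<Rightarrow> 's \<Rightarrow> 's measure) \<Rightarrow> (real \<Rightarrow> 'w \<Rightarrow> 's) \<Rightarrow> bool" where
  "markov_process M S K X \<longleftrightarrow>
     prob_space M \<and> transition_semigroup S K \<and>
     (\<forall>t\<ge>0. X t \<in> M \<rightarrow>\<^sub>M S) \<and>
     (\<forall>s\<ge>0. \<forall>t\<ge>0. \<forall>A\<in>sets S. AE w in M.
        real_cond_exp M (natural_filtration M S X s)
          (indicator {w \<in> space M. X (s + t) w \<in> A}) w = measure (K t (X s w)) A)"

definition cadlag :: "(real \<Rightarrow> 'a::topological_space) \<Rightarrow> bool" where
  "cadlag x \<longleftrightarrow>
     (\<forall>t\<ge>0. (x \<longlongrightarrow> x t) (at_right t)) \<and> (\<forall>t>0. \<exists>l. (x \<longlongrightarrow> l) (at_left t))"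


section \<open>The spin dynamics\<close>

abbreviation spins :: "int set" where
  "spins \<equiv> {- 1, 1}"

definition spin_space :: "('v \<Rightarrow> int) measure" where
  "spin_space = (\<Pi>\<^sub>M v\<in>UNIV. count_space spins)"

definition energy_change :: "'v set set \<Rightarrow> 'v \<Rightarrow> ('v \<Rightarrow> int) \<Rightarrow> int" where
  "energy_change E v \<eta> = 2 * (\<Sum>u\<in>{u. {u, v} \<in> E}. \<eta> u * \<eta> v)"

definition flip_rate :: "'v set set \<Rightarrow> 'v \<Rightarrow> ('v \<Rightarrow> int) \<Rightarrow> real" where
  "flip_rate E v \<eta> =
     (if energy_change E v \<eta> > 0 then 0
      else if energy_change E v \<eta> = 0 then 1 / 2
      else 1)"

text \<open>
  The spin at each vertex \<open>v\<close> flips at rate \<open>c v \<eta>\<close> and no two spins flip simultaneously.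
  Started from \<open>\<eta>\<close>, the probability that after time \<open>h\<close> the spin at \<open>v\<close> differs from
  \<open>\<eta> v\<close> is \<open>c v \<eta> * h + o(h)\<close>, and the probability that the spins at two given distinct
  vertices both differ is \<open>o(h)\<close>, as \<open>h\<close> tends to \<open>0\<close> from the right. The error terms are
  uniform in \<open>\<eta>\<close>, as is the convergence to the generator of a Feller process; this makes the rates
  determine the semigroup if \<open>c\<close> is \<open>flip_rate E\<close> for a graph \<open>E\<close> of bounded degree.
\<close>

definition flips_at_rate ::
    "(real \<Rightarrow> ('v \<Rightarrow> int) \<Rightarrow> ('v \<Rightarrow> int) measure) \<Rightarrow> ('v \<Rightarrow> ('v \<Rightarrow> int) \<Rightarrow> real) \<Rightarrow> bool" where
  "flips_at_rate K c \<longleftrightarrow>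
     (\<forall>v. uniform_limit (space spin_space)
        (\<lambda>h \<eta>. measure (K h \<eta>) {\<xi> \<in> space spin_space. \<xi> v \<noteq> \<eta> v} / h)
        (c v) (at_right 0)) \<and>
     (\<forall>u v. u \<noteq> v \<longrightarrow> uniform_limit (space spin_space)
        (\<lambda>h \<eta>. measure (K h \<eta>) {\<xi> \<in> space spin_space. \<xi> u \<noteq> \<eta> u \<and> \<xi> v \<noteq> \<eta> v} / h)
        (\<lambda>_. 0) (at_right 0))"

definition iid_spins :: "'w measure \<Rightarrow> real \<Rightarrow> ('w \<Rightarrow> 'v \<Rightarrow> int) \<Rightarrow> bool" where
  "iid_spins M p \<sigma>0 \<longleftrightarrow>
     prob_space.indep_vars M (\<lambda>_. count_space spins) (\<lambda>v w. \<sigma>0 w v) UNIV \<and>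
     (\<forall>v. measure M {w \<in> space M. \<sigma>0 w v = 1} = p \<and>
          measure M {w \<in> space M. \<sigma>0 w v = - 1} = 1 - p)"

text \<open>
  \<open>I_model E p M \<sigma>\<close>: on the probability space \<open>M\<close>, \<open>\<sigma>\<close> is a version of the \<open>I(G,p)\<close>-model.
\<close>

definition I_model ::
    "'v set set \<Rightarrow> real \<Rightarrow> 'w measure \<Rightarrow> (real \<Rightarrow> 'w \<Rightarrow> 'v \<Rightarrow> int) \<Rightarrow> bool" where
  "I_model E p M \<sigma> \<longleftrightarrow>
     (\<exists>K. markov_process M spin_space K \<sigma> \<and> flips_at_rate K (flip_rate E)) \<and>
     (AE w in M. \<forall>v. cadlag (\<lambda>t. \<sigma> t w v)) \<and>
     iid_spins M p (\<sigma> 0)"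

text \<open>For a cadlag trajectory with values in the discrete space \<open>int\<close> these are its jump times.\<close>

definition flip_times :: "(real \<Rightarrow> int) \<Rightarrow> real set" where
  "flip_times x = {t. t > 0 \<and> \<not> (x \<longlongrightarrow> x t) (at_left t)}"

definition fixates :: "(real \<Rightarrow> int) \<Rightarrow> bool" where
  "fixates x \<longleftrightarrow> finite (flip_times x)"

definition type_I :: "'w measure \<Rightarrow> (real \<Rightarrow> 'w \<Rightarrow> 'v \<Rightarrow> int) \<Rightarrow> bool" where
  "type_I M \<sigma> \<longleftrightarrow> (AE w in M. \<forall>v. \<not> fixates (\<lambda>t. \<sigma> t w v))"

end

theory Submission
  imports Defs
begin

text \<open>
  If the shrink property fails for a finite set \<open>S\<close>, every vertex of \<open>S\<close> has more neighbours inside \<open>S\<close>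
  than outside. Once the spins of \<open>S\<close> agree, none of them may ever flip, and they agree initially
  with positive probability. A probability of leaving this state within time \<open>h\<close> that is \<open>o(h)\<close>
  vanishes for all times (\<open>frozen_stays\<close>).

  Now assume the shrink property, and suppose that some spin is equal to \<open>s\<close> at all integer times
  from \<open>m\<close> on with positive probability; call it a survivor. Three facts are in conflict.

  \<^item> Let \<open>B\<close> consist of two blocks of vertices, one on either side of a window, whose width
    \<open>R\<close> bounds the length of the edges. If all spins of \<open>B\<close> oppose \<open>s\<close>, the shrink property allows the spins
    equal to \<open>s\<close> inside the window to be erased one by one, so with a probability bounded
    below, for a given window, none of them is left one unit of time later (\<open>erase_prob_pos\<close>, \<open>erase_step\<close>). Hence the
    probability that \<open>B\<close> opposes \<open>s\<close> at time \<open>n\<close> while there is a survivor in the window tends to \<open>0\<close>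
    (\<open>survival_avoids_turning\<close>).

  \<^item> The dynamics is attractive and the initial spins are independent, so the spins at time \<open>n\<close> are
    positively correlated (\<open>act_product_increasing\<close>, \<open>mean_product_increasing\<close>), and each is a fair coin
    by symmetry. So \<open>B\<close> opposes \<open>s\<close> at time \<open>n\<close> with probability at least \<open>(1/2) ^ (2 * R)\<close> for all \<open>n\<close>
    (\<open>block_prob\<close>). Together, a window contains a survivor with probability at most
    \<open>1 - (1/2) ^ (2 * R)\<close>, whatever its size (\<open>some_survivor_prob_le\<close>). That one-dimensional graphs are
    separated by blocks of bounded size is essential here.

  \<^item> The process is invariant under a period of the graph, and distant regions are nearly
    independent (\<open>act_product_distant\<close>, \<open>mean_product_distant\<close>). By a second moment estimate, large
    windows contain survivors with a probability close to \<open>1\<close> (\<open>some_survivor_prob_ge\<close>).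

  Only the semigroup \<open>K\<close> and its infinitesimal flip probabilities are given, not a construction of
  the process. All properties of the semigroup are therefore obtained from explicit approximations
  by powers of \<open>I + (t/n) \<Omega>\<close> with the generator \<open>\<Omega>\<close> of the dynamics in a finite set of vertices. They
  converge uniformly on observables whose dependence on a spin decays exponentially with the
  distance from a centre (\<open>generator_estimate\<close>, \<open>act_approx\<close>); decay, monotonicity, correlation
  inequalities and symmetries need to be checked only for a single step. The initial distribution
  is treated in the same way, with the resampling of single spins in place of the steps.
\<close>

section \<open>Observables with decaying dependence on the spins\<close>

definition configs :: "('v \<Rightarrow> int) set" where
  "configs = {\<eta>. \<forall>v. \<eta> v = -1 \<or> \<eta> v = 1}"

definition flip :: "'v \<Rightarrow> ('v \<Rightarrow> int) \<Rightarrow> 'v \<Rightarrow> int" where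
  "flip x \<eta> = \<eta>(x := - \<eta> x)"

text \<open>
  The influence of the vertex \<open>x\<close> on an observable centred at \<open>z\<close> is measured against this weight.
  It is summable, so influences add up, and it varies by a bounded factor over bounded distances, so
  one step of a dynamics with finite range increases the influences only by a constant factor.
\<close>

definition wt :: "int \<Rightarrow> int \<Rightarrow> real" where
  "wt z x = (1/2) ^ nat \<bar>x - z\<bar>"

abbreviation window :: "nat \<Rightarrow> int set" where
  "window N \<equiv> {- int N..int N}"

text \<open>
  The bound on single flips controls configurations that differ at finitely many vertices. The last
  condition is continuity in the product topology; it carries the bound over to infinitely many
  differences, since functions of the behaviour at infinity have no influences at all.
\<close>

definition smooth_at :: "int \<Rightarrow> real \<Rightarrow> ((int \<Rightarrow> int) \<Rightarrow> real) \<Rightarrow> bool" where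
  "smooth_at z A f \<longleftrightarrow> 0 \<le> A \<and>
     (\<forall>\<eta>\<in>configs. \<forall>x. \<bar>f (flip x \<eta>) - f \<eta>\<bar> \<le> A * wt z x) \<and>
     (\<forall>\<epsilon>>0. \<exists>N. \<forall>\<xi>\<in>configs. \<forall>\<eta>\<in>configs. (\<forall>x\<in>window N. \<xi> x = \<eta> x) \<longrightarrow> \<bar>f \<xi> - f \<eta>\<bar> \<le> \<epsilon>)"

lemma space_spin_space: "space spin_space = configs"
  by (auto simp: spin_space_def space_PiM configs_def PiE_def extensional_def)

lemma configs_nonempty: "configs \<noteq> {}"
proof -
  have "(\<lambda>_. 1) \<in> configs" by (simp add: configs_def)
  then show ?thesis by blast
qed

lemma flip_configs [simp]: "\<eta> \<in> configs \<Longrightarrow> flip x \<eta> \<in> configs"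
  by (auto simp: configs_def flip_def)

lemma flip_same [simp]: "flip x \<eta> x = - \<eta> x" and flip_other [simp]: "y \<noteq> x \<Longrightarrow> flip x \<eta> y = \<eta> y"
  by (auto simp: flip_def)

lemma flip_flip [simp]: "flip x (flip x \<eta>) = \<eta>"
  by (auto simp: flip_def)

lemma flip_commute: "flip x (flip y \<eta>) = flip y (flip x \<eta>)"
  by (auto simp: flip_def fun_eq_iff)

lemma configs_cases: "\<eta> \<in> configs \<Longrightarrow> \<eta> x = -1 \<or> \<eta> x = 1"
  by (auto simp: configs_def)

lemma configs_neq_iff: "\<eta> \<in> configs \<Longrightarrow> \<xi> \<in> configs \<Longrightarrow> \<xi> x \<noteq> \<eta> x \<longleftrightarrow> \<xi> x = - \<eta> x"
  using configs_cases[of \<eta> x] configs_cases[of \<xi> x] by auto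

lemma override_configs [simp]:
  "\<xi> \<in> configs \<Longrightarrow> \<eta> \<in> configs \<Longrightarrow> override_on \<eta> \<xi> S \<in> configs"
  by (auto simp: configs_def override_on_def)

lemma wt_nonneg [simp]: "0 \<le> wt z x" and wt_self [simp]: "wt z z = 1"
  by (auto simp: wt_def)

lemma wt_recentre: "wt z x \<le> 2 ^ nat \<bar>z - z'\<bar> * wt z' x"
proof -
  have "nat \<bar>x - z'\<bar> \<le> nat \<bar>z - z'\<bar> + nat \<bar>x - z\<bar>" by linarith
  then have "(1/2) ^ (nat \<bar>z - z'\<bar> + nat \<bar>x - z\<bar>) \<le> (1/2::real) ^ nat \<bar>x - z'\<bar>"
    by (intro power_decreasing) auto
  then show ?thesis by (simp add: wt_def power_add field_simps)
qed

lemma wt_neighbour: "\<bar>x - y\<bar> \<le> int R \<Longrightarrow> wt z x \<le> 2 ^ R * wt z y"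
proof -
  assume "\<bar>x - y\<bar> \<le> int R"
  then have "nat \<bar>y - z\<bar> \<le> R + nat \<bar>x - z\<bar>" by linarith
  then have "(1/2) ^ (R + nat \<bar>x - z\<bar>) \<le> (1/2::real) ^ nat \<bar>y - z\<bar>"
    by (intro power_decreasing) auto
  then show ?thesis by (simp add: wt_def power_add field_simps)
qed

lemma sum_half_powers_le:
  assumes "finite G" "\<forall>k\<in>G. N < k"
  shows "(\<Sum>k\<in>G. (1/2::real) ^ k) \<le> (1/2) ^ N"
proof -
  have eq: "(\<Sum>k\<in>{Suc N..<Suc N + m}. (1/2::real) ^ k) = (1/2) ^ N - (1/2) ^ (N + m)" for m
    by (induction m) auto
  obtain m where "\<forall>k\<in>G. k < m" using assms(1) finite_nat_set_iff_bounded by auto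
  with assms(2) have "G \<subseteq> {Suc N..<Suc N + m}" by force
  then have "(\<Sum>k\<in>G. (1/2::real) ^ k) \<le> (\<Sum>k\<in>{Suc N..<Suc N + m}. (1/2) ^ k)"
    by (intro sum_mono2) auto
  also have "\<dots> \<le> (1/2) ^ N" unfolding eq by simp
  finally show ?thesis .
qed

lemma sum_wt_outside:
  assumes "finite F" "\<forall>x\<in>F. int N < \<bar>x - z\<bar>"
  shows "(\<Sum>x\<in>F. wt z x) \<le> 2 * (1/2) ^ N"
proof -
  let ?R = "{x\<in>F. x > z}" and ?L = "{x\<in>F. x < z}"
  have "F = ?R \<union> ?L" using assms(2) by fastforce
  then have "(\<Sum>x\<in>F. wt z x) = (\<Sum>x\<in>?R \<union> ?L. wt z x)" by simp
  also have "\<dots> = (\<Sum>x\<in>?R. wt z x) + (\<Sum>x\<in>?L. wt z x)"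
    using assms(1) by (intro sum.union_disjoint) auto
  also have "(\<Sum>x\<in>?R. wt z x) = (\<Sum>k\<in>(\<lambda>x. nat \<bar>x - z\<bar>) ` ?R. (1/2) ^ k)"
    by (subst sum.reindex) (auto simp: inj_on_def wt_def)
  also have "\<dots> \<le> (1/2) ^ N"
    using assms by (intro sum_half_powers_le) auto
  also have "(\<Sum>x\<in>?L. wt z x) = (\<Sum>k\<in>(\<lambda>x. nat \<bar>x - z\<bar>) ` ?L. (1/2) ^ k)"
    by (subst sum.reindex) (auto simp: inj_on_def wt_def)
  also have "\<dots> \<le> (1/2) ^ N"
    using assms by (intro sum_half_powers_le) auto
  finally show ?thesis by simp
qed

lemma sum_wt_le_3:
  assumes "finite F"
  shows "(\<Sum>x\<in>F. wt z x) \<le> 3"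
proof -
  have "(\<Sum>x\<in>F. wt z x) \<le> (\<Sum>x\<in>insert z (F - {z}). wt z x)"
    using assms by (intro sum_mono2) auto
  also have "\<dots> = 1 + (\<Sum>x\<in>F - {z}. wt z x)" using assms by (subst sum.insert) auto
  also have "(\<Sum>x\<in>F - {z}. wt z x) \<le> 2"
    using sum_wt_outside[of "F - {z}" 0 z] assms by auto
  finally show ?thesis by simp
qed

text \<open>Two vertices at distance \<open>d\<close> cannot both be close to \<open>x\<close>, so one of the factors is small.\<close>

lemma sum_wt_mult_le:
  assumes "finite F"
  shows "(\<Sum>x\<in>F. wt z x * wt z' x) \<le> 6 * (1/2) ^ (nat \<bar>z - z'\<bar> div 2)"
proof -
  let ?d = "nat \<bar>z - z'\<bar> div 2"
  have "wt z x * wt z' x \<le> (wt z x + wt z' x) * (1/2) ^ ?d" for x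
  proof -
    have "?d \<le> nat \<bar>x - z\<bar> \<or> ?d \<le> nat \<bar>x - z'\<bar>" by linarith
    then have "wt z x \<le> (1/2) ^ ?d \<or> wt z' x \<le> (1/2) ^ ?d"
      unfolding wt_def by (auto intro: power_decreasing)
    then show ?thesis
    proof
      assume "wt z x \<le> (1/2) ^ ?d"
      then have "wt z x * wt z' x \<le> (1/2) ^ ?d * wt z' x" by (intro mult_right_mono) auto
      moreover have "0 \<le> wt z x * (1/2) ^ ?d" by simp
      ultimately show ?thesis unfolding distrib_right by (metis add_increasing mult.commute)
    next
      assume "wt z' x \<le> (1/2) ^ ?d"
      then have "wt z x * wt z' x \<le> wt z x * (1/2) ^ ?d" by (intro mult_left_mono) auto
      moreover have "0 \<le> wt z' x * (1/2) ^ ?d" by simp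
      ultimately show ?thesis unfolding distrib_right by linarith
    qed
  qed
  then have "(\<Sum>x\<in>F. wt z x * wt z' x) \<le> (\<Sum>x\<in>F. (wt z x + wt z' x) * (1/2) ^ ?d)"
    by (intro sum_mono)
  also have "\<dots> = ((\<Sum>x\<in>F. wt z x) + (\<Sum>x\<in>F. wt z' x)) * (1/2) ^ ?d"
    by (simp only: sum_distrib_right[symmetric] sum.distrib)
  also have "\<dots> \<le> (3 + 3) * (1/2) ^ ?d"
    using sum_wt_le_3[OF assms] by (intro mult_right_mono add_mono) auto
  finally show ?thesis by simp
qed

lemma smooth_atD:
  assumes "smooth_at z A f"
  shows "0 \<le> A" "\<eta> \<in> configs \<Longrightarrow> \<bar>f (flip x \<eta>) - f \<eta>\<bar> \<le> A * wt z x"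
    "\<epsilon> > 0 \<Longrightarrow> \<exists>N. \<forall>\<xi>\<in>configs. \<forall>\<eta>\<in>configs. (\<forall>x\<in>window N. \<xi> x = \<eta> x) \<longrightarrow> \<bar>f \<xi> - f \<eta>\<bar> \<le> \<epsilon>"
  using assms unfolding smooth_at_def by auto

lemma abs_diff_triangle: "\<bar>a - b\<bar> \<le> d \<Longrightarrow> \<bar>b - c\<bar> \<le> e \<Longrightarrow> \<bar>a - c\<bar> \<le> d + e" for a b c d e :: real
  by linarith

text \<open>
  The differing spins are flipped one after the other.
\<close>

lemma smooth_at_finite_diff:
  assumes f: "smooth_at z A f" and "finite F" "\<xi> \<in> configs" "\<eta> \<in> configs" "\<forall>x. x \<notin> F \<longrightarrow> \<xi> x = \<eta> x"
  shows "\<bar>f \<xi> - f \<eta>\<bar> \<le> A * (\<Sum>x\<in>{x\<in>F. \<xi> x \<noteq> \<eta> x}. wt z x)"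
  using assms(2-)
proof (induction F arbitrary: \<xi> rule: finite_induct)
  case empty
  then have "\<xi> = \<eta>" by auto
  then show ?case by simp
next
  case (insert a F)
  show ?case
  proof (cases "\<xi> a = \<eta> a")
    case True
    then have "{x \<in> insert a F. \<xi> x \<noteq> \<eta> x} = {x \<in> F. \<xi> x \<noteq> \<eta> x}" by auto
    moreover have "\<forall>x. x \<notin> F \<longrightarrow> \<xi> x = \<eta> x" using insert.prems(3) True by auto
    ultimately show ?thesis using insert.IH[OF insert.prems(1,2)] by presburger
  next
    case False
    let ?\<xi> = "flip a \<xi>"
    have "\<xi> a = - \<eta> a" using False configs_neq_iff[OF insert.prems(2,1)] by blast
    then have "\<forall>x. x \<notin> F \<longrightarrow> ?\<xi> x = \<eta> x" using insert.prems(3) by (simp add: flip_def)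
    note 1 = insert.IH[OF flip_configs[OF insert.prems(1)] insert.prems(2) this]
    note 2 = smooth_atD(2)[OF f insert.prems(1), of a]
    have 3: "{x\<in>F. ?\<xi> x \<noteq> \<eta> x} = {x\<in>F. \<xi> x \<noteq> \<eta> x}" using insert.hyps by (auto simp: flip_def)
    have 4: "{x \<in> insert a F. \<xi> x \<noteq> \<eta> x} = insert a {x\<in>F. \<xi> x \<noteq> \<eta> x}" using False by auto
    have "(\<Sum>x\<in>{x \<in> insert a F. \<xi> x \<noteq> \<eta> x}. wt z x) = wt z a + (\<Sum>x\<in>{x\<in>F. \<xi> x \<noteq> \<eta> x}. wt z x)"
      unfolding 4 using insert.hyps by (subst sum.insert) auto
    then show ?thesis
      using abs_diff_triangle[OF 2[unfolded abs_minus_commute[of "f ?\<xi>"]] 1] unfolding 3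
      by (simp only: distrib_left)
  qed
qed

lemma smooth_at_diff:
  assumes f: "smooth_at z A f" and "\<epsilon> > 0"
  obtains N where "\<And>M \<xi> \<eta>. N \<le> M \<Longrightarrow> \<xi> \<in> configs \<Longrightarrow> \<eta> \<in> configs \<Longrightarrow>
           \<bar>f \<xi> - f \<eta>\<bar> \<le> A * (\<Sum>x\<in>{x\<in>window M. \<xi> x \<noteq> \<eta> x}. wt z x) + \<epsilon>"
proof -
  obtain N where N: "\<And>\<xi> \<eta>. \<xi>\<in>configs \<Longrightarrow> \<eta>\<in>configs \<Longrightarrow> (\<forall>x\<in>window N. \<xi> x = \<eta> x) \<Longrightarrow> \<bar>f \<xi> - f \<eta>\<bar> \<le> \<epsilon>"
    using smooth_atD(3)[OF assms] by blast
  show thesis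
  proof (rule that[of N])
    fix M and \<xi> \<eta> :: "int \<Rightarrow> int" assume "N \<le> M" and c: "\<xi> \<in> configs" "\<eta> \<in> configs"
    let ?\<zeta> = "override_on \<eta> \<xi> (window M)"
    have z: "?\<zeta> \<in> configs" using c by simp
    have 1: "\<bar>f \<xi> - f ?\<zeta>\<bar> \<le> \<epsilon>"
      using \<open>N \<le> M\<close> by (intro N[OF c(1) z]) (auto simp: override_on_def)
    have "\<bar>f ?\<zeta> - f \<eta>\<bar> \<le> A * (\<Sum>x\<in>{x\<in>window M. ?\<zeta> x \<noteq> \<eta> x}. wt z x)"
      by (intro smooth_at_finite_diff[OF f _ z c(2)]) (auto simp: override_on_def)
    also have "{x\<in>window M. ?\<zeta> x \<noteq> \<eta> x} = {x\<in>window M. \<xi> x \<noteq> \<eta> x}"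
      by (auto simp: override_on_def)
    finally have 2: "\<bar>f ?\<zeta> - f \<eta>\<bar> \<le> A * (\<Sum>x\<in>{x\<in>window M. \<xi> x \<noteq> \<eta> x}. wt z x)" .
    show "\<bar>f \<xi> - f \<eta>\<bar> \<le> A * (\<Sum>x\<in>{x\<in>window M. \<xi> x \<noteq> \<eta> x}. wt z x) + \<epsilon>"
      using abs_diff_triangle[OF 1 2] by (simp only: add.commute)
  qed
qed

lemma smooth_at_agree:
  assumes f: "smooth_at z A f" and c: "\<xi> \<in> configs" "\<eta> \<in> configs"
    and ag: "\<And>x. \<bar>x - z\<bar> \<le> int N \<Longrightarrow> \<xi> x = \<eta> x"
  shows "\<bar>f \<xi> - f \<eta>\<bar> \<le> A * (2 * (1/2) ^ N)"
proof (rule field_le_epsilon)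
  fix \<epsilon> :: real assume "\<epsilon> > 0"
  obtain M where
    "\<And>M' \<xi> \<eta>. M \<le> M' \<Longrightarrow> \<xi> \<in> configs \<Longrightarrow> \<eta> \<in> configs \<Longrightarrow>
       \<bar>f \<xi> - f \<eta>\<bar> \<le> A * (\<Sum>x\<in>{x\<in>window M'. \<xi> x \<noteq> \<eta> x}. wt z x) + \<epsilon>"
    by (rule smooth_at_diff[OF f \<open>\<epsilon> > 0\<close>]) blast
  from this[OF order_refl c]
  have M: "\<bar>f \<xi> - f \<eta>\<bar> \<le> A * (\<Sum>x\<in>{x\<in>window M. \<xi> x \<noteq> \<eta> x}. wt z x) + \<epsilon>" .
  have "(\<Sum>x\<in>{x\<in>window M. \<xi> x \<noteq> \<eta> x}. wt z x) \<le> 2 * (1/2) ^ N"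
  proof (rule sum_wt_outside)
    show "\<forall>x\<in>{x \<in> window M. \<xi> x \<noteq> \<eta> x}. int N < \<bar>x - z\<bar>"
      using ag linorder_not_le by blast
  qed (rule finite_subset[of _ "window M"], auto)
  from mult_left_mono[OF this smooth_atD(1)[OF f]] M
  show "\<bar>f \<xi> - f \<eta>\<bar> \<le> A * (2 * (1/2) ^ N) + \<epsilon>" by linarith
qed

lemma smooth_at_oscillation:
  assumes f: "smooth_at z A f" and c: "\<xi> \<in> configs" "\<eta> \<in> configs"
  shows "\<bar>f \<xi> - f \<eta>\<bar> \<le> 3 * A"
proof (rule field_le_epsilon)
  fix \<epsilon> :: real assume "\<epsilon> > 0"
  obtain M where
    "\<And>M' \<xi> \<eta>. M \<le> M' \<Longrightarrow> \<xi> \<in> configs \<Longrightarrow> \<eta> \<in> configs \<Longrightarrow>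
       \<bar>f \<xi> - f \<eta>\<bar> \<le> A * (\<Sum>x\<in>{x\<in>window M'. \<xi> x \<noteq> \<eta> x}. wt z x) + \<epsilon>"
    by (rule smooth_at_diff[OF f \<open>\<epsilon> > 0\<close>]) blast
  from this[OF order_refl c]
  have M: "\<bar>f \<xi> - f \<eta>\<bar> \<le> A * (\<Sum>x\<in>{x\<in>window M. \<xi> x \<noteq> \<eta> x}. wt z x) + \<epsilon>" .
  have "(\<Sum>x\<in>{x\<in>window M. \<xi> x \<noteq> \<eta> x}. wt z x) \<le> 3"
    by (rule sum_wt_le_3, rule finite_subset[of _ "window M"]) auto
  from mult_left_mono[OF this smooth_atD(1)[OF f]] M
  show "\<bar>f \<xi> - f \<eta>\<bar> \<le> 3 * A + \<epsilon>" by linarith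
qed

lemma smooth_at_bounded:
  assumes f: "smooth_at z A f"
  shows "\<exists>B\<ge>0. \<forall>\<eta>\<in>configs. \<bar>f \<eta>\<bar> \<le> B"
proof -
  obtain \<eta>\<^sub>0 :: "int \<Rightarrow> int" where 0: "\<eta>\<^sub>0 \<in> configs" using configs_nonempty by blast
  have "\<bar>f \<eta>\<bar> \<le> \<bar>f \<eta>\<^sub>0\<bar> + 3 * A" if "\<eta> \<in> configs" for \<eta>
    using smooth_at_oscillation[OF f that 0] by linarith
  then show ?thesis using smooth_atD(1)[OF f] by (intro exI[of _ "\<bar>f \<eta>\<^sub>0\<bar> + 3 * A"]) auto
qed

lemma smooth_at_mono:
  assumes f: "smooth_at z A f" and "A \<le> B"
  shows "smooth_at z B f"
  unfolding smooth_at_def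
proof (intro conjI ballI allI)
  show "\<bar>f (flip x \<eta>) - f \<eta>\<bar> \<le> B * wt z x" if "\<eta> \<in> configs" for \<eta> x
    using smooth_atD(2)[OF f that, of x] mult_right_mono[OF assms(2) wt_nonneg[of z x]] by linarith
qed (use assms smooth_atD[OF f] in auto)

lemma smooth_at_recentre:
  assumes f: "smooth_at z A f"
  shows "smooth_at z' (A * 2 ^ nat \<bar>z - z'\<bar>) f"
  unfolding smooth_at_def
proof (intro conjI ballI allI)
  show "\<bar>f (flip x \<eta>) - f \<eta>\<bar> \<le> (A * 2 ^ nat \<bar>z - z'\<bar>) * wt z' x" if "\<eta> \<in> configs" for \<eta> x
    using smooth_atD(2)[OF f that, of x]
      mult_left_mono[OF wt_recentre[of z x z'] smooth_atD(1)[OF f]] by (simp add: mult.assoc)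
qed (use smooth_atD[OF f] in auto)

lemma smooth_at_mult:
  assumes f: "smooth_at z A f" and g: "smooth_at z B g"
    and bf: "\<And>\<eta>. \<eta> \<in> configs \<Longrightarrow> \<bar>f \<eta>\<bar> \<le> a" and bg: "\<And>\<eta>. \<eta> \<in> configs \<Longrightarrow> \<bar>g \<eta>\<bar> \<le> b"
  shows "smooth_at z (a * B + A * b) (\<lambda>\<eta>. f \<eta> * g \<eta>)"
proof -
  have ab: "0 \<le> a" "0 \<le> b" using bf bg configs_nonempty by fastforce+
  have key: "\<bar>f \<xi> * g \<xi> - f \<eta> * g \<eta>\<bar> \<le> a * \<bar>g \<xi> - g \<eta>\<bar> + \<bar>f \<xi> - f \<eta>\<bar> * b"
    if "\<xi> \<in> configs" "\<eta> \<in> configs" for \<xi> \<eta>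
  proof -
    have "f \<xi> * g \<xi> - f \<eta> * g \<eta> = f \<xi> * (g \<xi> - g \<eta>) + (f \<xi> - f \<eta>) * g \<eta>" by (simp add: algebra_simps)
    then have "\<bar>f \<xi> * g \<xi> - f \<eta> * g \<eta>\<bar> \<le> \<bar>f \<xi>\<bar> * \<bar>g \<xi> - g \<eta>\<bar> + \<bar>f \<xi> - f \<eta>\<bar> * \<bar>g \<eta>\<bar>"
      by (metis abs_mult abs_triangle_ineq)
    also have "\<dots> \<le> a * \<bar>g \<xi> - g \<eta>\<bar> + \<bar>f \<xi> - f \<eta>\<bar> * b"
      using that bf bg by (intro add_mono mult_right_mono mult_left_mono) auto
    finally show ?thesis .
  qed
  show ?thesis unfolding smooth_at_def
  proof (intro conjI ballI allI impI)
    show "0 \<le> a * B + A * b" using ab smooth_atD(1)[OF f] smooth_atD(1)[OF g] by auto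
  next
    fix \<eta> :: "int \<Rightarrow> int" and x assume c: "\<eta> \<in> configs"
    have "a * \<bar>g (flip x \<eta>) - g \<eta>\<bar> + \<bar>f (flip x \<eta>) - f \<eta>\<bar> * b \<le> a * (B * wt z x) + (A * wt z x) * b"
      using ab smooth_atD(2)[OF f c] smooth_atD(2)[OF g c]
      by (intro add_mono mult_right_mono mult_left_mono) auto
    with key[OF flip_configs[OF c] c, of x]
    show "\<bar>f (flip x \<eta>) * g (flip x \<eta>) - f \<eta> * g \<eta>\<bar> \<le> (a * B + A * b) * wt z x"
      by (simp add: algebra_simps)
  next
    fix \<epsilon> :: real assume "0 < \<epsilon>"
    define \<epsilon>' where "\<epsilon>' = \<epsilon> / (a + b + 1)"
    have e': "\<epsilon>' > 0" using \<open>0 < \<epsilon>\<close> ab by (auto simp: \<epsilon>'_def)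
    have "(a + b + 1) * \<epsilon>' = \<epsilon>" using ab by (simp add: \<epsilon>'_def)
    then have e2: "a * \<epsilon>' + \<epsilon>' * b \<le> \<epsilon>" using e' by (simp add: distrib_left distrib_right mult.commute)
    obtain N where N: "\<And>\<xi> \<eta>. \<xi>\<in>configs \<Longrightarrow> \<eta>\<in>configs \<Longrightarrow> (\<forall>x\<in>window N. \<xi> x = \<eta> x) \<Longrightarrow> \<bar>f \<xi> - f \<eta>\<bar> \<le> \<epsilon>'"
      using smooth_atD(3)[OF f e'] by blast
    obtain M where M: "\<And>\<xi> \<eta>. \<xi>\<in>configs \<Longrightarrow> \<eta>\<in>configs \<Longrightarrow> (\<forall>x\<in>window M. \<xi> x = \<eta> x) \<Longrightarrow> \<bar>g \<xi> - g \<eta>\<bar> \<le> \<epsilon>'"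
      using smooth_atD(3)[OF g e'] by blast
    show "\<exists>N. \<forall>\<xi>\<in>configs. \<forall>\<eta>\<in>configs. (\<forall>x\<in>window N. \<xi> x = \<eta> x) \<longrightarrow> \<bar>f \<xi> * g \<xi> - f \<eta> * g \<eta>\<bar> \<le> \<epsilon>"
    proof (intro exI[of _ "N + M"] ballI impI)
      fix \<xi> \<eta> assume c: "\<xi> \<in> configs" "\<eta> \<in> configs" and ag: "\<forall>x\<in>window (N + M). \<xi> x = \<eta> x"
      have "\<bar>f \<xi> - f \<eta>\<bar> \<le> \<epsilon>'" using c ag by (intro N) auto
      moreover have "\<bar>g \<xi> - g \<eta>\<bar> \<le> \<epsilon>'" using c ag by (intro M) auto
      ultimately have "a * \<bar>g \<xi> - g \<eta>\<bar> + \<bar>f \<xi> - f \<eta>\<bar> * b \<le> a * \<epsilon>' + \<epsilon>' * b"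
        using ab by (intro add_mono mult_left_mono mult_right_mono) auto
      with key[OF c] e2 show "\<bar>f \<xi> * g \<xi> - f \<eta> * g \<eta>\<bar> \<le> \<epsilon>" by linarith
    qed
  qed
qed

lemma smooth_at_uniform_limit:
  assumes appr: "\<And>\<epsilon>. \<epsilon> > 0 \<Longrightarrow> \<exists>g. smooth_at z A g \<and> (\<forall>\<eta>\<in>configs. \<bar>f \<eta> - g \<eta>\<bar> \<le> \<epsilon>)"
  shows "smooth_at z A f"
  unfolding smooth_at_def
proof (intro conjI ballI allI impI)
  show "0 \<le> A" using appr[of 1] smooth_atD(1) by auto
next
  fix \<eta> :: "int \<Rightarrow> int" and x assume c: "\<eta> \<in> configs"
  show "\<bar>f (flip x \<eta>) - f \<eta>\<bar> \<le> A * wt z x"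
  proof (rule field_le_epsilon)
    fix e :: real assume "e > 0"
    then obtain g where g: "smooth_at z A g" "\<forall>\<eta>\<in>configs. \<bar>f \<eta> - g \<eta>\<bar> \<le> e/2"
      using appr[of "e/2"] by auto
    have "\<bar>f \<eta> - g \<eta>\<bar> \<le> e/2" "\<bar>f (flip x \<eta>) - g (flip x \<eta>)\<bar> \<le> e/2" using g(2) c by auto
    with smooth_atD(2)[OF g(1) c, of x] show "\<bar>f (flip x \<eta>) - f \<eta>\<bar> \<le> A * wt z x + e"
      by linarith
  qed
next
  fix e :: real assume "e > 0"
  then obtain g where g: "smooth_at z A g" "\<forall>\<eta>\<in>configs. \<bar>f \<eta> - g \<eta>\<bar> \<le> e/3"
    using appr[of "e/3"] by auto
  obtain N where N: "\<And>\<xi> \<eta>. \<xi>\<in>configs \<Longrightarrow> \<eta>\<in>configs \<Longrightarrow> (\<forall>x\<in>window N. \<xi> x = \<eta> x) \<Longrightarrow> \<bar>g \<xi> - g \<eta>\<bar> \<le> e/3"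
    using smooth_atD(3)[OF g(1), of "e/3"] \<open>e > 0\<close> by auto
  show "\<exists>N. \<forall>\<xi>\<in>configs. \<forall>\<eta>\<in>configs. (\<forall>x\<in>window N. \<xi> x = \<eta> x) \<longrightarrow> \<bar>f \<xi> - f \<eta>\<bar> \<le> e"
  proof (intro exI[of _ N] ballI impI)
    fix \<xi> \<eta> assume c: "\<xi> \<in> configs" "\<eta> \<in> configs" and ag: "\<forall>x\<in>window N. \<xi> x = \<eta> x"
    have "\<bar>f \<xi> - g \<xi>\<bar> \<le> e/3" "\<bar>f \<eta> - g \<eta>\<bar> \<le> e/3" using g(2) c by auto
    with N[OF c ag] show "\<bar>f \<xi> - f \<eta>\<bar> \<le> e" by linarith
  qed
qed

lemma measurable_spin [measurable]: "(\<lambda>\<xi>. \<xi> v) \<in> spin_space \<rightarrow>\<^sub>M count_space spins"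
  unfolding spin_space_def by (rule measurable_component_singleton) simp

lemma sets_spin_event: "{\<xi>\<in>space spin_space. Q (\<xi> v)} \<in> sets spin_space"
proof -
  have "(\<lambda>\<xi>. \<xi> v) -` {a\<in>spins. Q a} \<inter> space spin_space \<in> sets spin_space"
    by (rule measurable_sets[OF measurable_spin]) auto
  also have "(\<lambda>\<xi>. \<xi> v) -` {a\<in>spins. Q a} \<inter> space spin_space = {\<xi>\<in>space spin_space. Q (\<xi> v)}"
    by (auto simp: space_spin_space configs_def)
  finally show ?thesis .
qed

lemma sets_spins_event:
  assumes "finite J"
  shows "{\<xi>\<in>space spin_space. \<forall>x\<in>J. Q x (\<xi> x)} \<in> sets spin_space"
  using assms by (intro sets.sets_Collect_finite_All sets_spin_event)

text \<open>
  Outside \<open>S\<close> the default spin \<open>1\<close> is used, so that only finitely many configurations remain.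
\<close>

lemma measurable_local:
  fixes f :: "('v \<Rightarrow> int) \<Rightarrow> real"
  assumes "finite S"
  shows "(\<lambda>\<eta>. f (override_on (\<lambda>_. 1) \<eta> S)) \<in> borel_measurable spin_space"
proof -
  let ?r = "\<lambda>\<eta>::'v \<Rightarrow> int. override_on (\<lambda>_. 1) \<eta> S"
  let ?P = "{p. \<forall>x. (x \<in> S \<longrightarrow> p x \<in> spins) \<and> (x \<notin> S \<longrightarrow> p x = 1)}"
  have "finite ?P" using assms by (intro finite_set_of_finite_funs) auto
  have "?r \<in> spin_space \<rightarrow>\<^sub>M count_space ?P"
    unfolding measurable_count_space_eq2[OF \<open>finite ?P\<close>]
  proof (intro conjI ballI)
    show "?r \<in> space spin_space \<rightarrow> ?P"
      by (auto simp: space_spin_space configs_def override_on_def)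
  next
    fix p assume p: "p \<in> ?P"
    have "?r -` {p} \<inter> space spin_space = {\<xi>\<in>space spin_space. \<forall>x\<in>S. \<xi> x = p x}"
      using p by (auto simp: override_on_def fun_eq_iff)
    also have "\<dots> \<in> sets spin_space" using assms by (rule sets_spins_event)
    finally show "?r -` {p} \<inter> space spin_space \<in> sets spin_space" .
  qed
  then show ?thesis by (rule measurable_compose) simp
qed

lemma smooth_at_measurable:
  assumes f: "smooth_at z A f"
  shows "f \<in> borel_measurable spin_space"
proof (rule borel_measurable_LIMSEQ_real)
  let ?r = "\<lambda>N \<eta>. override_on (\<lambda>_. 1) \<eta> (window N)"
  show "(\<lambda>\<eta>. f (?r N \<eta>)) \<in> borel_measurable spin_space" for N
    by (rule measurable_local) auto
  fix \<eta> :: "int \<Rightarrow> int" assume "\<eta> \<in> space spin_space"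
  then have c: "\<eta> \<in> configs" by (simp add: space_spin_space)
  have r: "?r N \<eta> \<in> configs" for N using c by (auto simp: configs_def override_on_def)
  show "(\<lambda>N. f (?r N \<eta>)) \<longlonglongrightarrow> f \<eta>"
  proof (rule LIMSEQ_I)
    fix e :: real assume "0 < e"
    then obtain N where N: "\<And>\<xi> \<eta>. \<xi>\<in>configs \<Longrightarrow> \<eta>\<in>configs \<Longrightarrow> (\<forall>x\<in>window N. \<xi> x = \<eta> x) \<Longrightarrow> \<bar>f \<xi> - f \<eta>\<bar> \<le> e/2"
      using smooth_atD(3)[OF f, of "e/2"] by auto
    show "\<exists>N. \<forall>n\<ge>N. norm (f (?r n \<eta>) - f \<eta>) < e"
    proof (intro exI[of _ N] allI impI)
      fix n assume "N \<le> n"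
      then have "\<bar>f (?r n \<eta>) - f \<eta>\<bar> \<le> e/2" using c r by (intro N) (auto simp: override_on_def)
      then show "norm (f (?r n \<eta>) - f \<eta>) < e" using \<open>0 < e\<close> by simp
    qed
  qed
qed

lemma smooth_at_spin: "smooth_at x 1 (\<lambda>\<eta>. of_bool (\<eta> x = s))"
  unfolding smooth_at_def
proof (intro conjI ballI allI impI)
  fix e :: real assume "0 < e"
  show "\<exists>N. \<forall>\<xi>\<in>configs. \<forall>\<eta>\<in>configs. (\<forall>x\<in>window N. \<xi> x = \<eta> x) \<longrightarrow>
    \<bar>of_bool (\<xi> x = s) - of_bool (\<eta> x = s) :: real\<bar> \<le> e"
  proof (intro exI[of _ "nat \<bar>x\<bar>"] ballI impI)
    fix \<xi> \<eta> :: "int \<Rightarrow> int" assume "\<forall>y\<in>window (nat \<bar>x\<bar>). \<xi> y = \<eta> y"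
    moreover have "x \<in> window (nat \<bar>x\<bar>)" by (cases "0 \<le> x") auto
    ultimately have "\<xi> x = \<eta> x" by blast
    then show "\<bar>of_bool (\<xi> x = s) - of_bool (\<eta> x = s) :: real\<bar> \<le> e" using \<open>0 < e\<close> by simp
  qed
next
  fix \<eta> :: "int \<Rightarrow> int" and y
  show "\<bar>of_bool (flip y \<eta> x = s) - of_bool (\<eta> x = s) :: real\<bar> \<le> 1 * wt x y"
    using wt_nonneg[of x y] by (cases "y = x") auto
qed simp

text \<open>
  Monotonicity under single flips. For continuous observables this is monotonicity with respect to
  the pointwise order.
\<close>

definition increasing :: "(('v \<Rightarrow> int) \<Rightarrow> real) \<Rightarrow> bool" where
  "increasing f \<longleftrightarrow> (\<forall>\<eta>\<in>configs. \<forall>x. \<eta> x = -1 \<longrightarrow> f \<eta> \<le> f (flip x \<eta>))"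


text \<open>
  A flip moves the configuration up or down, and increasing observables follow it in the same direction.
\<close>

lemma increasing_gradients_agree:
  assumes f: "increasing f" and g: "increasing g" and c: "\<eta> \<in> configs"
  shows "0 \<le> (f (flip x \<eta>) - f \<eta>) * (g (flip x \<eta>) - g \<eta>)"
proof (cases "\<eta> x = -1")
  case True
  then show ?thesis using f g c unfolding increasing_def by (intro mult_nonneg_nonneg) auto
next
  case False
  then have "flip x \<eta> x = -1" using configs_cases[OF c, of x] by auto
  then have "f (flip x \<eta>) \<le> f \<eta>" "g (flip x \<eta>) \<le> g \<eta>"
    using f g flip_configs[OF c, of x] unfolding increasing_def by (metis flip_flip)+
  then show ?thesis by (intro mult_nonpos_nonpos) auto
qed

section \<open>The action of the semigroup on observables\<close>

definition bounded_obs :: "(('v \<Rightarrow> int) \<Rightarrow> real) \<Rightarrow> bool" where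
  "bounded_obs f \<longleftrightarrow> f \<in> borel_measurable spin_space \<and> (\<exists>B. \<forall>\<eta>\<in>configs. \<bar>f \<eta>\<bar> \<le> B)"

lemma bounded_obsI:
  "f \<in> borel_measurable spin_space \<Longrightarrow> (\<And>\<eta>. \<eta> \<in> configs \<Longrightarrow> \<bar>f \<eta>\<bar> \<le> B) \<Longrightarrow> bounded_obs f"
  unfolding bounded_obs_def by blast

lemma smooth_at_bounded_obs: "smooth_at z A f \<Longrightarrow> bounded_obs f"
  using smooth_at_measurable smooth_at_bounded unfolding bounded_obs_def by blast

lemma bounded_obs_const: "bounded_obs (\<lambda>_. a)"
  by (rule bounded_obsI[of _ "\<bar>a\<bar>"]) auto

lemma bounded_obs_of_bool: "bounded_obs (\<lambda>\<xi>. of_bool (Q (\<xi> v)))"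
proof (rule bounded_obsI[of _ 1])
  have "(\<lambda>\<xi>. indicator {\<xi>\<in>space spin_space. Q (\<xi> v)} \<xi> :: real) \<in> borel_measurable spin_space"
    by (intro borel_measurable_indicator sets_spin_event)
  then show "(\<lambda>\<xi>. of_bool (Q (\<xi> v)) :: real) \<in> borel_measurable spin_space"
    by (rule measurable_cong[THEN iffD1, rotated]) (auto simp: indicator_def)
qed auto

lemmas bounded_obs_neq = bounded_obs_of_bool[of "\<lambda>s. s \<noteq> a" for a]

lemma bounded_obs_add:
  assumes "bounded_obs f" "bounded_obs g"
  shows "bounded_obs (\<lambda>\<xi>. f \<xi> + g \<xi>)"
proof -
  obtain a b where "\<forall>\<eta>\<in>configs. \<bar>f \<eta>\<bar> \<le> a" "\<forall>\<eta>\<in>configs. \<bar>g \<eta>\<bar> \<le> b"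
    using assms unfolding bounded_obs_def by blast
  then have "\<bar>f \<eta> + g \<eta>\<bar> \<le> a + b" if "\<eta> \<in> configs" for \<eta>
    using that abs_triangle_ineq[of "f \<eta>" "g \<eta>"] by fastforce
  then show ?thesis using assms by (intro bounded_obsI) (auto simp: bounded_obs_def)
qed

lemma bounded_obs_mult:
  assumes "bounded_obs f" "bounded_obs g"
  shows "bounded_obs (\<lambda>\<xi>. f \<xi> * g \<xi>)"
proof -
  obtain a b where ab: "\<forall>\<eta>\<in>configs. \<bar>f \<eta>\<bar> \<le> a" "\<forall>\<eta>\<in>configs. \<bar>g \<eta>\<bar> \<le> b"
    using assms unfolding bounded_obs_def by blast
  have "\<bar>f \<eta> * g \<eta>\<bar> \<le> a * b" if "\<eta> \<in> configs" for \<eta>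
    unfolding abs_mult using that ab by (intro mult_mono) (auto intro: order_trans[OF abs_ge_zero])
  then show ?thesis using assms by (intro bounded_obsI) (auto simp: bounded_obs_def)
qed

lemma bounded_obs_diff:
  assumes "bounded_obs f" "bounded_obs g"
  shows "bounded_obs (\<lambda>\<xi>. f \<xi> - g \<xi>)"
  using bounded_obs_add[OF assms(1) bounded_obs_mult[OF bounded_obs_const[of "-1"] assms(2)]] by simp

lemma bounded_obs_sum:
  assumes "finite S" "\<And>x. x \<in> S \<Longrightarrow> bounded_obs (f x)"
  shows "bounded_obs (\<lambda>\<xi>. \<Sum>x\<in>S. f x \<xi>)"
  using assms by (induction S rule: finite_induct) (auto intro: bounded_obs_const bounded_obs_add)

text \<open>
  \<open>K\<close> is the semigroup of a spin system with bounded rates of finite range \<open>R\<close>. Its action on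
  observables is investigated through the rates alone.
\<close>

locale spin_flip_process =
  fixes K :: "real \<Rightarrow> (int \<Rightarrow> int) \<Rightarrow> (int \<Rightarrow> int) measure"
    and c :: "int \<Rightarrow> (int \<Rightarrow> int) \<Rightarrow> real"
    and R :: nat
  assumes semigroup: "transition_semigroup spin_space K"
    and rates: "flips_at_rate K c"
    and c_nonneg: "\<eta> \<in> configs \<Longrightarrow> 0 \<le> c x \<eta>"
    and c_le_1: "\<eta> \<in> configs \<Longrightarrow> c x \<eta> \<le> 1"
    and c_local: "\<xi> \<in> configs \<Longrightarrow> \<eta> \<in> configs \<Longrightarrow> (\<And>y. \<bar>y - x\<bar> \<le> int R \<Longrightarrow> \<xi> y = \<eta> y) \<Longrightarrow> c x \<xi> = c x \<eta>"
begin

definition act :: "real \<Rightarrow> ((int \<Rightarrow> int) \<Rightarrow> real) \<Rightarrow> (int \<Rightarrow> int) \<Rightarrow> real" where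
  "act t f \<eta> = (\<integral>\<xi>. f \<xi> \<partial>K t \<eta>)"

lemma kernel: "0 \<le> t \<Longrightarrow> K t \<in> spin_space \<rightarrow>\<^sub>M prob_algebra spin_space"
  using semigroup unfolding transition_semigroup_def by blast

lemma kernel_subprob: "0 \<le> t \<Longrightarrow> K t \<in> spin_space \<rightarrow>\<^sub>M subprob_algebra spin_space"
  by (rule measurable_prob_algebraD[OF kernel])

lemma kernel_prob:
  assumes "0 \<le> t" "\<eta> \<in> configs"
  shows "prob_space (K t \<eta>)" "sets (K t \<eta>) = sets spin_space" "space (K t \<eta>) = configs"
proof -
  have "K t \<eta> \<in> space (prob_algebra spin_space)"
    using measurable_space[OF kernel[OF assms(1)]] assms(2) by (simp add: space_spin_space)
  then show "prob_space (K t \<eta>)" and s: "sets (K t \<eta>) = sets spin_space"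
    by (auto simp: space_prob_algebra)
  show "space (K t \<eta>) = configs" using sets_eq_imp_space_eq[OF s] by (simp add: space_spin_space)
qed

lemma integrable_act:
  assumes "0 \<le> t" "\<eta> \<in> configs" "bounded_obs f"
  shows "integrable (K t \<eta>) f"
proof -
  interpret prob_space "K t \<eta>" using kernel_prob assms by blast
  obtain B where B: "\<forall>\<eta>\<in>configs. \<bar>f \<eta>\<bar> \<le> B" using assms(3) unfolding bounded_obs_def by blast
  show ?thesis
  proof (rule integrable_const_bound[of _ B])
    show "AE x in K t \<eta>. norm (f x) \<le> B" using B kernel_prob[OF assms(1,2)] by (intro AE_I2) auto
    show "f \<in> borel_measurable (K t \<eta>)"
      using assms(3) kernel_prob(2)[OF assms(1,2)] unfolding bounded_obs_def by (metis measurable_cong_sets)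
  qed
qed

lemma act_mono:
  assumes "0 \<le> t" "\<eta> \<in> configs" "bounded_obs f" "bounded_obs g" "\<And>\<xi>. \<xi> \<in> configs \<Longrightarrow> f \<xi> \<le> g \<xi>"
  shows "act t f \<eta> \<le> act t g \<eta>"
  unfolding act_def using assms kernel_prob(3)[OF assms(1,2)]
  by (intro integral_mono integrable_act) auto

lemma act_cong:
  assumes "0 \<le> t" "\<eta> \<in> configs" "\<And>\<xi>. \<xi> \<in> configs \<Longrightarrow> f \<xi> = g \<xi>"
  shows "act t f \<eta> = act t g \<eta>"
  unfolding act_def using assms kernel_prob(3)[OF assms(1,2)]
  by (intro Bochner_Integration.integral_cong) auto

lemma act_const: "0 \<le> t \<Longrightarrow> \<eta> \<in> configs \<Longrightarrow> act t (\<lambda>_. a) \<eta> = a"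
  unfolding act_def using kernel_prob(1)[of t \<eta>] by (simp add: prob_space.prob_space)

lemma act_add:
  "0 \<le> t \<Longrightarrow> \<eta> \<in> configs \<Longrightarrow> bounded_obs f \<Longrightarrow> bounded_obs g \<Longrightarrow>
   act t (\<lambda>\<xi>. f \<xi> + g \<xi>) \<eta> = act t f \<eta> + act t g \<eta>"
  unfolding act_def by (intro Bochner_Integration.integral_add integrable_act)

lemma act_diff:
  "0 \<le> t \<Longrightarrow> \<eta> \<in> configs \<Longrightarrow> bounded_obs f \<Longrightarrow> bounded_obs g \<Longrightarrow>
   act t (\<lambda>\<xi>. f \<xi> - g \<xi>) \<eta> = act t f \<eta> - act t g \<eta>"
  unfolding act_def by (intro Bochner_Integration.integral_diff integrable_act)

lemma act_cmult: "act t (\<lambda>\<xi>. a * f \<xi>) \<eta> = a * act t f \<eta>"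
  unfolding act_def by simp

lemma act_sum:
  assumes "0 \<le> t" "\<eta> \<in> configs" "\<And>x. x \<in> S \<Longrightarrow> bounded_obs (f x)"
  shows "act t (\<lambda>\<xi>. \<Sum>x\<in>S. f x \<xi>) \<eta> = (\<Sum>x\<in>S. act t (f x) \<eta>)"
  unfolding act_def using assms by (intro Bochner_Integration.integral_sum integrable_act)

lemma act_abs_le:
  assumes "0 \<le> t" "\<eta> \<in> configs" "bounded_obs f" "bounded_obs g" "\<And>\<xi>. \<xi> \<in> configs \<Longrightarrow> \<bar>f \<xi>\<bar> \<le> g \<xi>"
  shows "\<bar>act t f \<eta>\<bar> \<le> act t g \<eta>"
proof -
  have 1: "act t f \<eta> \<le> act t g \<eta>" by (intro act_mono assms) (use assms(5) abs_le_iff in blast)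
  have "bounded_obs (\<lambda>\<xi>. -1 * f \<xi>)" by (intro bounded_obs_mult bounded_obs_const assms)
  then have "act t (\<lambda>\<xi>. -1 * f \<xi>) \<eta> \<le> act t g \<eta>"
    by (intro act_mono assms) (use assms(5) abs_le_iff in fastforce)+
  with 1 show ?thesis unfolding act_cmult by linarith
qed

lemma act_close:
  assumes "0 \<le> t" "\<eta> \<in> configs" "bounded_obs f" "bounded_obs g" "\<And>\<xi>. \<xi> \<in> configs \<Longrightarrow> \<bar>f \<xi> - g \<xi>\<bar> \<le> e"
  shows "\<bar>act t f \<eta> - act t g \<eta>\<bar> \<le> e"
proof -
  have "\<bar>act t (\<lambda>\<xi>. f \<xi> - g \<xi>) \<eta>\<bar> \<le> act t (\<lambda>_. e) \<eta>"
    by (intro act_abs_le bounded_obs_diff bounded_obs_const assms)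
  then show ?thesis using assms by (simp add: act_diff act_const)
qed

lemma bounded_obs_act:
  assumes "0 \<le> t" "bounded_obs f"
  shows "bounded_obs (act t f)"
proof -
  obtain B where B: "\<And>\<eta>. \<eta>\<in>configs \<Longrightarrow> \<bar>f \<eta>\<bar> \<le> B" using assms(2) unfolding bounded_obs_def by blast
  have "act t f \<in> borel_measurable spin_space"
    unfolding act_def using assms(2) kernel_subprob[OF assms(1)] unfolding bounded_obs_def
    by (intro measurable_compose[OF _ integral_measurable_subprob_algebra]) auto
  moreover have "\<bar>act t f \<eta>\<bar> \<le> B" if "\<eta> \<in> configs" for \<eta>
    using act_abs_le[OF assms(1) that assms(2) bounded_obs_const[of B]] B that assms act_const by simp
  ultimately show ?thesis by (rule bounded_obsI)
qed

lemma act_semigroup: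
  assumes "0 \<le> s" "0 \<le> t" "\<eta> \<in> configs" "bounded_obs f"
  shows "act (s + t) f \<eta> = act s (act t f) \<eta>"
proof -
  obtain B where B: "\<forall>\<eta>\<in>configs. \<bar>f \<eta>\<bar> \<le> B" using assms(4) unfolding bounded_obs_def by blast
  interpret prob_space "K s \<eta>" using kernel_prob assms by blast
  have "K (s + t) \<eta> = K s \<eta> \<bind> K t"
    using semigroup assms unfolding transition_semigroup_def by (simp add: space_spin_space)
  moreover have "integral\<^sup>L (K s \<eta> \<bind> K t) f = (\<integral>\<xi>. integral\<^sup>L (K t \<xi>) f \<partial>K s \<eta>)"
  proof (rule integral_bind[where K=spin_space and B=B and B'=1])
    show "K t \<in> K s \<eta> \<rightarrow>\<^sub>M subprob_algebra spin_space"
      using kernel_subprob[OF assms(2)] kernel_prob(2)[OF assms(1,3)] by (metis measurable_cong_sets)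
    show "f \<in> borel_measurable spin_space" using assms(4) unfolding bounded_obs_def by blast
    show "AE \<xi> in K s \<eta>. emeasure (K t \<xi>) (space (K t \<xi>)) \<le> ennreal 1"
    proof (rule AE_I2)
      fix \<xi> assume "\<xi> \<in> space (K s \<eta>)"
      then have "\<xi> \<in> configs" using kernel_prob(3)[OF assms(1,3)] by simp
      from prob_space.emeasure_space_1[OF kernel_prob(1)[OF assms(2) this]]
      show "emeasure (K t \<xi>) (space (K t \<xi>)) \<le> ennreal 1" by simp
    qed
    show "\<bar>f \<xi>\<bar> \<le> B" if "\<xi> \<in> space spin_space" for \<xi> using that B by (simp add: space_spin_space)
  qed (unfold_locales)
  ultimately show ?thesis unfolding act_def by simp
qed

lemma act_0:
  assumes "\<eta> \<in> configs" "bounded_obs f"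
  shows "act 0 f \<eta> = f \<eta>"
proof -
  have "K 0 \<eta> = return spin_space \<eta>"
    using semigroup assms unfolding transition_semigroup_def by (simp add: space_spin_space)
  then show ?thesis unfolding act_def using assms
    by (simp add: integral_return space_spin_space bounded_obs_def)
qed

lemma act_of_bool:
  assumes "0 \<le> t" "\<eta> \<in> configs" "{\<xi>\<in>space spin_space. Q \<xi>} \<in> sets spin_space"
  shows "act t (\<lambda>\<xi>. of_bool (Q \<xi>)) \<eta> = measure (K t \<eta>) {\<xi>\<in>space spin_space. Q \<xi>}"
proof -
  have "act t (\<lambda>\<xi>. of_bool (Q \<xi>)) \<eta> = act t (indicator {\<xi>\<in>space spin_space. Q \<xi>}) \<eta>"
    by (intro act_cong assms) (auto simp: indicator_def space_spin_space)
  also have "\<dots> = measure (K t \<eta>) ({\<xi>\<in>space spin_space. Q \<xi>} \<inter> space (K t \<eta>))"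
    unfolding act_def by simp
  also have "{\<xi>\<in>space spin_space. Q \<xi>} \<inter> space (K t \<eta>) = {\<xi>\<in>space spin_space. Q \<xi>}"
    using kernel_prob(3)[OF assms(1,2)] by (auto simp: space_spin_space)
  finally show ?thesis .
qed

definition flip_prob :: "real \<Rightarrow> int \<Rightarrow> (int \<Rightarrow> int) \<Rightarrow> real" where
  "flip_prob t x \<eta> = act t (\<lambda>\<xi>. of_bool (\<xi> x \<noteq> \<eta> x)) \<eta>"

definition pair_flip_prob :: "real \<Rightarrow> int \<Rightarrow> int \<Rightarrow> (int \<Rightarrow> int) \<Rightarrow> real" where
  "pair_flip_prob t x y \<eta> = act t (\<lambda>\<xi>. of_bool (\<xi> x \<noteq> \<eta> x) * of_bool (\<xi> y \<noteq> \<eta> y)) \<eta>"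

lemma flip_prob_limit:
  assumes "\<epsilon> > 0"
  shows "eventually (\<lambda>h. \<forall>\<eta>\<in>configs. \<bar>flip_prob h x \<eta> - h * c x \<eta>\<bar> \<le> h * \<epsilon>) (at_right 0)"
proof -
  have "uniform_limit (space spin_space)
        (\<lambda>h \<eta>. measure (K h \<eta>) {\<xi> \<in> space spin_space. \<xi> x \<noteq> \<eta> x} / h) (c x) (at_right 0)"
    using rates unfolding flips_at_rate_def by blast
  from uniform_limitD[OF this assms]
  have "eventually (\<lambda>h. \<forall>\<eta>\<in>space spin_space.
          dist (measure (K h \<eta>) {\<xi> \<in> space spin_space. \<xi> x \<noteq> \<eta> x} / h) (c x \<eta>) < \<epsilon>) (at_right 0)" .
  moreover have "eventually (\<lambda>h::real. 0 < h) (at_right 0)" by (rule eventually_at_right_less)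
  ultimately show ?thesis
  proof eventually_elim
    case (elim h)
    show ?case
    proof
      fix \<eta> :: "int \<Rightarrow> int" assume c: "\<eta> \<in> configs"
      have "flip_prob h x \<eta> = measure (K h \<eta>) {\<xi> \<in> space spin_space. \<xi> x \<noteq> \<eta> x}"
        unfolding flip_prob_def using elim(2) c by (intro act_of_bool sets_spin_event) auto
      then have "\<bar>flip_prob h x \<eta> / h - c x \<eta>\<bar> \<le> \<epsilon>"
        using elim(1) c by (force simp: dist_real_def space_spin_space)
      then have "h * \<bar>flip_prob h x \<eta> / h - c x \<eta>\<bar> \<le> h * \<epsilon>"
        using elim(2) by (intro mult_left_mono) auto
      moreover have "h * \<bar>flip_prob h x \<eta> / h - c x \<eta>\<bar> = \<bar>h * (flip_prob h x \<eta> / h - c x \<eta>)\<bar>"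
        using elim(2) by (simp add: abs_mult)
      ultimately show "\<bar>flip_prob h x \<eta> - h * c x \<eta>\<bar> \<le> h * \<epsilon>"
        using elim(2) by (simp add: right_diff_distrib)
    qed
  qed
qed

lemma pair_flip_prob_limit:
  assumes "\<epsilon> > 0" "x \<noteq> y"
  shows "eventually (\<lambda>h. \<forall>\<eta>\<in>configs. pair_flip_prob h x y \<eta> \<le> h * \<epsilon>) (at_right 0)"
proof -
  have "uniform_limit (space spin_space)
        (\<lambda>h \<eta>. measure (K h \<eta>) {\<xi> \<in> space spin_space. \<xi> x \<noteq> \<eta> x \<and> \<xi> y \<noteq> \<eta> y} / h) (\<lambda>_. 0) (at_right 0)"
    using rates assms unfolding flips_at_rate_def by blast
  from uniform_limitD[OF this assms(1)]
  have "eventually (\<lambda>h. \<forall>\<eta>\<in>space spin_space.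
          dist (measure (K h \<eta>) {\<xi> \<in> space spin_space. \<xi> x \<noteq> \<eta> x \<and> \<xi> y \<noteq> \<eta> y} / h) 0 < \<epsilon>) (at_right 0)" .
  moreover have "eventually (\<lambda>h::real. 0 < h) (at_right 0)" by (rule eventually_at_right_less)
  ultimately show ?thesis
  proof eventually_elim
    case (elim h)
    show ?case
    proof
      fix \<eta> :: "int \<Rightarrow> int" assume c: "\<eta> \<in> configs"
      have m: "{\<xi> \<in> space spin_space. \<xi> x \<noteq> \<eta> x \<and> \<xi> y \<noteq> \<eta> y} \<in> sets spin_space"
        by (intro sets.sets_Collect_conj sets_spin_event)
      have "pair_flip_prob h x y \<eta> = act h (\<lambda>\<xi>. of_bool (\<xi> x \<noteq> \<eta> x \<and> \<xi> y \<noteq> \<eta> y)) \<eta>"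
        unfolding pair_flip_prob_def by (simp add: of_bool_conj)
      also have "\<dots> = measure (K h \<eta>) {\<xi> \<in> space spin_space. \<xi> x \<noteq> \<eta> x \<and> \<xi> y \<noteq> \<eta> y}"
        using elim(2) c by (intro act_of_bool m) auto
      finally have "pair_flip_prob h x y \<eta> / h < \<epsilon>"
        using bspec[OF elim(1), of \<eta>] c elim(2) by (auto simp: dist_real_def space_spin_space)
      then show "pair_flip_prob h x y \<eta> \<le> h * \<epsilon>"
        using elim(2) by (simp add: field_simps)
    qed
  qed
qed

text \<open>
  The limit of \<open>flip_prob h x\<close> is not uniform in the vertex \<open>x\<close>. Subadditivity in time turns it
  into a bound that holds for all times and hence uniformly in \<open>x\<close>; this controls the flips
  far away in \<open>generator_estimate\<close>.
\<close>

lemma flip_prob_le: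
  assumes "0 \<le> t" "\<eta> \<in> configs"
  shows "flip_prob t x \<eta> \<le> 2 * t"
proof (cases "t = 0")
  case True
  then show ?thesis
    unfolding flip_prob_def using act_0[OF assms(2) bounded_obs_neq] by simp
next
  case False
  then have t: "0 < t" using assms by simp
  have "eventually (\<lambda>h. \<forall>\<eta>\<in>configs. \<bar>flip_prob h x \<eta> - h * c x \<eta>\<bar> \<le> h * 1) (at_right 0)"
    by (rule flip_prob_limit) simp
  then obtain h\<^sub>0 where h0: "h\<^sub>0 > 0"
    "\<And>h. 0 < h \<Longrightarrow> h < h\<^sub>0 \<Longrightarrow> \<forall>\<eta>\<in>configs. \<bar>flip_prob h x \<eta> - h * c x \<eta>\<bar> \<le> h * 1"
    unfolding eventually_at_right_field by auto
  have small: "flip_prob h x \<eta> \<le> 2 * h" if h: "0 < h" "h < h\<^sub>0" and "\<eta> \<in> configs" for h \<eta>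
  proof -
    have "\<bar>flip_prob h x \<eta> - h * c x \<eta>\<bar> \<le> h" using h0(2)[OF h] that by simp
    moreover have "h * c x \<eta> \<le> h * 1" using c_le_1 that by (intro mult_left_mono) auto
    ultimately show ?thesis by linarith
  qed
  have iter: "flip_prob (real n * h) x \<eta> \<le> real n * (2 * h)"
    if h: "0 < h" "h < h\<^sub>0" and c: "\<eta> \<in> configs" for n h \<eta>
  proof (induction n)
    case 0
    show ?case
      unfolding flip_prob_def using act_0[OF c bounded_obs_neq] by simp
  next
    case (Suc n)
    let ?I = "\<lambda>\<xi>. of_bool (\<xi> x \<noteq> \<eta> x) :: real"
    have 1: "act h ?I \<zeta> \<le> ?I \<zeta> + 2 * h" if z: "\<zeta> \<in> configs" for \<zeta>
    proof (cases "\<zeta> x = \<eta> x")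
      case True
      then have "act h ?I \<zeta> = flip_prob h x \<zeta>" unfolding flip_prob_def by simp
      then show ?thesis using small[OF h z] True by simp
    next
      case False
      have "act h ?I \<zeta> \<le> act h (\<lambda>_. 1) \<zeta>"
        using h z by (intro act_mono bounded_obs_neq bounded_obs_const) auto
      then show ?thesis using False h z by (simp add: act_const)
    qed
    have nh: "0 \<le> real n * h" using h by simp
    have "flip_prob (real (Suc n) * h) x \<eta> = act (real n * h + h) ?I \<eta>"
      unfolding flip_prob_def by (simp add: algebra_simps)
    also have "\<dots> = act (real n * h) (act h ?I) \<eta>"
      using h c by (intro act_semigroup bounded_obs_neq) auto
    also have "\<dots> \<le> act (real n * h) (\<lambda>\<xi>. ?I \<xi> + 2 * h) \<eta>"
      using h c 1 nh by (intro act_mono bounded_obs_add bounded_obs_neq bounded_obs_const bounded_obs_act) auto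
    also have "\<dots> = flip_prob (real n * h) x \<eta> + 2 * h"
      unfolding flip_prob_def using nh c
      by (simp only: act_add act_const bounded_obs_neq bounded_obs_const)
    finally show ?case using Suc by (simp add: algebra_simps)
  qed
  obtain n where n: "t / h\<^sub>0 < real n" using reals_Archimedean2 by blast
  moreover have "0 < t / h\<^sub>0" using t h0 by simp
  ultimately have n0: "0 < real n" by linarith
  have "t / real n < h\<^sub>0" using n n0 h0(1) by (simp add: field_simps)
  with iter[of "t / real n" \<eta> n] t n0 assms show ?thesis by simp
qed

text \<open>
  The operator \<open>I + h \<Omega>\<close>, where \<open>\<Omega>\<close> generates the dynamics in which only the spins in \<open>\<Lambda>\<close> flip.
  Since \<open>\<Lambda>\<close> is finite, this is a Markov operator for small \<open>h\<close>, and its properties can be read off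
  from a finite sum.
\<close>

definition step :: "int set \<Rightarrow> real \<Rightarrow> ((int \<Rightarrow> int) \<Rightarrow> real) \<Rightarrow> (int \<Rightarrow> int) \<Rightarrow> real" where
  "step \<Lambda> h f \<eta> = f \<eta> + h * (\<Sum>x\<in>\<Lambda>. c x \<eta> * (f (flip x \<eta>) - f \<eta>))"

text \<open>
  The linearization is exact if at most one spin in \<open>\<Lambda>\<close> differs. Otherwise some pair of spins differs,
  and each of the two sides is at most \<open>3 * A\<close>.
\<close>

lemma smooth_at_linearization:
  assumes g: "smooth_at z A g" and c: "\<xi> \<in> configs" "\<eta> \<in> configs" and fin: "finite \<Lambda>"
  shows "\<bar>g (override_on \<eta> \<xi> \<Lambda>) - g \<eta> - (\<Sum>x\<in>\<Lambda>. of_bool (\<xi> x \<noteq> \<eta> x) * (g (flip x \<eta>) - g \<eta>))\<bar>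
    \<le> 6 * A * (\<Sum>(x,y)\<in>{(x,y). x \<in> \<Lambda> \<and> y \<in> \<Lambda> \<and> x \<noteq> y}. of_bool (\<xi> x \<noteq> \<eta> x) * of_bool (\<xi> y \<noteq> \<eta> y))"
    (is "?lhs \<le> 6 * A * ?S")
proof -
  let ?D = "{x\<in>\<Lambda>. \<xi> x \<noteq> \<eta> x}" and ?P = "{(x,y). x \<in> \<Lambda> \<and> y \<in> \<Lambda> \<and> x \<noteq> y}"
  let ?\<zeta> = "override_on \<eta> \<xi> \<Lambda>"
  have finP: "finite ?P" by (rule finite_subset[of _ "\<Lambda> \<times> \<Lambda>"]) (use fin in auto)
  have A: "0 \<le> A" using smooth_atD(1)[OF g] .
  have S0: "0 \<le> ?S" by (intro sum_nonneg) auto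
  have sumD: "(\<Sum>x\<in>\<Lambda>. of_bool (\<xi> x \<noteq> \<eta> x) * (g (flip x \<eta>) - g \<eta>)) = (\<Sum>x\<in>?D. g (flip x \<eta>) - g \<eta>)"
    by (intro sum.mono_neutral_cong_right fin) auto
  consider (none) "?D = {}" | (one) a where "?D = {a}" | (two) a b where "a \<in> ?D" "b \<in> ?D" "a \<noteq> b"
    by blast
  then show ?thesis
  proof cases
    case none
    then have "?\<zeta> = \<eta>" by (auto simp: override_on_def fun_eq_iff)
    then show ?thesis using S0 A unfolding sumD none by simp
  next
    case one
    then have "a \<in> ?D" by blast
    then have "\<xi> a = - \<eta> a" using configs_neq_iff[OF c(2,1)] by blast
    then have "?\<zeta> = flip a \<eta>" using one by (auto simp: override_on_def fun_eq_iff flip_def)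
    then show ?thesis using S0 A unfolding sumD one by simp
  next
    case two
    have "?S \<ge> (\<Sum>(x,y)\<in>{(a,b)}. of_bool (\<xi> x \<noteq> \<eta> x) * of_bool (\<xi> y \<noteq> \<eta> y))"
      using two by (intro sum_mono2 finP) auto
    then have S1: "1 \<le> ?S" using two by simp
    have 1: "\<bar>g ?\<zeta> - g \<eta>\<bar> \<le> 3 * A" using c by (intro smooth_at_oscillation[OF g]) auto
    have "\<bar>\<Sum>x\<in>?D. g (flip x \<eta>) - g \<eta>\<bar> \<le> (\<Sum>x\<in>?D. \<bar>g (flip x \<eta>) - g \<eta>\<bar>)" by (rule sum_abs)
    also have "\<dots> \<le> (\<Sum>x\<in>?D. A * wt z x)" by (intro sum_mono smooth_atD(2)[OF g c(2)])
    also have "\<dots> = A * (\<Sum>x\<in>?D. wt z x)" by (simp add: sum_distrib_left)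
    also have "\<dots> \<le> A * 3" using fin A by (intro mult_left_mono sum_wt_le_3) auto
    finally have "?lhs \<le> 6 * A" unfolding sumD using 1 by linarith
    also have "6 * A \<le> 6 * A * ?S" using mult_left_mono[OF S1, of "6 * A"] A by simp
    finally show ?thesis .
  qed
qed

text \<open>
  Flips outside \<open>\<Lambda>\<close> contribute their probabilities, at most \<open>2 * h\<close> each, weighted by their
  influences, which sum to at most \<open>A * (2 * (1/2) ^ N)\<close>. Inside \<open>\<Lambda>\<close> the observable may be linearized, and the
  finitely many limits that define the rates hold uniformly. What matters later is that the bound
  on \<open>h\<close> depends on \<open>\<Lambda>\<close> and \<open>\<epsilon>\<close> but not on the observable.
\<close>

lemma generator_estimate:
  assumes fin: "finite \<Lambda>" and e: "\<epsilon> > 0"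
  obtains h\<^sub>0 where "h\<^sub>0 > 0"
    "\<And>h z N A g \<eta>. 0 < h \<Longrightarrow> h < h\<^sub>0 \<Longrightarrow> {x. \<bar>x - z\<bar> \<le> int N} \<subseteq> \<Lambda> \<Longrightarrow> smooth_at z A g \<Longrightarrow> \<eta> \<in> configs \<Longrightarrow>
      \<bar>act h g \<eta> - step \<Lambda> h g \<eta>\<bar> \<le> h * (A * (4 * (1/2) ^ N + \<epsilon>))"
proof -
  let ?P = "{(x,y). x \<in> \<Lambda> \<and> y \<in> \<Lambda> \<and> x \<noteq> y}"
  have finP: "finite ?P" by (rule finite_subset[of _ "\<Lambda> \<times> \<Lambda>"]) (use fin in auto)
  \<comment> \<open>The errors of the flip probabilities count with total influence 3, those of the pairs with 6 each.\<close>
  define m where "m = 3 + 6 * real (card ?P)"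
  have m: "m > 0" unfolding m_def by (simp add: add_pos_nonneg)
  define \<delta> where "\<delta> = \<epsilon> / m"
  have d: "\<delta> > 0" "m * \<delta> = \<epsilon>" using e m by (auto simp: \<delta>_def)
  have "eventually (\<lambda>h. \<forall>x\<in>\<Lambda>. \<forall>\<eta>\<in>configs. \<bar>flip_prob h x \<eta> - h * c x \<eta>\<bar> \<le> h * \<delta>) (at_right 0)"
    by (intro eventually_ball_finite fin ballI flip_prob_limit d)
  moreover have "eventually (\<lambda>h. \<forall>p\<in>?P. \<forall>\<eta>\<in>configs. pair_flip_prob h (fst p) (snd p) \<eta> \<le> h * \<delta>) (at_right 0)"
    by (intro eventually_ball_finite finP ballI pair_flip_prob_limit d) auto
  ultimately have "eventually (\<lambda>h. (\<forall>x\<in>\<Lambda>. \<forall>\<eta>\<in>configs. \<bar>flip_prob h x \<eta> - h * c x \<eta>\<bar> \<le> h * \<delta>) \<and>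
     (\<forall>p\<in>?P. \<forall>\<eta>\<in>configs. pair_flip_prob h (fst p) (snd p) \<eta> \<le> h * \<delta>)) (at_right 0)"
    by (rule eventually_conj)
  then obtain h\<^sub>0 where h0: "h\<^sub>0 > 0"
    "\<And>h. 0 < h \<Longrightarrow> h < h\<^sub>0 \<Longrightarrow> (\<forall>x\<in>\<Lambda>. \<forall>\<eta>\<in>configs. \<bar>flip_prob h x \<eta> - h * c x \<eta>\<bar> \<le> h * \<delta>) \<and>
     (\<forall>p\<in>?P. \<forall>\<eta>\<in>configs. pair_flip_prob h (fst p) (snd p) \<eta> \<le> h * \<delta>)"
    unfolding eventually_at_right_field by auto
  show thesis
  proof (rule that[OF h0(1)])
    fix h z N A g and \<eta> :: "int \<Rightarrow> int"
    assume h: "0 < h" "h < h\<^sub>0" and N: "{x. \<bar>x - z\<bar> \<le> int N} \<subseteq> \<Lambda>"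
      and g: "smooth_at z A g" and c: "\<eta> \<in> configs"
    have A: "0 \<le> A" using smooth_atD(1)[OF g] .
    have h': "0 \<le> h" using h by simp
    let ?I = "\<lambda>x \<xi>. of_bool (\<xi> x \<noteq> \<eta> x) :: real"
    let ?d = "\<lambda>x. g (flip x \<eta>) - g \<eta>"
    let ?e = "\<lambda>\<xi>. g \<xi> - g \<eta> - (\<Sum>x\<in>\<Lambda>. ?d x * ?I x \<xi>)"
    note bo = bounded_obs_add bounded_obs_mult bounded_obs_sum bounded_obs_const bounded_obs_neq
      bounded_obs_diff smooth_at_bounded_obs[OF g]
    have act_e: "act h ?e \<eta> = act h g \<eta> - g \<eta> - (\<Sum>x\<in>\<Lambda>. ?d x * flip_prob h x \<eta>)"
      unfolding flip_prob_def
      by (simp only: act_diff act_sum act_cmult act_const bo h' c fin)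
    have main: "\<bar>act h ?e \<eta>\<bar> \<le> h * (A * (4 * (1/2) ^ N)) + 6 * A * (real (card ?P) * (h * \<delta>))"
    proof (rule field_le_epsilon)
      fix e' :: real assume "e' > 0"
      obtain M where M: "\<And>M' \<xi> \<eta>. M \<le> M' \<Longrightarrow> \<xi> \<in> configs \<Longrightarrow> \<eta> \<in> configs \<Longrightarrow>
         \<bar>g \<xi> - g \<eta>\<bar> \<le> A * (\<Sum>x\<in>{x\<in>window M'. \<xi> x \<noteq> \<eta> x}. wt z x) + e'"
        by (rule smooth_at_diff[OF g \<open>e' > 0\<close>]) blast
      let ?F = "window M - \<Lambda>"
      let ?b = "\<lambda>\<xi>. ((\<Sum>x\<in>?F. (A * wt z x) * ?I x \<xi>) + e') + 6 * A * (\<Sum>p\<in>?P. ?I (fst p) \<xi> * ?I (snd p) \<xi>)"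
      have "\<bar>?e \<xi>\<bar> \<le> ?b \<xi>" if x: "\<xi> \<in> configs" for \<xi>
      proof -
        let ?\<zeta> = "override_on \<eta> \<xi> \<Lambda>"
        have z: "?\<zeta> \<in> configs" using c x by simp
        have "(\<Sum>x\<in>{x\<in>window M. \<xi> x \<noteq> ?\<zeta> x}. wt z x) = (\<Sum>x\<in>?F. wt z x * ?I x \<xi>)"
          by (rule sum.mono_neutral_cong_left) (auto simp: override_on_def split: if_splits)
        then have "A * (\<Sum>x\<in>{x\<in>window M. \<xi> x \<noteq> ?\<zeta> x}. wt z x) = (\<Sum>x\<in>?F. (A * wt z x) * ?I x \<xi>)"
          by (simp only: sum_distrib_left mult.assoc)
        with M[OF order_refl x z] have 1: "\<bar>g \<xi> - g ?\<zeta>\<bar> \<le> (\<Sum>x\<in>?F. (A * wt z x) * ?I x \<xi>) + e'"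
          by simp
        have 2: "\<bar>g ?\<zeta> - g \<eta> - (\<Sum>x\<in>\<Lambda>. ?d x * ?I x \<xi>)\<bar> \<le> 6 * A * (\<Sum>p\<in>?P. ?I (fst p) \<xi> * ?I (snd p) \<xi>)"
          using smooth_at_linearization[OF g x c fin] unfolding case_prod_unfold by (simp only: mult.commute)
        have "?e \<xi> = (g \<xi> - g ?\<zeta>) + (g ?\<zeta> - g \<eta> - (\<Sum>x\<in>\<Lambda>. ?d x * ?I x \<xi>))" by simp
        then have "\<bar>?e \<xi>\<bar> \<le> \<bar>g \<xi> - g ?\<zeta>\<bar> + \<bar>g ?\<zeta> - g \<eta> - (\<Sum>x\<in>\<Lambda>. ?d x * ?I x \<xi>)\<bar>"
          by (simp only: abs_triangle_ineq)
        with add_mono[OF 1 2] show ?thesis by (rule order_trans[rotated])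
      qed
      then have "\<bar>act h ?e \<eta>\<bar> \<le> act h ?b \<eta>"
        using h' c fin finP by (intro act_abs_le bo) auto
      also have "act h ?b \<eta> = ((\<Sum>x\<in>?F. (A * wt z x) * flip_prob h x \<eta>) + e')
          + 6 * A * (\<Sum>p\<in>?P. pair_flip_prob h (fst p) (snd p) \<eta>)"
        unfolding flip_prob_def pair_flip_prob_def
        by (simp only: act_add act_sum act_cmult act_const bo h' c fin finP finite_Diff finite_atLeastAtMost_int)
      finally have 0: "\<bar>act h ?e \<eta>\<bar> \<le> ((\<Sum>x\<in>?F. (A * wt z x) * flip_prob h x \<eta>) + e')
          + 6 * A * (\<Sum>p\<in>?P. pair_flip_prob h (fst p) (snd p) \<eta>)" .
      have "(\<Sum>x\<in>?F. (A * wt z x) * flip_prob h x \<eta>) \<le> (\<Sum>x\<in>?F. (A * wt z x) * (2 * h))"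
        using A h' c by (intro sum_mono mult_left_mono flip_prob_le) auto
      also have "\<dots> = A * 2 * h * (\<Sum>x\<in>?F. wt z x)" by (simp add: sum_distrib_left mult_ac)
      also have "\<dots> \<le> A * 2 * h * (2 * (1/2) ^ N)"
      proof (intro mult_left_mono sum_wt_outside)
        show "\<forall>x\<in>?F. int N < \<bar>x - z\<bar>" using N by force
      qed (use A h' in auto)
      finally have 1: "(\<Sum>x\<in>?F. (A * wt z x) * flip_prob h x \<eta>) \<le> A * 2 * h * (2 * (1/2) ^ N)" .
      have "(\<Sum>p\<in>?P. pair_flip_prob h (fst p) (snd p) \<eta>) \<le> (\<Sum>p\<in>?P. h * \<delta>)"
        using h0(2)[OF h] c by (intro sum_mono) blast
      then have "6 * A * (\<Sum>p\<in>?P. pair_flip_prob h (fst p) (snd p) \<eta>) \<le> 6 * A * (real (card ?P) * (h * \<delta>))"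
        using A by (intro mult_left_mono) auto
      with 0 1 show "\<bar>act h ?e \<eta>\<bar> \<le> h * (A * (4 * (1/2) ^ N)) + 6 * A * (real (card ?P) * (h * \<delta>)) + e'"
        by (simp add: algebra_simps)
    qed
    have "\<bar>(\<Sum>x\<in>\<Lambda>. ?d x * flip_prob h x \<eta>) - h * (\<Sum>x\<in>\<Lambda>. c x \<eta> * ?d x)\<bar>
        = \<bar>\<Sum>x\<in>\<Lambda>. ?d x * (flip_prob h x \<eta> - h * c x \<eta>)\<bar>"
      by (simp add: sum_distrib_left sum_subtractf[symmetric] algebra_simps)
    also have "\<dots> \<le> (\<Sum>x\<in>\<Lambda>. \<bar>?d x\<bar> * \<bar>flip_prob h x \<eta> - h * c x \<eta>\<bar>)"
      by (rule order_trans[OF sum_abs]) (simp add: abs_mult)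
    also have "\<dots> \<le> (\<Sum>x\<in>\<Lambda>. (A * wt z x) * (h * \<delta>))"
      using h0(2)[OF h] c smooth_atD(2)[OF g c] A by (intro sum_mono mult_mono) auto
    also have "\<dots> = A * (h * \<delta>) * (\<Sum>x\<in>\<Lambda>. wt z x)" by (simp add: sum_distrib_left mult_ac)
    also have "\<dots> \<le> A * (h * \<delta>) * 3"
      using A h d fin by (intro mult_left_mono sum_wt_le_3) auto
    finally have second: "\<bar>(\<Sum>x\<in>\<Lambda>. ?d x * flip_prob h x \<eta>) - h * (\<Sum>x\<in>\<Lambda>. c x \<eta> * ?d x)\<bar> \<le> A * (h * \<delta>) * 3" .
    have "act h g \<eta> - step \<Lambda> h g \<eta> = act h ?e \<eta> + ((\<Sum>x\<in>\<Lambda>. ?d x * flip_prob h x \<eta>) - h * (\<Sum>x\<in>\<Lambda>. c x \<eta> * ?d x))"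
      unfolding act_e step_def by simp
    then have "\<bar>act h g \<eta> - step \<Lambda> h g \<eta>\<bar> \<le> \<bar>act h ?e \<eta>\<bar> + \<bar>(\<Sum>x\<in>\<Lambda>. ?d x * flip_prob h x \<eta>) - h * (\<Sum>x\<in>\<Lambda>. c x \<eta> * ?d x)\<bar>"
      by (simp only: abs_triangle_ineq)
    also have "\<dots> \<le> (h * (A * (4 * (1/2) ^ N)) + 6 * A * (real (card ?P) * (h * \<delta>))) + A * (h * \<delta>) * 3"
      by (rule add_mono[OF main second])
    also have "\<dots> = h * (A * (4 * (1/2) ^ N + m * \<delta>))" unfolding m_def by (simp add: algebra_simps)
    finally show "\<bar>act h g \<eta> - step \<Lambda> h g \<eta>\<bar> \<le> h * (A * (4 * (1/2) ^ N + \<epsilon>))" unfolding d(2) .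
  qed
qed

end

section \<open>Approximating the semigroup by elementary steps\<close>

context spin_flip_process
begin

text \<open>
  The flip rates of at most \<open>2 * R + 1\<close> vertices depend on the spin at a given vertex, and their weights
  exceed that of the vertex by a factor of at most \<open>2 ^ R\<close>.
\<close>

definition spread :: real where
  "spread = (2 * real R + 1) * 2 ^ R"

lemma spread_nonneg [simp]: "0 \<le> spread"
  by (simp add: spread_def)

lemma sum_rates_le:
  assumes "finite \<Lambda>" "\<eta> \<in> configs"
  shows "0 \<le> (\<Sum>x\<in>\<Lambda>. c x \<eta>)" "(\<Sum>x\<in>\<Lambda>. c x \<eta>) \<le> real (card \<Lambda>)"
proof -
  show "0 \<le> (\<Sum>x\<in>\<Lambda>. c x \<eta>)" using c_nonneg assms by (intro sum_nonneg) auto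
  have "(\<Sum>x\<in>\<Lambda>. c x \<eta>) \<le> (\<Sum>x\<in>\<Lambda>. 1)" using c_le_1 assms by (intro sum_mono) auto
  then show "(\<Sum>x\<in>\<Lambda>. c x \<eta>) \<le> real (card \<Lambda>)" by simp
qed

text \<open>
  For small \<open>h\<close> a step averages \<open>f\<close> over \<open>\<eta>\<close> and the configurations one flip away, with nonnegative
  weights of total mass one.
\<close>

lemma step_average:
  "step \<Lambda> h f \<eta> = (1 - h * (\<Sum>x\<in>\<Lambda>. c x \<eta>)) * f \<eta> + h * (\<Sum>x\<in>\<Lambda>. c x \<eta> * f (flip x \<eta>))"
  unfolding step_def by (simp add: algebra_simps sum_subtractf sum_distrib_left)

lemma step_mono:
  assumes fin: "finite \<Lambda>" and h: "0 \<le> h" "h * (real (card \<Lambda>) + 1) \<le> 1" and c: "\<eta> \<in> configs"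
    and le: "\<And>\<xi>. \<xi> \<in> configs \<Longrightarrow> f \<xi> \<le> g \<xi> + e"
  shows "step \<Lambda> h f \<eta> \<le> step \<Lambda> h g \<eta> + e"
proof -
  let ?s = "\<Sum>x\<in>\<Lambda>. c x \<eta>"
  have "h * ?s \<le> h * (real (card \<Lambda>) + 1)"
    using sum_rates_le[OF fin c] h by (intro mult_left_mono) auto
  then have s: "0 \<le> 1 - h * ?s" using h by linarith
  have "(1 - h * ?s) * f \<eta> \<le> (1 - h * ?s) * (g \<eta> + e)" using s le c by (intro mult_left_mono) auto
  moreover have "h * (\<Sum>x\<in>\<Lambda>. c x \<eta> * f (flip x \<eta>)) \<le> h * (\<Sum>x\<in>\<Lambda>. c x \<eta> * (g (flip x \<eta>) + e))"
    using h c c_nonneg le by (intro mult_left_mono sum_mono) auto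
  moreover have "h * (\<Sum>x\<in>\<Lambda>. c x \<eta> * (g (flip x \<eta>) + e)) = h * (\<Sum>x\<in>\<Lambda>. c x \<eta> * g (flip x \<eta>)) + h * ?s * e"
    by (simp add: distrib_left sum.distrib sum_distrib_right)
  ultimately show ?thesis unfolding step_average by (simp add: algebra_simps)
qed

text \<open>
  How the gradient at \<open>y\<close> is transported by one step: the first two terms average gradients at \<open>y\<close>,
  and the last one collects the vertices whose rates depend on the spin at \<open>y\<close>.
\<close>

lemma step_gradient:
  fixes f :: "(int \<Rightarrow> int) \<Rightarrow> real"
  assumes fin: "finite \<Lambda>" and h: "0 \<le> h" "h * (real (card \<Lambda>) + 1) \<le> 1" and c: "\<eta> \<in> configs"
  obtains a where "0 \<le> a" "a \<le> 1 - h * (\<Sum>x\<in>\<Lambda> - {y}. c x \<eta>)"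
    "step \<Lambda> h f (flip y \<eta>) - step \<Lambda> h f \<eta> = a * (f (flip y \<eta>) - f \<eta>)
      + h * (\<Sum>x\<in>\<Lambda> - {y}. c x \<eta> * (f (flip y (flip x \<eta>)) - f (flip x \<eta>)))
      + h * (\<Sum>x\<in>\<Lambda> - {y}. (c x (flip y \<eta>) - c x \<eta>) * (f (flip x (flip y \<eta>)) - f (flip y \<eta>)))"
proof -
  let ?\<zeta> = "flip y \<eta>"
  let ?L = "\<Lambda> - {y}"
  let ?d = "f ?\<zeta> - f \<eta>"
  define s where "s = (\<Sum>x\<in>?L. c x \<eta>)"
  \<comment> \<open>A flip at y itself exchanges the two configurations and so reduces the gradient.\<close>
  define k where "k = (if y \<in> \<Lambda> then c y ?\<zeta> + c y \<eta> else 0)"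
  have z: "?\<zeta> \<in> configs" using c by simp
  have k0: "0 \<le> k" using c_nonneg c z by (auto simp: k_def)
  have sL: "s \<le> real (card ?L)" unfolding s_def using sum_rates_le(2)[of ?L] fin c by auto
  have sk: "s + k \<le> real (card \<Lambda>) + 1"
  proof (cases "y \<in> \<Lambda>")
    case True
    then have "card \<Lambda> = Suc (card ?L)" using card_Suc_Diff1[OF fin True] by simp
    then have "real (card \<Lambda>) = real (card ?L) + 1" by simp
    moreover have "k \<le> 1 + 1"
      unfolding k_def using c_le_1[OF z, of y] c_le_1[OF c, of y] by simp
    ultimately show ?thesis using sL by linarith
  next
    case False
    then have "?L = \<Lambda>" "k = 0" by (auto simp: k_def)
    then show ?thesis using sL by simp
  qed
  have "h * (s + k) \<le> h * (real (card \<Lambda>) + 1)" using sk h by (intro mult_left_mono) auto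
  then have a0: "0 \<le> 1 - h * (s + k)" using h by linarith
  have a1: "1 - h * (s + k) \<le> 1 - h * s" using h k0 by (simp add: algebra_simps)
  let ?G = "\<lambda>x. c x ?\<zeta> * (f (flip x ?\<zeta>) - f ?\<zeta>) - c x \<eta> * (f (flip x \<eta>) - f \<eta>)"
  have "(\<Sum>x\<in>\<Lambda>. ?G x) = (\<Sum>x\<in>?L. ?G x) + (if y \<in> \<Lambda> then ?G y else 0)"
    using fin by (auto simp: sum.remove[of \<Lambda> y])
  also have "(if y \<in> \<Lambda> then ?G y else 0) = - k * ?d" unfolding k_def by (simp add: algebra_simps)
  also have "(\<Sum>x\<in>?L. ?G x) = (\<Sum>x\<in>?L. c x \<eta> * (f (flip y (flip x \<eta>)) - f (flip x \<eta>))
      + (c x ?\<zeta> - c x \<eta>) * (f (flip x ?\<zeta>) - f ?\<zeta>) - c x \<eta> * ?d)"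
    by (intro sum.cong) (auto simp: flip_commute[of y] algebra_simps)
  also have "\<dots> = (\<Sum>x\<in>?L. c x \<eta> * (f (flip y (flip x \<eta>)) - f (flip x \<eta>)))
      + (\<Sum>x\<in>?L. (c x ?\<zeta> - c x \<eta>) * (f (flip x ?\<zeta>) - f ?\<zeta>)) - s * ?d"
    unfolding s_def by (simp only: sum.distrib sum_subtractf sum_distrib_right)
  finally have G: "(\<Sum>x\<in>\<Lambda>. ?G x) = (\<Sum>x\<in>?L. c x \<eta> * (f (flip y (flip x \<eta>)) - f (flip x \<eta>)))
      + (\<Sum>x\<in>?L. (c x ?\<zeta> - c x \<eta>) * (f (flip x ?\<zeta>) - f ?\<zeta>)) - s * ?d + - k * ?d" .
  have "step \<Lambda> h f ?\<zeta> - step \<Lambda> h f \<eta> = ?d + h * (\<Sum>x\<in>\<Lambda>. ?G x)"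
    unfolding step_def by (simp only: sum_subtractf) (simp add: algebra_simps)
  also have "\<dots> = (1 - h * (s + k)) * ?d
      + h * (\<Sum>x\<in>?L. c x \<eta> * (f (flip y (flip x \<eta>)) - f (flip x \<eta>)))
      + h * (\<Sum>x\<in>?L. (c x ?\<zeta> - c x \<eta>) * (f (flip x ?\<zeta>) - f ?\<zeta>))"
    unfolding G by (simp add: distrib_left distrib_right left_diff_distrib right_diff_distrib mult.assoc)
  finally show thesis using a1 unfolding s_def by (intro that[OF a0[unfolded s_def]])
qed

lemma step_smooth:
  assumes f: "smooth_at z A f" and fin: "finite \<Lambda>" and h: "0 \<le> h" "h * (real (card \<Lambda>) + 1) \<le> 1"
  shows "smooth_at z (A * (1 + h * spread)) (step \<Lambda> h f)"
  unfolding smooth_at_def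
proof (intro conjI ballI allI impI)
  have A: "0 \<le> A" by (rule smooth_atD(1)[OF f])
  then show "0 \<le> A * (1 + h * spread)" using h by simp
  fix \<eta> :: "int \<Rightarrow> int" and y assume c: "\<eta> \<in> configs"
  then have z: "flip y \<eta> \<in> configs" by simp
  obtain a where a: "0 \<le> a" "a \<le> 1 - h * (\<Sum>x\<in>\<Lambda> - {y}. c x \<eta>)"
    and eq: "step \<Lambda> h f (flip y \<eta>) - step \<Lambda> h f \<eta> = a * (f (flip y \<eta>) - f \<eta>)
      + h * (\<Sum>x\<in>\<Lambda> - {y}. c x \<eta> * (f (flip y (flip x \<eta>)) - f (flip x \<eta>)))
      + h * (\<Sum>x\<in>\<Lambda> - {y}. (c x (flip y \<eta>) - c x \<eta>) * (f (flip x (flip y \<eta>)) - f (flip y \<eta>)))"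
    by (rule step_gradient[OF fin h c, of y f])
  have "\<bar>a * (f (flip y \<eta>) - f \<eta>)\<bar> \<le> (1 - h * (\<Sum>x\<in>\<Lambda> - {y}. c x \<eta>)) * (A * wt z y)"
    unfolding abs_mult using a smooth_atD(2)[OF f c] by (intro mult_mono) auto
  moreover have "\<bar>h * (\<Sum>x\<in>\<Lambda> - {y}. c x \<eta> * (f (flip y (flip x \<eta>)) - f (flip x \<eta>)))\<bar>
      \<le> h * ((\<Sum>x\<in>\<Lambda> - {y}. c x \<eta>) * (A * wt z y))"
  proof -
    have "\<bar>\<Sum>x\<in>\<Lambda> - {y}. c x \<eta> * (f (flip y (flip x \<eta>)) - f (flip x \<eta>))\<bar>
        \<le> (\<Sum>x\<in>\<Lambda> - {y}. c x \<eta> * (A * wt z y))"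
      using smooth_atD(2)[OF f flip_configs[OF c]] c_nonneg[OF c]
      by (intro order_trans[OF sum_abs] sum_mono) (simp add: abs_mult mult_left_mono)
    then show ?thesis using h by (simp add: abs_mult sum_distrib_right mult_left_mono)
  qed
  moreover have "\<bar>h * (\<Sum>x\<in>\<Lambda> - {y}. (c x (flip y \<eta>) - c x \<eta>) * (f (flip x (flip y \<eta>)) - f (flip y \<eta>)))\<bar>
      \<le> h * (spread * (A * wt z y))"
  proof -
    let ?N = "{y - int R..y + int R}"
    let ?g = "\<lambda>x. (c x (flip y \<eta>) - c x \<eta>) * (f (flip x (flip y \<eta>)) - f (flip y \<eta>))"
    have zero: "?g x = 0" if "x \<notin> ?N" for x
    proof -
      have "c x (flip y \<eta>) = c x \<eta>"
        using that by (intro c_local z c) (auto simp: flip_def)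
      then show ?thesis by simp
    qed
    have restrict: "(\<Sum>x\<in>\<Lambda> - {y}. ?g x) = (\<Sum>x\<in>(\<Lambda> - {y}) \<inter> ?N. ?g x)"
      by (intro sum.mono_neutral_right ballI zero finite_Diff fin) blast+
    have "\<bar>\<Sum>x\<in>\<Lambda> - {y}. ?g x\<bar> \<le> (\<Sum>x\<in>(\<Lambda> - {y}) \<inter> ?N. \<bar>?g x\<bar>)"
      unfolding restrict by (rule sum_abs)
    also have "\<dots> \<le> (\<Sum>x\<in>(\<Lambda> - {y}) \<inter> ?N. 2 ^ R * (A * wt z y))"
    proof (intro sum_mono)
      fix x assume x: "x \<in> (\<Lambda> - {y}) \<inter> ?N"
      have "\<bar>c x (flip y \<eta>) - c x \<eta>\<bar> \<le> 1"
        using c_nonneg[OF c, of x] c_nonneg[OF z, of x] c_le_1[OF c, of x] c_le_1[OF z, of x] by linarith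
      then have "\<bar>?g x\<bar> \<le> 1 * (A * wt z x)"
        unfolding abs_mult using smooth_atD(2)[OF f z] by (intro mult_mono) auto
      also have "\<dots> \<le> A * (2 ^ R * wt z y)"
        using x A by (auto intro!: mult_left_mono wt_neighbour)
      finally show "\<bar>?g x\<bar> \<le> 2 ^ R * (A * wt z y)" by (simp add: mult_ac)
    qed
    also have "\<dots> = real (card ((\<Lambda> - {y}) \<inter> ?N)) * (2 ^ R * (A * wt z y))" by simp
    also have "\<dots> \<le> real (card ?N) * (2 ^ R * (A * wt z y))"
      using A by (intro mult_right_mono of_nat_mono card_mono) auto
    also have "\<dots> = spread * (A * wt z y)" unfolding spread_def by simp
    finally show ?thesis using h by (simp add: abs_mult mult_left_mono)
  qed
  ultimately show "\<bar>step \<Lambda> h f (flip y \<eta>) - step \<Lambda> h f \<eta>\<bar> \<le> A * (1 + h * spread) * wt z y"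
    unfolding eq
    by (intro order_trans[OF abs_triangle_ineq] order_trans[OF add_right_mono[OF abs_triangle_ineq]])
       (simp add: algebra_simps)
next
  fix \<epsilon> :: real assume "0 < \<epsilon>"
  then obtain N where N: "\<And>\<xi> \<eta>. \<xi>\<in>configs \<Longrightarrow> \<eta>\<in>configs \<Longrightarrow> (\<forall>x\<in>window N. \<xi> x = \<eta> x) \<Longrightarrow> \<bar>f \<xi> - f \<eta>\<bar> \<le> \<epsilon>"
    using smooth_atD(3)[OF f] by blast
  obtain M where M: "\<forall>x\<in>\<Lambda>. nat \<bar>x\<bar> \<le> M"
    using finite_nat_set_iff_bounded_le[of "(\<lambda>x. nat \<bar>x\<bar>) ` \<Lambda>"] fin by auto
  show "\<exists>N. \<forall>\<xi>\<in>configs. \<forall>\<eta>\<in>configs. (\<forall>x\<in>window N. \<xi> x = \<eta> x) \<longrightarrow> \<bar>step \<Lambda> h f \<xi> - step \<Lambda> h f \<eta>\<bar> \<le> \<epsilon>"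
  proof (intro exI[of _ "N + M + R"] ballI impI)
    fix \<xi> \<eta> assume c: "\<xi> \<in> configs" "\<eta> \<in> configs" and ag: "\<forall>x\<in>window (N + M + R). \<xi> x = \<eta> x"
    have cc: "c x \<xi> = c x \<eta>" if "x \<in> \<Lambda>" for x
    proof (rule c_local[OF c])
      fix y assume "\<bar>y - x\<bar> \<le> int R"
      moreover have "\<bar>x\<bar> \<le> int M" using M that by auto
      ultimately have "y \<in> window (N + M + R)" by auto
      then show "\<xi> y = \<eta> y" using ag by blast
    qed
    have ag': "\<forall>x\<in>window N. \<xi> x = \<eta> x" using ag by auto
    have d0: "\<bar>f \<xi> - f \<eta>\<bar> \<le> \<epsilon>" using N[OF c ag'] .
    have d: "\<bar>f (flip x \<xi>) - f (flip x \<eta>)\<bar> \<le> \<epsilon>" for x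
      using ag' by (intro N[OF flip_configs[OF c(1)] flip_configs[OF c(2)]]) (auto simp: flip_def)
    let ?s = "\<Sum>x\<in>\<Lambda>. c x \<eta>"
    have "h * ?s \<le> h * (real (card \<Lambda>) + 1)"
      using sum_rates_le[OF fin c(2)] h by (intro mult_left_mono) auto
    then have s: "0 \<le> 1 - h * ?s" using h by linarith
    have eq: "step \<Lambda> h f \<xi> - step \<Lambda> h f \<eta> = (1 - h * ?s) * (f \<xi> - f \<eta>)
        + h * (\<Sum>x\<in>\<Lambda>. c x \<eta> * (f (flip x \<xi>) - f (flip x \<eta>)))"
      unfolding step_average using cc by (simp add: right_diff_distrib sum_subtractf)
    have "\<bar>step \<Lambda> h f \<xi> - step \<Lambda> h f \<eta>\<bar> \<le> (1 - h * ?s) * \<epsilon> + h * (?s * \<epsilon>)"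
      unfolding eq
    proof (intro order_trans[OF abs_triangle_ineq] add_mono)
      show "\<bar>(1 - h * ?s) * (f \<xi> - f \<eta>)\<bar> \<le> (1 - h * ?s) * \<epsilon>"
        using s d0 by (simp add: abs_mult mult_left_mono)
      have "\<bar>\<Sum>x\<in>\<Lambda>. c x \<eta> * (f (flip x \<xi>) - f (flip x \<eta>))\<bar> \<le> (\<Sum>x\<in>\<Lambda>. c x \<eta> * \<epsilon>)"
        using d c_nonneg[OF c(2)]
        by (intro order_trans[OF sum_abs] sum_mono) (simp add: abs_mult mult_left_mono)
      then show "\<bar>h * (\<Sum>x\<in>\<Lambda>. c x \<eta> * (f (flip x \<xi>) - f (flip x \<eta>)))\<bar> \<le> h * (?s * \<epsilon>)"
        using h by (simp add: abs_mult sum_distrib_right mult_left_mono)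
    qed
    also have "\<dots> = \<epsilon>" by (simp add: algebra_simps)
    finally show "\<bar>step \<Lambda> h f \<xi> - step \<Lambda> h f \<eta>\<bar> \<le> \<epsilon>" .
  qed
qed

abbreviation steps :: "int set \<Rightarrow> real \<Rightarrow> nat \<Rightarrow> ((int \<Rightarrow> int) \<Rightarrow> real) \<Rightarrow> (int \<Rightarrow> int) \<Rightarrow> real" where
  "steps \<Lambda> h n \<equiv> step \<Lambda> h ^^ n"

lemma steps_smooth:
  assumes f: "smooth_at z A f" and fin: "finite \<Lambda>" and h: "0 \<le> h" "h * (real (card \<Lambda>) + 1) \<le> 1"
  shows "smooth_at z (A * exp (real n * h * spread)) (steps \<Lambda> h n f)"
proof -
  have "smooth_at z (A * (1 + h * spread) ^ n) (steps \<Lambda> h n f)"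
  proof (induction n)
    case (Suc n)
    from step_smooth[OF this fin h] show ?case by (simp add: mult_ac)
  qed (use f in simp)
  moreover have "(1 + h * spread) ^ n \<le> exp (h * spread) ^ n"
    using h by (intro power_mono) auto
  then have "A * (1 + h * spread) ^ n \<le> A * exp (real n * h * spread)"
    using smooth_atD(1)[OF f] by (intro mult_left_mono) (auto simp: exp_of_nat_mult[symmetric] mult.assoc)
  ultimately show ?thesis by (rule smooth_at_mono)
qed

text \<open>
  Convergence as first the number of steps tends to infinity and then \<open>\<Lambda>\<close> exhausts the vertices.
  Arbitrary finite sets are allowed for \<open>\<Lambda>\<close>, so that \<open>\<Lambda>\<close> may be translated.
\<close>

definition eventually_steps :: "(int set \<Rightarrow> nat \<Rightarrow> bool) \<Rightarrow> bool" where
  "eventually_steps Q \<longleftrightarrow> (\<exists>N. \<forall>\<Lambda>. finite \<Lambda> \<longrightarrow> window N \<subseteq> \<Lambda> \<longrightarrow> (\<exists>m. \<forall>n\<ge>m. Q \<Lambda> n))"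

lemma eventually_steps_conj:
  assumes "eventually_steps P" "eventually_steps Q"
  shows "eventually_steps (\<lambda>\<Lambda> n. P \<Lambda> n \<and> Q \<Lambda> n)"
proof -
  obtain N where N: "\<And>\<Lambda>. finite \<Lambda> \<Longrightarrow> window N \<subseteq> \<Lambda> \<Longrightarrow> \<exists>m. \<forall>n\<ge>m. P \<Lambda> n"
    using assms(1) unfolding eventually_steps_def by blast
  obtain N' where N': "\<And>\<Lambda>. finite \<Lambda> \<Longrightarrow> window N' \<subseteq> \<Lambda> \<Longrightarrow> \<exists>m. \<forall>n\<ge>m. Q \<Lambda> n"
    using assms(2) unfolding eventually_steps_def by blast
  show ?thesis unfolding eventually_steps_def
  proof (rule exI[of _ "N + N'"], intro allI impI)
    fix \<Lambda> :: "int set" assume L: "finite \<Lambda>" "window (N + N') \<subseteq> \<Lambda>"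
    have "window N \<subseteq> window (N + N')" "window N' \<subseteq> window (N + N')" by auto
    then have "window N \<subseteq> \<Lambda>" "window N' \<subseteq> \<Lambda>" using L(2) by blast+
    then obtain m m' where "\<forall>n\<ge>m. P \<Lambda> n" "\<forall>n\<ge>m'. Q \<Lambda> n" using N[OF L(1)] N'[OF L(1)] by blast
    then show "\<exists>m. \<forall>n\<ge>m. P \<Lambda> n \<and> Q \<Lambda> n" by (intro exI[of _ "max m m'"]) auto
  qed
qed

lemma eventually_steps_mono:
  "eventually_steps P \<Longrightarrow> (\<And>\<Lambda> n. P \<Lambda> n \<Longrightarrow> Q \<Lambda> n) \<Longrightarrow> eventually_steps Q"
  unfolding eventually_steps_def by meson

lemma eventually_steps_finite: "eventually_steps (\<lambda>\<Lambda> n. finite \<Lambda>)"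
  unfolding eventually_steps_def by blast

lemma eventually_steps_small:
  assumes "0 \<le> t" "0 < e"
  shows "eventually_steps (\<lambda>\<Lambda> n. t / real n * (real (card \<Lambda>) + 1) \<le> 1 \<and> t / real n \<le> e \<and> 0 < n)"
  unfolding eventually_steps_def
proof (rule exI[of _ 0], intro allI impI)
  fix \<Lambda> :: "int set"
  obtain m :: nat where m: "t * (real (card \<Lambda>) + 1) + t / e + 1 \<le> real m" using real_arch_simple by blast
  have m1: "t * (real (card \<Lambda>) + 1) \<le> real m" "t / e \<le> real m" "1 \<le> real m"
  proof -
    have "0 \<le> t * (real (card \<Lambda>) + 1)" "0 \<le> t / e" using assms by auto
    then show "t * (real (card \<Lambda>) + 1) \<le> real m" "t / e \<le> real m" "1 \<le> real m" using m by linarith+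
  qed
  show "\<exists>m. \<forall>n\<ge>m. t / real n * (real (card \<Lambda>) + 1) \<le> 1 \<and> t / real n \<le> e \<and> 0 < n"
  proof (intro exI[of _ m] allI impI)
    fix n assume "m \<le> n"
    then have n: "t * (real (card \<Lambda>) + 1) \<le> real n" "t / e \<le> real n" "0 < n"
      using m1 by (auto intro: order_trans)
    then show "t / real n * (real (card \<Lambda>) + 1) \<le> 1 \<and> t / real n \<le> e \<and> 0 < n"
      using assms(2) by (simp add: field_simps)
  qed
qed

lemma eventually_steps_ex: "eventually_steps P \<Longrightarrow> \<exists>\<Lambda> n. P \<Lambda> n"
  unfolding eventually_steps_def by (meson finite_atLeastAtMost_int order_refl)

lemma eventually_steps_translate:
  assumes "eventually_steps P"
  shows "eventually_steps (\<lambda>\<Lambda> n. P ((\<lambda>x. x + l) ` \<Lambda>) n)"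
proof -
  obtain N where N: "\<And>\<Lambda>. finite \<Lambda> \<Longrightarrow> window N \<subseteq> \<Lambda> \<Longrightarrow> \<exists>m. \<forall>n\<ge>m. P \<Lambda> n"
    using assms unfolding eventually_steps_def by blast
  show ?thesis unfolding eventually_steps_def
  proof (rule exI[of _ "N + nat \<bar>l\<bar>"], intro allI impI N)
    fix \<Lambda> :: "int set" assume L: "window (N + nat \<bar>l\<bar>) \<subseteq> \<Lambda>"
    show "window N \<subseteq> (\<lambda>x. x + l) ` \<Lambda>"
    proof
      fix y assume "y \<in> window N"
      then have "y - l \<in> window (N + nat \<bar>l\<bar>)" by auto
      then show "y \<in> (\<lambda>x. x + l) ` \<Lambda>" using L by force
    qed
  qed auto
qed

text \<open>
  The one-step errors \<open>K\<^sub>h g - step \<Lambda> h g\<close> are proportional to \<open>h\<close>, with a factor that depends on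
  \<open>g\<close> only through its decay constant. All iterates of \<open>f\<close> have decay constants below
  \<open>A * exp (t * spread)\<close>, so the errors of the \<open>n\<close> steps add up to a small total.
\<close>

theorem act_approx:
  assumes f: "smooth_at z A f" and t: "0 \<le> t" and e: "0 < e"
  shows "eventually_steps (\<lambda>\<Lambda> n. \<forall>\<eta>\<in>configs. \<bar>act t f \<eta> - steps \<Lambda> (t / real n) n f \<eta>\<bar> \<le> e)"
proof (cases "t = 0")
  case True
  have "step \<Lambda> 0 f = f" for \<Lambda> f by (simp add: step_def fun_eq_iff)
  then have "steps \<Lambda> 0 n f = f" for \<Lambda> n by (induction n) auto
  then show ?thesis
    using True e act_0[OF _ smooth_at_bounded_obs[OF f]] by (simp add: eventually_steps_def)
next
  case False
  then have t: "0 < t" using t by simp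
  define B where "B = A * exp (t * spread) + 1"
  have A: "0 \<le> A" using smooth_atD(1)[OF f] .
  then have B: "0 < B" by (simp add: B_def add_nonneg_pos)
  \<comment> \<open>All n steps together must not err by more than e, and each of them errs by at most 2 \<epsilon> B t / n.\<close>
  define \<epsilon> where "\<epsilon> = e / (2 * t * B)"
  have eps: "0 < \<epsilon>" using e t B by (simp add: \<epsilon>_def)
  obtain N where "(1/2::real) ^ N < \<epsilon> / 4" using real_arch_pow_inv[of "\<epsilon> / 4" "1/2"] eps by auto
  then have N: "4 * (1/2::real) ^ N \<le> \<epsilon>" by simp
  show ?thesis unfolding eventually_steps_def
  proof (rule exI[of _ "N + nat \<bar>z\<bar>"], intro allI impI)
    fix \<Lambda> :: "int set" assume fin: "finite \<Lambda>" and L: "window (N + nat \<bar>z\<bar>) \<subseteq> \<Lambda>"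
    have "{x. \<bar>x - z\<bar> \<le> int N} \<subseteq> window (N + nat \<bar>z\<bar>)" by auto
    then have sub: "{x. \<bar>x - z\<bar> \<le> int N} \<subseteq> \<Lambda>" using L by (rule order_trans)
    obtain h\<^sub>0 where h0: "h\<^sub>0 > 0"
      and gen: "\<And>h z N A g \<eta>. 0 < h \<Longrightarrow> h < h\<^sub>0 \<Longrightarrow> {x. \<bar>x - z\<bar> \<le> int N} \<subseteq> \<Lambda> \<Longrightarrow> smooth_at z A g \<Longrightarrow>
        \<eta> \<in> configs \<Longrightarrow> \<bar>act h g \<eta> - step \<Lambda> h g \<eta>\<bar> \<le> h * (A * (4 * (1/2) ^ N + \<epsilon>))"
      by (rule generator_estimate[OF fin eps]) blast
    obtain m :: nat where m: "t * (real (card \<Lambda>) + 1) + t / h\<^sub>0 + 1 < real m" using reals_Archimedean2 by blast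
    have m1: "t * (real (card \<Lambda>) + 1) \<le> real m" "t / h\<^sub>0 < real m" "1 \<le> real m"
    proof -
      have "0 \<le> t * (real (card \<Lambda>) + 1)" "0 \<le> t / h\<^sub>0" using t h0 by auto
      then show "t * (real (card \<Lambda>) + 1) \<le> real m" "t / h\<^sub>0 < real m" "1 \<le> real m" using m by linarith+
    qed
    show "\<exists>m. \<forall>n\<ge>m. \<forall>\<eta>\<in>configs. \<bar>act t f \<eta> - steps \<Lambda> (t / real n) n f \<eta>\<bar> \<le> e"
    proof (intro exI[of _ m] allI impI)
      fix n assume "m \<le> n"
      then have mn: "real m \<le> real n" by simp
      have n: "t * (real (card \<Lambda>) + 1) \<le> real n" "t / h\<^sub>0 < real n" "0 < real n"
        using order_trans[OF m1(1) mn] less_le_trans[OF m1(2) mn] order_trans[OF m1(3) mn] by auto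
      define h where "h = t / real n"
      have h: "0 < h" "h < h\<^sub>0" "h * (real (card \<Lambda>) + 1) \<le> 1" "real n * h = t"
        using n t h0 by (auto simp: h_def field_simps)
      have "\<forall>\<eta>\<in>configs. \<bar>act (real k * h) f \<eta> - steps \<Lambda> h k f \<eta>\<bar> \<le> real k * (h * (B * (2 * \<epsilon>)))"
        if "k \<le> n" for k
        using that
      proof (induction k)
        case 0
        then show ?case using act_0[OF _ smooth_at_bounded_obs[OF f]] by simp
      next
        case (Suc k)
        show ?case
        proof
          fix \<eta> :: "int \<Rightarrow> int" assume c: "\<eta> \<in> configs"
          have hk: "0 \<le> real k * h" using h by simp
          have sm: "smooth_at z (A * exp (real k * h * spread)) (steps \<Lambda> h k f)"
            using h by (intro steps_smooth f fin) auto
          have "real k * h \<le> t" using Suc.prems h by (metis less_imp_le mult_right_mono of_nat_le_iff Suc_leD)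
          then have "A * exp (real k * h * spread) \<le> A * exp (t * spread)"
            using A by (intro mult_left_mono) (auto intro: mult_right_mono)
          then have smB: "smooth_at z B (steps \<Lambda> h k f)" unfolding B_def by (intro smooth_at_mono[OF sm]) linarith
          have "act (real (Suc k) * h) f \<eta> = act (h + real k * h) f \<eta>" by (simp add: algebra_simps)
          also have "\<dots> = act h (act (real k * h) f) \<eta>"
            using h hk c by (intro act_semigroup smooth_at_bounded_obs[OF f]) auto
          finally have eq: "act (real (Suc k) * h) f \<eta> = act h (act (real k * h) f) \<eta>" .
          have 1: "\<bar>act h (act (real k * h) f) \<eta> - act h (steps \<Lambda> h k f) \<eta>\<bar> \<le> real k * (h * (B * (2 * \<epsilon>)))"
            using h hk c Suc
            by (intro act_close bounded_obs_act smooth_at_bounded_obs[OF f] smooth_at_bounded_obs[OF smB]) auto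
          have "\<bar>act h (steps \<Lambda> h k f) \<eta> - step \<Lambda> h (steps \<Lambda> h k f) \<eta>\<bar> \<le> h * (B * (4 * (1/2) ^ N + \<epsilon>))"
            by (rule gen[OF h(1,2) sub smB c])
          also have "\<dots> \<le> h * (B * (2 * \<epsilon>))" using N h B by (intro mult_left_mono) auto
          finally have 2: "\<bar>act h (steps \<Lambda> h k f) \<eta> - step \<Lambda> h (steps \<Lambda> h k f) \<eta>\<bar> \<le> h * (B * (2 * \<epsilon>))" .
          show "\<bar>act (real (Suc k) * h) f \<eta> - steps \<Lambda> h (Suc k) f \<eta>\<bar> \<le> real (Suc k) * (h * (B * (2 * \<epsilon>)))"
            unfolding eq using abs_diff_triangle[OF 1 2] by (simp add: distrib_right)
        qed
      qed
      from this[of n]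
      have "\<forall>\<eta>\<in>configs. \<bar>act (real n * h) f \<eta> - steps \<Lambda> h n f \<eta>\<bar> \<le> real n * (h * (B * (2 * \<epsilon>)))"
        by simp
      moreover have "real n * (h * (B * (2 * \<epsilon>))) = e"
        unfolding mult.assoc[symmetric, of "real n" h] h(4) \<epsilon>_def using t B by simp
      ultimately show "\<forall>\<eta>\<in>configs. \<bar>act t f \<eta> - steps \<Lambda> (t / real n) n f \<eta>\<bar> \<le> e"
        unfolding h(4) h_def[symmetric] by simp
    qed
  qed
qed

end

section \<open>Regularity, monotonicity, correlations and symmetries of the semigroup\<close>

text \<open>
  A bound for \<open>\<Sum>x. wt z x * wt z' x\<close>: the total overlap of the influences on two observables centred at
  \<open>z\<close> and \<open>z'\<close>.
\<close>

definition decorrelation :: "int \<Rightarrow> int \<Rightarrow> real" where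
  "decorrelation z z' = 6 * (1/2) ^ (nat \<bar>z - z'\<bar> div 2)"

lemma decorrelation_nonneg [simp]: "0 \<le> decorrelation z z'"
  by (simp add: decorrelation_def)

definition negate :: "('v \<Rightarrow> int) \<Rightarrow> 'v \<Rightarrow> int" where
  "negate \<eta> = (\<lambda>v. - \<eta> v)"

definition translate :: "int \<Rightarrow> (int \<Rightarrow> int) \<Rightarrow> int \<Rightarrow> int" where
  "translate l \<eta> = (\<lambda>v. \<eta> (v + l))"

lemma negate_configs [simp]: "\<eta> \<in> configs \<Longrightarrow> negate \<eta> \<in> configs"
  by (auto simp: configs_def negate_def)

lemma translate_configs [simp]: "\<eta> \<in> configs \<Longrightarrow> translate l \<eta> \<in> configs"
  by (auto simp: configs_def translate_def)

lemma negate_flip: "negate (flip x \<eta>) = flip x (negate \<eta>)"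
  by (auto simp: negate_def flip_def)

lemma translate_flip: "translate l (flip x \<eta>) = flip (x - l) (translate l \<eta>)"
  by (auto simp: translate_def flip_def fun_eq_iff)

lemma smooth_at_negate:
  assumes f: "smooth_at z A f"
  shows "smooth_at z A (\<lambda>\<eta>. f (negate \<eta>))"
  unfolding smooth_at_def
proof (intro conjI ballI allI impI)
  show "0 \<le> A" by (rule smooth_atD(1)[OF f])
  show "\<bar>f (negate (flip x \<eta>)) - f (negate \<eta>)\<bar> \<le> A * wt z x" if "\<eta> \<in> configs" for \<eta> x
    unfolding negate_flip using that by (intro smooth_atD(2)[OF f]) simp
  fix \<epsilon> :: real assume "0 < \<epsilon>"
  then obtain N where N: "\<And>\<xi> \<eta>. \<xi>\<in>configs \<Longrightarrow> \<eta>\<in>configs \<Longrightarrow> (\<forall>x\<in>window N. \<xi> x = \<eta> x) \<Longrightarrow> \<bar>f \<xi> - f \<eta>\<bar> \<le> \<epsilon>"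
    using smooth_atD(3)[OF f] by blast
  show "\<exists>N. \<forall>\<xi>\<in>configs. \<forall>\<eta>\<in>configs. (\<forall>x\<in>window N. \<xi> x = \<eta> x) \<longrightarrow> \<bar>f (negate \<xi>) - f (negate \<eta>)\<bar> \<le> \<epsilon>"
    by (intro exI[of _ N] ballI impI N negate_configs) (simp_all add: negate_def)
qed

lemma smooth_at_translate:
  assumes f: "smooth_at z A f"
  shows "smooth_at (z + l) A (\<lambda>\<eta>. f (translate l \<eta>))"
  unfolding smooth_at_def
proof (intro conjI ballI allI impI)
  show "0 \<le> A" by (rule smooth_atD(1)[OF f])
  fix \<eta> :: "int \<Rightarrow> int" and x assume "\<eta> \<in> configs"
  then have "\<bar>f (flip (x - l) (translate l \<eta>)) - f (translate l \<eta>)\<bar> \<le> A * wt z (x - l)"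
    by (intro smooth_atD(2)[OF f]) simp
  moreover have "wt z (x - l) = wt (z + l) x" by (simp add: wt_def algebra_simps)
  ultimately show "\<bar>f (translate l (flip x \<eta>)) - f (translate l \<eta>)\<bar> \<le> A * wt (z + l) x"
    unfolding translate_flip by simp
next
  fix \<epsilon> :: real assume "0 < \<epsilon>"
  then obtain N where N: "\<And>\<xi> \<eta>. \<xi>\<in>configs \<Longrightarrow> \<eta>\<in>configs \<Longrightarrow> (\<forall>x\<in>window N. \<xi> x = \<eta> x) \<Longrightarrow> \<bar>f \<xi> - f \<eta>\<bar> \<le> \<epsilon>"
    using smooth_atD(3)[OF f] by blast
  show "\<exists>N. \<forall>\<xi>\<in>configs. \<forall>\<eta>\<in>configs. (\<forall>x\<in>window N. \<xi> x = \<eta> x) \<longrightarrow> \<bar>f (translate l \<xi>) - f (translate l \<eta>)\<bar> \<le> \<epsilon>"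
  proof (intro exI[of _ "N + nat \<bar>l\<bar>"] ballI impI N translate_configs)
    fix \<xi> \<eta> :: "int \<Rightarrow> int" and x
    assume ag: "\<forall>x\<in>window (N + nat \<bar>l\<bar>). \<xi> x = \<eta> x" and "x \<in> window N"
    then have "x + l \<in> window (N + nat \<bar>l\<bar>)" by auto
    with ag have "\<xi> (x + l) = \<eta> (x + l)" by blast
    then show "translate l \<xi> x = translate l \<eta> x" by (simp add: translate_def)
  qed
qed

context spin_flip_process
begin

lemma act_smooth:
  assumes f: "smooth_at z A f" and t: "0 \<le> t"
  shows "smooth_at z (A * exp (t * spread)) (act t f)"
proof (rule smooth_at_uniform_limit)
  fix e :: real assume e: "0 < e"
  obtain \<Lambda> n where ap: "\<forall>\<eta>\<in>configs. \<bar>act t f \<eta> - steps \<Lambda> (t / real n) n f \<eta>\<bar> \<le> e"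
    and fin: "finite \<Lambda>" and n: "t / real n * (real (card \<Lambda>) + 1) \<le> 1" "0 < n"
    using eventually_steps_ex[OF eventually_steps_conj[OF act_approx[OF f t e]
      eventually_steps_conj[OF eventually_steps_finite eventually_steps_small[OF t e]]]] by blast
  have "smooth_at z (A * exp (real n * (t / real n) * spread)) (steps \<Lambda> (t / real n) n f)"
    using t n by (intro steps_smooth f fin) auto
  then have "smooth_at z (A * exp (t * spread)) (steps \<Lambda> (t / real n) n f)" using n by simp
  with ap show "\<exists>g. smooth_at z (A * exp (t * spread)) g \<and> (\<forall>\<eta>\<in>configs. \<bar>act t f \<eta> - g \<eta>\<bar> \<le> e)" by blast
qed

lemma eventually_steps_ball:
  assumes "finite S" "\<And>f. f \<in> S \<Longrightarrow> eventually_steps (P f)"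
  shows "eventually_steps (\<lambda>\<Lambda> n. \<forall>f\<in>S. P f \<Lambda> n)"
  using assms
proof (induction S rule: finite_induct)
  case empty
  then show ?case by (simp add: eventually_steps_def)
next
  case (insert a S)
  have "eventually_steps (\<lambda>\<Lambda> n. P a \<Lambda> n \<and> (\<forall>f\<in>S. P f \<Lambda> n))"
    using insert by (intro eventually_steps_conj) auto
  then show ?case by (rule eventually_steps_mono) auto
qed

text \<open>
  One sequence of approximations serves finitely many observables, so relations between them pass to
  the limit.
\<close>

lemma act_limit_of_steps:
  assumes fin: "finite S" and S: "\<And>f. f \<in> S \<Longrightarrow> \<exists>z A. smooth_at z A f" and t: "0 \<le> t"
  obtains \<Lambda> n where "\<And>j. finite (\<Lambda> j)" "\<And>j::nat. 0 < n j" "\<And>j. 0 \<le> t / real (n j)"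
    "\<And>j. t / real (n j) * (real (card (\<Lambda> j)) + 1) \<le> 1" "(\<lambda>j. t / real (n j)) \<longlonglongrightarrow> 0"
    "\<And>f \<eta>. f \<in> S \<Longrightarrow> \<eta> \<in> configs \<Longrightarrow> (\<lambda>j. steps (\<Lambda> j) (t / real (n j)) (n j) f \<eta>) \<longlonglongrightarrow> act t f \<eta>"
proof -
  let ?e = "\<lambda>j. inverse (real (Suc j))"
  have conv: "a \<longlonglongrightarrow> l" if le: "\<And>j. \<bar>a j - l\<bar> \<le> ?e j" for a and l :: real
  proof (rule LIM_zero_cancel, rule tendsto_rabs_zero_cancel)
    show "(\<lambda>j. \<bar>a j - l\<bar>) \<longlonglongrightarrow> 0"
      by (rule tendsto_sandwich[OF _ _ tendsto_const LIMSEQ_inverse_real_of_nat])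
         (auto intro!: always_eventually le simp del: of_nat_Suc)
  qed
  have "\<exists>\<Lambda> n. (\<forall>f\<in>S. \<forall>\<eta>\<in>configs. \<bar>act t f \<eta> - steps \<Lambda> (t / real n) n f \<eta>\<bar> \<le> ?e j) \<and> finite \<Lambda> \<and>
      t / real n * (real (card \<Lambda>) + 1) \<le> 1 \<and> t / real n \<le> ?e j \<and> 0 < n" for j
  proof (rule eventually_steps_ex, rule eventually_steps_conj[OF eventually_steps_ball[OF fin]
      eventually_steps_conj[OF eventually_steps_finite eventually_steps_small[OF t]]])
    fix f assume "f \<in> S"
    then obtain z A where "smooth_at z A f" using S by blast
    then show "eventually_steps (\<lambda>\<Lambda> n. \<forall>\<eta>\<in>configs. \<bar>act t f \<eta> - steps \<Lambda> (t / real n) n f \<eta>\<bar> \<le> ?e j)"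
      by (rule act_approx[OF _ t]) simp
  qed simp
  then obtain \<Lambda> n where *: "\<And>j. (\<forall>f\<in>S. \<forall>\<eta>\<in>configs. \<bar>act t f \<eta> - steps (\<Lambda> j) (t / real (n j)) (n j) f \<eta>\<bar> \<le> ?e j) \<and>
      finite (\<Lambda> j) \<and> t / real (n j) * (real (card (\<Lambda> j)) + 1) \<le> 1 \<and> t / real (n j) \<le> ?e j \<and> 0 < n j"
    by metis
  show thesis
  proof (rule that[of \<Lambda> n])
    show "(\<lambda>j. t / real (n j)) \<longlonglongrightarrow> 0" using * t by (intro conv) auto
    fix f and \<eta> :: "int \<Rightarrow> int" assume "f \<in> S" "\<eta> \<in> configs"
    then show "(\<lambda>j. steps (\<Lambda> j) (t / real (n j)) (n j) f \<eta>) \<longlonglongrightarrow> act t f \<eta>"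
      using * by (intro conv) (simp add: abs_minus_commute)
  qed (use * t in auto)
qed

subsection \<open>Products\<close>

text \<open>
  The term of order \<open>h\<close> is the carre du champ of the generator, the source of all correlations. The
  remaining term is \<open>O(h\<^sup>2)\<close> and disappears in the limit.
\<close>

lemma step_product:
  "step \<Lambda> h (\<lambda>\<xi>. f \<xi> * g \<xi>) \<eta> - step \<Lambda> h f \<eta> * step \<Lambda> h g \<eta> =
     h * (\<Sum>x\<in>\<Lambda>. c x \<eta> * ((f (flip x \<eta>) - f \<eta>) * (g (flip x \<eta>) - g \<eta>)))
     - h\<^sup>2 * ((\<Sum>x\<in>\<Lambda>. c x \<eta> * (f (flip x \<eta>) - f \<eta>)) * (\<Sum>x\<in>\<Lambda>. c x \<eta> * (g (flip x \<eta>) - g \<eta>)))"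
proof -
  have "(\<Sum>x\<in>\<Lambda>. c x \<eta> * (f (flip x \<eta>) * g (flip x \<eta>) - f \<eta> * g \<eta>)) =
      (\<Sum>x\<in>\<Lambda>. f \<eta> * (c x \<eta> * (g (flip x \<eta>) - g \<eta>)) + g \<eta> * (c x \<eta> * (f (flip x \<eta>) - f \<eta>))
         + c x \<eta> * ((f (flip x \<eta>) - f \<eta>) * (g (flip x \<eta>) - g \<eta>)))"
    by (intro sum.cong) (auto simp: algebra_simps)
  also have "\<dots> = f \<eta> * (\<Sum>x\<in>\<Lambda>. c x \<eta> * (g (flip x \<eta>) - g \<eta>)) + g \<eta> * (\<Sum>x\<in>\<Lambda>. c x \<eta> * (f (flip x \<eta>) - f \<eta>))
      + (\<Sum>x\<in>\<Lambda>. c x \<eta> * ((f (flip x \<eta>) - f \<eta>) * (g (flip x \<eta>) - g \<eta>)))"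
    by (simp only: sum.distrib sum_distrib_left)
  finally have eq: "(\<Sum>x\<in>\<Lambda>. c x \<eta> * (f (flip x \<eta>) * g (flip x \<eta>) - f \<eta> * g \<eta>)) =
      f \<eta> * (\<Sum>x\<in>\<Lambda>. c x \<eta> * (g (flip x \<eta>) - g \<eta>)) + g \<eta> * (\<Sum>x\<in>\<Lambda>. c x \<eta> * (f (flip x \<eta>) - f \<eta>))
      + (\<Sum>x\<in>\<Lambda>. c x \<eta> * ((f (flip x \<eta>) - f \<eta>) * (g (flip x \<eta>) - g \<eta>)))" .
  have "(a + h * (b * p + a' * q + r)) - (b' + h * q') * (d + h * p') =
     h * r - h\<^sup>2 * (q' * p')" if "a = b' * d" "b = b'" "a' = d" "p' = p" "q' = q" for a b p a' q r b' q' d p'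
    unfolding that by (simp add: algebra_simps power2_eq_square)
  then show ?thesis unfolding step_def eq by simp
qed

lemma rate_weighted_gradient_le:
  assumes f: "smooth_at z A f" and fin: "finite \<Lambda>" and c: "\<eta> \<in> configs"
  shows "\<bar>\<Sum>x\<in>\<Lambda>. c x \<eta> * (f (flip x \<eta>) - f \<eta>)\<bar> \<le> 3 * A"
proof -
  have A: "0 \<le> A" by (rule smooth_atD(1)[OF f])
  have "\<bar>\<Sum>x\<in>\<Lambda>. c x \<eta> * (f (flip x \<eta>) - f \<eta>)\<bar> \<le> (\<Sum>x\<in>\<Lambda>. 1 * (A * wt z x))"
  proof (intro order_trans[OF sum_abs] sum_mono)
    fix x
    show "\<bar>c x \<eta> * (f (flip x \<eta>) - f \<eta>)\<bar> \<le> 1 * (A * wt z x)"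
      unfolding abs_mult using c_nonneg[OF c] c_le_1[OF c] smooth_atD(2)[OF f c]
      by (intro mult_mono) auto
  qed
  also have "\<dots> = A * (\<Sum>x\<in>\<Lambda>. wt z x)" by (simp add: sum_distrib_left)
  also have "\<dots> \<le> A * 3" using A by (intro mult_left_mono sum_wt_le_3 fin)
  finally show ?thesis by simp
qed

lemma step_product_error:
  assumes f: "smooth_at z A f" and g: "smooth_at z' B g" and fin: "finite \<Lambda>" and c: "\<eta> \<in> configs"
  shows "\<bar>h\<^sup>2 * ((\<Sum>x\<in>\<Lambda>. c x \<eta> * (f (flip x \<eta>) - f \<eta>)) * (\<Sum>x\<in>\<Lambda>. c x \<eta> * (g (flip x \<eta>) - g \<eta>)))\<bar>
    \<le> 9 * h\<^sup>2 * (A * B)"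
proof -
  have "\<bar>(\<Sum>x\<in>\<Lambda>. c x \<eta> * (f (flip x \<eta>) - f \<eta>)) * (\<Sum>x\<in>\<Lambda>. c x \<eta> * (g (flip x \<eta>) - g \<eta>))\<bar> \<le> (3 * A) * (3 * B)"
    unfolding abs_mult using rate_weighted_gradient_le[OF f fin c] rate_weighted_gradient_le[OF g fin c]
      smooth_atD(1)[OF f] by (intro mult_mono) auto
  from mult_left_mono[OF this zero_le_power2[of h]] show ?thesis by (simp add: abs_mult mult_ac)
qed

lemma step_product_increasing:
  assumes f: "smooth_at z A f" and g: "smooth_at z' B g" and fin: "finite \<Lambda>" and c: "\<eta> \<in> configs"
    and inc: "increasing f" "increasing g" and h: "0 \<le> h"
  shows "step \<Lambda> h f \<eta> * step \<Lambda> h g \<eta> \<le> step \<Lambda> h (\<lambda>\<xi>. f \<xi> * g \<xi>) \<eta> + 9 * h\<^sup>2 * (A * B)"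
proof -
  have "0 \<le> h * (\<Sum>x\<in>\<Lambda>. c x \<eta> * ((f (flip x \<eta>) - f \<eta>) * (g (flip x \<eta>) - g \<eta>)))"
    by (intro mult_nonneg_nonneg[OF h] sum_nonneg mult_nonneg_nonneg[OF c_nonneg[OF c]]
        increasing_gradients_agree[OF inc c])
  with step_product[of \<Lambda> h f g \<eta>] abs_le_D1[OF step_product_error[OF f g fin c, of h]] show ?thesis by linarith
qed

lemma step_product_distant:
  assumes f: "smooth_at z A f" and g: "smooth_at z' B g" and fin: "finite \<Lambda>" and c: "\<eta> \<in> configs" and h: "0 \<le> h"
  shows "\<bar>step \<Lambda> h (\<lambda>\<xi>. f \<xi> * g \<xi>) \<eta> - step \<Lambda> h f \<eta> * step \<Lambda> h g \<eta>\<bar>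
    \<le> h * (A * B * decorrelation z z') + 9 * h\<^sup>2 * (A * B)"
proof -
  have AB: "0 \<le> A" "0 \<le> B" using smooth_atD(1)[OF f] smooth_atD(1)[OF g] by auto
  have "\<bar>\<Sum>x\<in>\<Lambda>. c x \<eta> * ((f (flip x \<eta>) - f \<eta>) * (g (flip x \<eta>) - g \<eta>))\<bar>
      \<le> (\<Sum>x\<in>\<Lambda>. 1 * ((A * wt z x) * (B * wt z' x)))"
  proof (intro order_trans[OF sum_abs] sum_mono)
    fix x
    show "\<bar>c x \<eta> * ((f (flip x \<eta>) - f \<eta>) * (g (flip x \<eta>) - g \<eta>))\<bar> \<le> 1 * ((A * wt z x) * (B * wt z' x))"
      unfolding abs_mult using c_nonneg[OF c] c_le_1[OF c] smooth_atD(2)[OF f c] smooth_atD(2)[OF g c] AB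
      by (intro mult_mono) auto
  qed
  also have "\<dots> = A * B * (\<Sum>x\<in>\<Lambda>. wt z x * wt z' x)" by (simp add: sum_distrib_left mult_ac)
  also have "\<dots> \<le> A * B * decorrelation z z'"
    unfolding decorrelation_def using AB by (intro mult_left_mono sum_wt_mult_le fin) auto
  finally have "\<bar>h * (\<Sum>x\<in>\<Lambda>. c x \<eta> * ((f (flip x \<eta>) - f \<eta>) * (g (flip x \<eta>) - g \<eta>)))\<bar> \<le> h * (A * B * decorrelation z z')"
    using h by (simp add: abs_mult mult_left_mono)
  from add_mono[OF this step_product_error[OF f g fin c, of h]] show ?thesis
    unfolding step_product by (rule order_trans[OF abs_triangle_ineq4])
qed

text \<open>
  The errors \<open>d\<close> of the single steps add up, because \<open>step\<close> is monotone and preserves constants.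
\<close>

lemma steps_product_le:
  assumes fin: "finite \<Lambda>" and h: "0 \<le> h" "h * (real (card \<Lambda>) + 1) \<le> 1"
    and le: "\<And>k \<eta>. k < n \<Longrightarrow> \<eta> \<in> configs \<Longrightarrow>
      steps \<Lambda> h (Suc k) f \<eta> * steps \<Lambda> h (Suc k) g \<eta> \<le> step \<Lambda> h (\<lambda>\<xi>. steps \<Lambda> h k f \<xi> * steps \<Lambda> h k g \<xi>) \<eta> + d"
    and k: "k \<le> n" and c: "\<eta> \<in> configs"
  shows "steps \<Lambda> h k f \<eta> * steps \<Lambda> h k g \<eta> \<le> steps \<Lambda> h k (\<lambda>\<xi>. f \<xi> * g \<xi>) \<eta> + real k * d"
  using k c
proof (induction k arbitrary: \<eta>)
  case (Suc k)
  have "step \<Lambda> h (\<lambda>\<xi>. steps \<Lambda> h k f \<xi> * steps \<Lambda> h k g \<xi>) \<eta>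
      \<le> step \<Lambda> h (steps \<Lambda> h k (\<lambda>\<xi>. f \<xi> * g \<xi>)) \<eta> + real k * d"
    using Suc by (intro step_mono fin h) auto
  with le[of k \<eta>] Suc.prems show ?case by (simp add: distrib_right)
qed simp

lemma steps_product_ge:
  assumes fin: "finite \<Lambda>" and h: "0 \<le> h" "h * (real (card \<Lambda>) + 1) \<le> 1"
    and le: "\<And>k \<eta>. k < n \<Longrightarrow> \<eta> \<in> configs \<Longrightarrow>
      step \<Lambda> h (\<lambda>\<xi>. steps \<Lambda> h k f \<xi> * steps \<Lambda> h k g \<xi>) \<eta> \<le> steps \<Lambda> h (Suc k) f \<eta> * steps \<Lambda> h (Suc k) g \<eta> + d"
    and k: "k \<le> n" and c: "\<eta> \<in> configs"
  shows "steps \<Lambda> h k (\<lambda>\<xi>. f \<xi> * g \<xi>) \<eta> \<le> steps \<Lambda> h k f \<eta> * steps \<Lambda> h k g \<eta> + real k * d"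
  using k c
proof (induction k arbitrary: \<eta>)
  case (Suc k)
  have "step \<Lambda> h (steps \<Lambda> h k (\<lambda>\<xi>. f \<xi> * g \<xi>)) \<eta>
      \<le> step \<Lambda> h (\<lambda>\<xi>. steps \<Lambda> h k f \<xi> * steps \<Lambda> h k g \<xi>) \<eta> + real k * d"
    using Suc by (intro step_mono fin h) auto
  with le[of k \<eta>] Suc.prems show ?case by (simp add: distrib_right)
qed simp

lemma steps_smooth_uniform:
  assumes f: "smooth_at z A f" and fin: "finite \<Lambda>" and n: "0 < n" and t: "0 \<le> t"
    and h: "t / real n * (real (card \<Lambda>) + 1) \<le> 1" and k: "k \<le> n"
  shows "smooth_at z (A * exp (t * spread)) (steps \<Lambda> (t / real n) k f)"
proof (rule smooth_at_mono)
  show "smooth_at z (A * exp (real k * (t / real n) * spread)) (steps \<Lambda> (t / real n) k f)"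
    using t n by (intro steps_smooth f fin h) auto
  have "real k * (t / real n) \<le> real n * (t / real n)" using k t by (intro mult_right_mono) auto
  then have "real k * (t / real n) \<le> t" using n by simp
  then have "exp (real k * (t / real n) * spread) \<le> exp (t * spread)"
    by (simp only: exp_le_cancel_iff mult_right_mono spread_nonneg)
  then show "A * exp (real k * (t / real n) * spread) \<le> A * exp (t * spread)"
    using smooth_atD(1)[OF f] by (rule mult_left_mono)
qed

text \<open>
  In one step the covariance of \<open>f\<close> and \<open>g\<close> grows by at most \<open>h\<close> times the sum over the
  vertices of the products of their oscillations, up to \<open>O(h\<^sup>2)\<close>. For observables that are
  sensitive in distant regions that sum is small.
\<close>

theorem act_product_distant:
  assumes f: "smooth_at z A f" and g: "smooth_at z' B g" and t: "0 \<le> t" and c: "\<eta> \<in> configs"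
  shows "\<bar>act t (\<lambda>\<xi>. f \<xi> * g \<xi>) \<eta> - act t f \<eta> * act t g \<eta>\<bar>
    \<le> t * (A * exp (t * spread) * (B * exp (t * spread)) * decorrelation z z')"
proof -
  let ?A = "A * exp (t * spread)" and ?B = "B * exp (t * spread)"
  let ?b = "?A * ?B * decorrelation z z'"
  have g': "smooth_at z (B * 2 ^ nat \<bar>z' - z\<bar>) g" by (rule smooth_at_recentre[OF g])
  obtain a b where "\<And>\<eta>. \<eta>\<in>configs \<Longrightarrow> \<bar>f \<eta>\<bar> \<le> a" "\<And>\<eta>. \<eta>\<in>configs \<Longrightarrow> \<bar>g \<eta>\<bar> \<le> b"
    using smooth_at_bounded[OF f] smooth_at_bounded[OF g] by blast
  then have "\<exists>z A. smooth_at z A (\<lambda>\<xi>. f \<xi> * g \<xi>)" using smooth_at_mult[OF f g'] by blast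
  then have "\<And>u. u \<in> {f, g, \<lambda>\<xi>. f \<xi> * g \<xi>} \<Longrightarrow> \<exists>z A. smooth_at z A u" using f g by auto
  then obtain \<Lambda> n where fin: "\<And>j. finite (\<Lambda> j)" and n: "\<And>j::nat. 0 < n j" and h: "\<And>j. 0 \<le> t / real (n j)"
    "\<And>j. t / real (n j) * (real (card (\<Lambda> j)) + 1) \<le> 1" and h0: "(\<lambda>j. t / real (n j)) \<longlonglongrightarrow> 0"
    and lim: "\<And>u \<eta>. u \<in> {f, g, \<lambda>\<xi>. f \<xi> * g \<xi>} \<Longrightarrow> \<eta> \<in> configs \<Longrightarrow>
       (\<lambda>j. steps (\<Lambda> j) (t / real (n j)) (n j) u \<eta>) \<longlonglongrightarrow> act t u \<eta>"
    by (rule act_limit_of_steps[OF _ _ t, of "{f, g, \<lambda>\<xi>. f \<xi> * g \<xi>}", rotated]) (blast, blast, simp)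
  let ?S = "\<lambda>j. steps (\<Lambda> j) (t / real (n j))"
  have bound: "\<bar>?S j (n j) (\<lambda>\<xi>. f \<xi> * g \<xi>) \<eta> - ?S j (n j) f \<eta> * ?S j (n j) g \<eta>\<bar>
      \<le> t * ?b + 9 * t * (t / real (n j)) * (?A * ?B)" for j
  proof -
    let ?h = "t / real (n j)"
    let ?d = "?h * ?b + 9 * ?h\<^sup>2 * (?A * ?B)"
    have one: "\<bar>step (\<Lambda> j) ?h (\<lambda>\<xi>. ?S j k f \<xi> * ?S j k g \<xi>) \<eta> - ?S j (Suc k) f \<eta> * ?S j (Suc k) g \<eta>\<bar> \<le> ?d"
      if "k < n j" "\<eta> \<in> configs" for k \<eta>
      using step_product_distant[OF steps_smooth_uniform[OF f fin n t h(2)] steps_smooth_uniform[OF g fin n t h(2)] fin that(2) h(1),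
          of k j k j j j] that by simp
    have "?S j (n j) f \<eta> * ?S j (n j) g \<eta> \<le> ?S j (n j) (\<lambda>\<xi>. f \<xi> * g \<xi>) \<eta> + real (n j) * ?d"
      by (rule steps_product_le[OF fin h _ order_refl c]) (use one abs_le_D2 in fastforce)
    moreover have "?S j (n j) (\<lambda>\<xi>. f \<xi> * g \<xi>) \<eta> \<le> ?S j (n j) f \<eta> * ?S j (n j) g \<eta> + real (n j) * ?d"
      by (rule steps_product_ge[OF fin h _ order_refl c]) (use one abs_le_D1 in fastforce)
    moreover have "real (n j) * ?d = t * ?b + 9 * t * ?h * (?A * ?B)"
      using n[of j] by (simp add: field_simps power2_eq_square)
    ultimately show ?thesis by (simp only: abs_le_iff) linarith
  qed
  have "(\<lambda>j. t * ?b + 9 * t * (t / real (n j)) * (?A * ?B)) \<longlonglongrightarrow> t * ?b + 9 * t * 0 * (?A * ?B)"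
    by (intro tendsto_intros h0)
  then have rhs: "(\<lambda>j. t * ?b + 9 * t * (t / real (n j)) * (?A * ?B)) \<longlonglongrightarrow> t * ?b" by simp
  have lhs: "(\<lambda>j. \<bar>?S j (n j) (\<lambda>\<xi>. f \<xi> * g \<xi>) \<eta> - ?S j (n j) f \<eta> * ?S j (n j) g \<eta>\<bar>)
      \<longlonglongrightarrow> \<bar>act t (\<lambda>\<xi>. f \<xi> * g \<xi>) \<eta> - act t f \<eta> * act t g \<eta>\<bar>"
    by (intro tendsto_intros lim c) auto
  show ?thesis by (rule LIMSEQ_le[OF lhs rhs]) (use bound in blast)
qed

end

text \<open>
  Attractiveness: the more neighbours are up, the sooner a spin flips up and the later it flips down.
  The rates are also invariant under a global change of sign.
\<close>

locale symmetric_attractive_process = spin_flip_process +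
  assumes attractive_minus: "\<eta> \<in> configs \<Longrightarrow> y \<noteq> x \<Longrightarrow> \<eta> y = -1 \<Longrightarrow> \<eta> x = -1 \<Longrightarrow> c x \<eta> \<le> c x (flip y \<eta>)"
    and attractive_plus: "\<eta> \<in> configs \<Longrightarrow> y \<noteq> x \<Longrightarrow> \<eta> y = -1 \<Longrightarrow> \<eta> x = 1 \<Longrightarrow> c x (flip y \<eta>) \<le> c x \<eta>"
    and symmetric: "\<eta> \<in> configs \<Longrightarrow> c x (negate \<eta>) = c x \<eta>"
begin

text \<open>
  Each of the three terms of \<open>step_gradient\<close> is nonnegative; for the last one this is attractiveness.
\<close>

lemma step_increasing:
  assumes inc: "increasing f" and fin: "finite \<Lambda>" and h: "0 \<le> h" "h * (real (card \<Lambda>) + 1) \<le> 1"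
  shows "increasing (step \<Lambda> h f)"
  unfolding increasing_def
proof (intro ballI allI impI)
  fix \<eta> :: "int \<Rightarrow> int" and y assume c: "\<eta> \<in> configs" and y: "\<eta> y = -1"
  have up: "f \<xi> \<le> f (flip x \<xi>)" if "\<xi> \<in> configs" "\<xi> x = -1" for \<xi> x
    using inc that unfolding increasing_def by blast
  obtain a where a: "0 \<le> a"
    and eq: "step \<Lambda> h f (flip y \<eta>) - step \<Lambda> h f \<eta> = a * (f (flip y \<eta>) - f \<eta>)
      + h * (\<Sum>x\<in>\<Lambda> - {y}. c x \<eta> * (f (flip y (flip x \<eta>)) - f (flip x \<eta>)))
      + h * (\<Sum>x\<in>\<Lambda> - {y}. (c x (flip y \<eta>) - c x \<eta>) * (f (flip x (flip y \<eta>)) - f (flip y \<eta>)))"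
    by (rule step_gradient[OF fin h c, of y f])
  have "0 \<le> a * (f (flip y \<eta>) - f \<eta>)" using a up[OF c y] by simp
  moreover have "0 \<le> h * (\<Sum>x\<in>\<Lambda> - {y}. c x \<eta> * (f (flip y (flip x \<eta>)) - f (flip x \<eta>)))"
    using up[OF flip_configs[OF c], of _ y] y c_nonneg[OF c] h
    by (intro mult_nonneg_nonneg sum_nonneg) auto
  moreover have "0 \<le> h * (\<Sum>x\<in>\<Lambda> - {y}. (c x (flip y \<eta>) - c x \<eta>) * (f (flip x (flip y \<eta>)) - f (flip y \<eta>)))"
  proof (rule mult_nonneg_nonneg[OF h(1)], rule sum_nonneg)
    fix x assume "x \<in> \<Lambda> - {y}"
    then have xy: "y \<noteq> x" "x \<noteq> y" by auto
    show "0 \<le> (c x (flip y \<eta>) - c x \<eta>) * (f (flip x (flip y \<eta>)) - f (flip y \<eta>))"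
    proof (cases "\<eta> x = -1")
      case True
      then show ?thesis
        using attractive_minus[OF c xy(1) y] up[OF flip_configs[OF c], of y x] xy
        by (intro mult_nonneg_nonneg) auto
    next
      case False
      then have x1: "\<eta> x = 1" using configs_cases[OF c] by blast
      then have "f (flip x (flip y \<eta>)) \<le> f (flip y \<eta>)"
        using up[OF flip_configs[OF flip_configs[OF c]], of x y x] xy by simp
      then show ?thesis using attractive_plus[OF c xy(1) y x1] by (intro mult_nonpos_nonpos) auto
    qed
  qed
  ultimately show "step \<Lambda> h f \<eta> \<le> step \<Lambda> h f (flip y \<eta>)" using eq by linarith
qed

lemma steps_increasing:
  assumes "increasing f" "finite \<Lambda>" "0 \<le> h" "h * (real (card \<Lambda>) + 1) \<le> 1"
  shows "increasing (steps \<Lambda> h n f)"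
  using assms by (induction n) (auto intro: step_increasing)

lemma act_increasing:
  assumes f: "smooth_at z A f" and inc: "increasing f" and t: "0 \<le> t"
  shows "increasing (act t f)"
  unfolding increasing_def
proof (intro ballI allI impI)
  fix \<eta> :: "int \<Rightarrow> int" and y assume c: "\<eta> \<in> configs" and y: "\<eta> y = -1"
  have "\<And>u. u \<in> {f} \<Longrightarrow> \<exists>z A. smooth_at z A u" using f by auto
  then obtain \<Lambda> n where fin: "\<And>j. finite (\<Lambda> j)" and n: "\<And>j::nat. 0 < n j" and h: "\<And>j. 0 \<le> t / real (n j)"
    "\<And>j. t / real (n j) * (real (card (\<Lambda> j)) + 1) \<le> 1" and h0: "(\<lambda>j. t / real (n j)) \<longlonglongrightarrow> 0"
    and lim: "\<And>u \<eta>. u \<in> {f} \<Longrightarrow> \<eta> \<in> configs \<Longrightarrow>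
       (\<lambda>j. steps (\<Lambda> j) (t / real (n j)) (n j) u \<eta>) \<longlonglongrightarrow> act t u \<eta>"
    by (rule act_limit_of_steps[OF _ _ t, of "{f}", rotated]) (blast, blast, simp)
  show "act t f \<eta> \<le> act t f (flip y \<eta>)"
  proof (rule LIMSEQ_le)
    show "(\<lambda>j. steps (\<Lambda> j) (t / real (n j)) (n j) f \<eta>) \<longlonglongrightarrow> act t f \<eta>"
      "(\<lambda>j. steps (\<Lambda> j) (t / real (n j)) (n j) f (flip y \<eta>)) \<longlonglongrightarrow> act t f (flip y \<eta>)"
      using c by (auto intro: lim)
    show "\<exists>N. \<forall>j\<ge>N. steps (\<Lambda> j) (t / real (n j)) (n j) f \<eta> \<le> steps (\<Lambda> j) (t / real (n j)) (n j) f (flip y \<eta>)"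
      using steps_increasing[OF inc fin h] c y unfolding increasing_def by blast
  qed
qed

text \<open>
  The Harris inequality: in one step increasing observables gain a nonnegative covariance, up to
  \<open>O(h\<^sup>2)\<close>, since their gradients at each vertex have the same sign, and attractiveness keeps
  them increasing.
\<close>

theorem act_product_increasing:
  assumes f: "smooth_at z A f" and g: "smooth_at z B g" and inc: "increasing f" "increasing g"
    and t: "0 \<le> t" and c: "\<eta> \<in> configs"
  shows "act t f \<eta> * act t g \<eta> \<le> act t (\<lambda>\<xi>. f \<xi> * g \<xi>) \<eta>"
proof -
  let ?A = "A * exp (t * spread)" and ?B = "B * exp (t * spread)"
  obtain a b where "\<And>\<eta>. \<eta>\<in>configs \<Longrightarrow> \<bar>f \<eta>\<bar> \<le> a" "\<And>\<eta>. \<eta>\<in>configs \<Longrightarrow> \<bar>g \<eta>\<bar> \<le> b"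
    using smooth_at_bounded[OF f] smooth_at_bounded[OF g] by blast
  then have "\<exists>z A. smooth_at z A (\<lambda>\<xi>. f \<xi> * g \<xi>)" using smooth_at_mult[OF f g] by blast
  then have "\<And>u. u \<in> {f, g, \<lambda>\<xi>. f \<xi> * g \<xi>} \<Longrightarrow> \<exists>z A. smooth_at z A u" using f g by auto
  then obtain \<Lambda> n where fin: "\<And>j. finite (\<Lambda> j)" and n: "\<And>j::nat. 0 < n j" and h: "\<And>j. 0 \<le> t / real (n j)"
    "\<And>j. t / real (n j) * (real (card (\<Lambda> j)) + 1) \<le> 1" and h0: "(\<lambda>j. t / real (n j)) \<longlonglongrightarrow> 0"
    and lim: "\<And>u \<eta>. u \<in> {f, g, \<lambda>\<xi>. f \<xi> * g \<xi>} \<Longrightarrow> \<eta> \<in> configs \<Longrightarrow>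
       (\<lambda>j. steps (\<Lambda> j) (t / real (n j)) (n j) u \<eta>) \<longlonglongrightarrow> act t u \<eta>"
    by (rule act_limit_of_steps[OF _ _ t, of "{f, g, \<lambda>\<xi>. f \<xi> * g \<xi>}", rotated]) (blast, blast, simp)
  let ?S = "\<lambda>j. steps (\<Lambda> j) (t / real (n j))"
  have bound: "?S j (n j) f \<eta> * ?S j (n j) g \<eta> \<le> ?S j (n j) (\<lambda>\<xi>. f \<xi> * g \<xi>) \<eta> + 9 * t * (t / real (n j)) * (?A * ?B)" for j
  proof -
    let ?h = "t / real (n j)"
    have one: "?S j (Suc k) f \<eta> * ?S j (Suc k) g \<eta> \<le> step (\<Lambda> j) ?h (\<lambda>\<xi>. ?S j k f \<xi> * ?S j k g \<xi>) \<eta> + 9 * ?h\<^sup>2 * (?A * ?B)"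
      if "k < n j" "\<eta> \<in> configs" for k \<eta>
      using step_product_increasing[OF steps_smooth_uniform[OF f fin n t h(2)] steps_smooth_uniform[OF g fin n t h(2)] fin that(2)
          steps_increasing[OF inc(1) fin h] steps_increasing[OF inc(2) fin h] h(1), of k j k j j j] that by simp
    have "?S j (n j) f \<eta> * ?S j (n j) g \<eta> \<le> ?S j (n j) (\<lambda>\<xi>. f \<xi> * g \<xi>) \<eta> + real (n j) * (9 * ?h\<^sup>2 * (?A * ?B))"
      by (rule steps_product_le[OF fin h one order_refl c])
    moreover have "real (n j) * (9 * ?h\<^sup>2 * (?A * ?B)) = 9 * t * ?h * (?A * ?B)"
      using n[of j] by (simp add: field_simps power2_eq_square)
    ultimately show ?thesis by simp
  qed
  have "(\<lambda>j. ?S j (n j) (\<lambda>\<xi>. f \<xi> * g \<xi>) \<eta> + 9 * t * (t / real (n j)) * (?A * ?B))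
      \<longlonglongrightarrow> act t (\<lambda>\<xi>. f \<xi> * g \<xi>) \<eta> + 9 * t * 0 * (?A * ?B)"
    by (intro tendsto_intros h0 lim c) auto
  then have rhs: "(\<lambda>j. ?S j (n j) (\<lambda>\<xi>. f \<xi> * g \<xi>) \<eta> + 9 * t * (t / real (n j)) * (?A * ?B))
      \<longlonglongrightarrow> act t (\<lambda>\<xi>. f \<xi> * g \<xi>) \<eta>" by simp
  have lhs: "(\<lambda>j. ?S j (n j) f \<eta> * ?S j (n j) g \<eta>) \<longlonglongrightarrow> act t f \<eta> * act t g \<eta>"
    by (intro tendsto_intros lim c) auto
  show ?thesis by (rule LIMSEQ_le[OF lhs rhs]) (use bound in blast)
qed

subsection \<open>Symmetries\<close>

lemma steps_negate:
  assumes "\<eta> \<in> configs"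
  shows "steps \<Lambda> h n (\<lambda>\<xi>. f (negate \<xi>)) \<eta> = steps \<Lambda> h n f (negate \<eta>)"
  using assms
proof (induction n arbitrary: \<eta>)
  case (Suc n)
  have "steps \<Lambda> h (Suc n) (\<lambda>\<xi>. f (negate \<xi>)) \<eta> = step \<Lambda> h (steps \<Lambda> h n (\<lambda>\<xi>. f (negate \<xi>))) \<eta>" by simp
  also have "\<dots> = step \<Lambda> h (steps \<Lambda> h n f) (negate \<eta>)"
    using Suc symmetric
    by (simp add: negate_flip step_def[of _ _ "steps \<Lambda> h n (\<lambda>\<xi>. f (negate \<xi>))"] step_def[of _ _ "steps \<Lambda> h n f"])
  finally show ?case by simp
qed simp

lemma act_negate:
  assumes f: "smooth_at z A f" and t: "0 \<le> t" and c: "\<eta> \<in> configs"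
  shows "act t (\<lambda>\<xi>. f (negate \<xi>)) \<eta> = act t f (negate \<eta>)"
proof -
  let ?S = "{f, \<lambda>\<xi>. f (negate \<xi>)}"
  have "\<And>u. u \<in> ?S \<Longrightarrow> \<exists>z A. smooth_at z A u" using f smooth_at_negate[OF f] by auto
  then obtain \<Lambda> n where fin: "\<And>j. finite (\<Lambda> j)" and n: "\<And>j::nat. 0 < n j" and h: "\<And>j. 0 \<le> t / real (n j)"
    "\<And>j. t / real (n j) * (real (card (\<Lambda> j)) + 1) \<le> 1" and h0: "(\<lambda>j. t / real (n j)) \<longlonglongrightarrow> 0"
    and lim: "\<And>u \<eta>. u \<in> ?S \<Longrightarrow> \<eta> \<in> configs \<Longrightarrow>
       (\<lambda>j. steps (\<Lambda> j) (t / real (n j)) (n j) u \<eta>) \<longlonglongrightarrow> act t u \<eta>"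
    by (rule act_limit_of_steps[OF _ _ t, of "?S", rotated]) (blast, blast, simp)
  have "(\<lambda>j. steps (\<Lambda> j) (t / real (n j)) (n j) (\<lambda>\<xi>. f (negate \<xi>)) \<eta>) \<longlonglongrightarrow> act t (\<lambda>\<xi>. f (negate \<xi>)) \<eta>"
    by (intro lim c) auto
  then have "(\<lambda>j. steps (\<Lambda> j) (t / real (n j)) (n j) f (negate \<eta>)) \<longlonglongrightarrow> act t (\<lambda>\<xi>. f (negate \<xi>)) \<eta>"
    unfolding steps_negate[OF c] .
  moreover have "(\<lambda>j. steps (\<Lambda> j) (t / real (n j)) (n j) f (negate \<eta>)) \<longlonglongrightarrow> act t f (negate \<eta>)"
    using c by (intro lim) auto
  ultimately show ?thesis by (rule LIMSEQ_unique)
qed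

end

context spin_flip_process
begin

lemma steps_translate:
  assumes per: "\<And>x \<eta>. \<eta> \<in> configs \<Longrightarrow> c x (translate l \<eta>) = c (x + l) \<eta>" and "\<eta> \<in> configs"
  shows "steps \<Lambda> h n (\<lambda>\<xi>. f (translate l \<xi>)) \<eta> = steps ((\<lambda>x. x + - l) ` \<Lambda>) h n f (translate l \<eta>)"
  using assms(2)
proof (induction n arbitrary: \<eta>)
  case (Suc n)
  let ?L = "(\<lambda>x. x + - l) ` \<Lambda>"
  have "steps \<Lambda> h (Suc n) (\<lambda>\<xi>. f (translate l \<xi>)) \<eta> = step \<Lambda> h (steps \<Lambda> h n (\<lambda>\<xi>. f (translate l \<xi>))) \<eta>" by simp
  also have "\<dots> = step ?L h (steps ?L h n f) (translate l \<eta>)"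
    unfolding step_def[of _ _ "steps \<Lambda> h n (\<lambda>\<xi>. f (translate l \<xi>))"] step_def[of _ _ "steps ?L h n f"]
    using Suc per[OF Suc.prems] by (subst sum.reindex) (auto simp: inj_on_def translate_flip)
  finally show ?case by simp
qed simp

lemma act_translate:
  assumes f: "smooth_at z A f" and t: "0 \<le> t" and c: "\<eta> \<in> configs"
    and per: "\<And>x \<eta>. \<eta> \<in> configs \<Longrightarrow> c x (translate l \<eta>) = c (x + l) \<eta>"
  shows "act t (\<lambda>\<xi>. f (translate l \<xi>)) \<eta> = act t f (translate l \<eta>)"
proof (rule ccontr)
  assume neq: "act t (\<lambda>\<xi>. f (translate l \<xi>)) \<eta> \<noteq> act t f (translate l \<eta>)"
  define e where "e = \<bar>act t (\<lambda>\<xi>. f (translate l \<xi>)) \<eta> - act t f (translate l \<eta>)\<bar> / 3"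
  have e: "0 < e" using neq by (simp add: e_def)
  obtain \<Lambda> n where 1: "\<forall>\<eta>\<in>configs. \<bar>act t (\<lambda>\<xi>. f (translate l \<xi>)) \<eta> - steps \<Lambda> (t / real n) n (\<lambda>\<xi>. f (translate l \<xi>)) \<eta>\<bar> \<le> e"
    and 2: "\<forall>\<eta>\<in>configs. \<bar>act t f \<eta> - steps ((\<lambda>x. x + - l) ` \<Lambda>) (t / real n) n f \<eta>\<bar> \<le> e"
    using eventually_steps_ex[OF eventually_steps_conj[OF act_approx[OF smooth_at_translate[OF f] t e]
      eventually_steps_translate[OF act_approx[OF f t e]]]] by blast
  have "\<bar>act t (\<lambda>\<xi>. f (translate l \<xi>)) \<eta> - act t f (translate l \<eta>)\<bar> \<le> e + e"
  proof (rule abs_diff_triangle)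
    show "\<bar>act t (\<lambda>\<xi>. f (translate l \<xi>)) \<eta> - steps \<Lambda> (t / real n) n (\<lambda>\<xi>. f (translate l \<xi>)) \<eta>\<bar> \<le> e" using 1 c by blast
    have eq: "steps \<Lambda> (t / real n) n (\<lambda>\<xi>. f (translate l \<xi>)) \<eta>
        = steps ((\<lambda>x. x + - l) ` \<Lambda>) (t / real n) n f (translate l \<eta>)"
      by (rule steps_translate[OF per c])
    show "\<bar>steps \<Lambda> (t / real n) n (\<lambda>\<xi>. f (translate l \<xi>)) \<eta> - act t f (translate l \<eta>)\<bar> \<le> e"
      using bspec[OF 2 translate_configs[OF c, of l]] unfolding eq by (subst abs_minus_commute)
  qed
  moreover have "\<bar>act t (\<lambda>\<xi>. f (translate l \<xi>)) \<eta> - act t f (translate l \<eta>)\<bar> = 3 * e" by (simp add: e_def)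
  ultimately show False using e by simp
qed

end

section \<open>Fair coin configurations\<close>

text \<open>
  The spin at \<open>x\<close> is replaced by a fair coin. This operator plays the role for the initial distribution
  that \<open>step\<close> plays for the dynamics.
\<close>

definition resample :: "'v \<Rightarrow> (('v \<Rightarrow> int) \<Rightarrow> real) \<Rightarrow> ('v \<Rightarrow> int) \<Rightarrow> real" where
  "resample x f \<eta> = (f \<eta> + f (flip x \<eta>)) / 2"

abbreviation resamples :: "'v list \<Rightarrow> (('v \<Rightarrow> int) \<Rightarrow> real) \<Rightarrow> ('v \<Rightarrow> int) \<Rightarrow> real" where
  "resamples xs f \<equiv> foldr resample xs f"

lemma abs_average_le: "\<bar>a - b\<bar> \<le> e \<Longrightarrow> \<bar>c - d\<bar> \<le> e \<Longrightarrow> \<bar>(a + c) / 2 - (b + d) / 2\<bar> \<le> e"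
  for a b c d e :: real
  unfolding abs_le_iff by (simp add: field_simps)

lemma resample_smooth:
  assumes f: "smooth_at z A f"
  shows "smooth_at z A (resample x f)"
  unfolding smooth_at_def
proof (intro conjI ballI allI impI)
  show "0 \<le> A" by (rule smooth_atD(1)[OF f])
next
  fix \<eta> :: "int \<Rightarrow> int" and y assume c: "\<eta> \<in> configs"
  have "\<bar>f (flip y \<eta>) - f \<eta>\<bar> \<le> A * wt z y" "\<bar>f (flip x (flip y \<eta>)) - f (flip x \<eta>)\<bar> \<le> A * wt z y"
    using smooth_atD(2)[OF f c, of y] smooth_atD(2)[OF f flip_configs[OF c, of x], of y] flip_commute[of x y \<eta>] by auto
  then show "\<bar>resample x f (flip y \<eta>) - resample x f \<eta>\<bar> \<le> A * wt z y"
    unfolding resample_def by (rule abs_average_le)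
next
  fix \<epsilon> :: real assume "0 < \<epsilon>"
  then obtain N where N: "\<And>\<xi> \<eta>. \<xi>\<in>configs \<Longrightarrow> \<eta>\<in>configs \<Longrightarrow> (\<forall>x\<in>window N. \<xi> x = \<eta> x) \<Longrightarrow> \<bar>f \<xi> - f \<eta>\<bar> \<le> \<epsilon>"
    using smooth_atD(3)[OF f] by blast
  show "\<exists>N. \<forall>\<xi>\<in>configs. \<forall>\<eta>\<in>configs. (\<forall>x\<in>window N. \<xi> x = \<eta> x) \<longrightarrow> \<bar>resample x f \<xi> - resample x f \<eta>\<bar> \<le> \<epsilon>"
  proof (intro exI[of _ N] ballI impI)
    fix \<xi> \<eta> :: "int \<Rightarrow> int" assume c: "\<xi> \<in> configs" "\<eta> \<in> configs" and ag: "\<forall>x\<in>window N. \<xi> x = \<eta> x"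
    have 1: "\<bar>f \<xi> - f \<eta>\<bar> \<le> \<epsilon>" by (rule N[OF c ag])
    have 2: "\<bar>f (flip x \<xi>) - f (flip x \<eta>)\<bar> \<le> \<epsilon>"
      using ag by (intro N flip_configs c) (simp add: flip_def)
    show "\<bar>resample x f \<xi> - resample x f \<eta>\<bar> \<le> \<epsilon>" unfolding resample_def by (rule abs_average_le[OF 1 2])
  qed
qed

lemma resamples_smooth: "smooth_at z A f \<Longrightarrow> smooth_at z A (resamples xs f)"
  by (induction xs) (auto intro: resample_smooth)

lemma resamples_flip: "x \<in> set xs \<Longrightarrow> resamples xs f (flip x \<eta>) = resamples xs f \<eta>"
proof (induction xs arbitrary: \<eta>)
  case (Cons a xs)
  show ?case
  proof (cases "x = a")
    case True
    then show ?thesis by (simp add: resample_def)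
  next
    case False
    then have "x \<in> set xs" using Cons.prems by simp
    from Cons.IH[OF this] show ?thesis by (simp add: resample_def flip_commute[of a x])
  qed
qed simp

text \<open>
  After the spins of \<open>xs\<close> have been resampled, their original values are forgotten.
\<close>

lemma resamples_override:
  assumes "finite S" "S \<subseteq> set xs" "\<xi> \<in> configs" "\<eta> \<in> configs"
  shows "resamples xs f (override_on \<eta> \<xi> S) = resamples xs f \<eta>"
  using assms(1,2)
proof (induction S rule: finite_induct)
  case (insert a S)
  show ?case
  proof (cases "\<xi> a = \<eta> a")
    case True
    then have "override_on \<eta> \<xi> (insert a S) = override_on \<eta> \<xi> S"
      by (auto simp: override_on_def fun_eq_iff)
    then show ?thesis using insert by simp
  next
    case False
    then have "\<xi> a = - \<eta> a" using configs_neq_iff[OF assms(4,3)] by blast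
    then have "override_on \<eta> \<xi> (insert a S) = flip a (override_on \<eta> \<xi> S)"
      using insert.hyps by (auto simp: override_on_def fun_eq_iff flip_def)
    then show ?thesis using insert resamples_flip[of a xs f] by simp
  qed
qed simp

lemma resamples_oscillation:
  assumes f: "smooth_at z A f" and xs: "{x. \<bar>x - z\<bar> \<le> int N} \<subseteq> set xs" and c: "\<xi> \<in> configs" "\<eta> \<in> configs"
  shows "\<bar>resamples xs f \<xi> - resamples xs f \<eta>\<bar> \<le> A * (2 * (1/2) ^ N)"
proof -
  have "\<bar>resamples xs f \<xi> - resamples xs f (override_on \<eta> \<xi> (set xs))\<bar> \<le> A * (2 * (1/2) ^ N)"
    using xs c by (intro smooth_at_agree[OF resamples_smooth[OF f]] override_configs) (auto simp: override_on_def)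
  then show ?thesis using resamples_override[OF finite_set order_refl c] by simp
qed

lemma resample_mono:
  "\<eta> \<in> configs \<Longrightarrow> (\<And>\<xi>. \<xi> \<in> configs \<Longrightarrow> f \<xi> \<le> g \<xi>) \<Longrightarrow> resample x f \<eta> \<le> resample x g \<eta>"
  unfolding resample_def by (simp add: add_mono)

lemma resample_product:
  "resample x (\<lambda>\<eta>. f \<eta> * g \<eta>) \<eta> - resample x f \<eta> * resample x g \<eta> = (f (flip x \<eta>) - f \<eta>) * (g (flip x \<eta>) - g \<eta>) / 4"
  unfolding resample_def by (simp add: field_simps)

lemma resample_increasing:
  assumes "increasing f"
  shows "increasing (resample x f)"
  unfolding increasing_def
proof (intro ballI allI impI)
  fix \<eta> :: "'a \<Rightarrow> int" and y assume c: "\<eta> \<in> configs" and y: "\<eta> y = -1"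
  have up: "f \<xi> \<le> f (flip y \<xi>)" if "\<xi> \<in> configs" "\<xi> y = -1" for \<xi>
    using assms that unfolding increasing_def by blast
  show "resample x f \<eta> \<le> resample x f (flip y \<eta>)"
  proof (cases "x = y")
    case True
    then show ?thesis by (simp add: resample_def)
  next
    case False
    then have "f (flip x \<eta>) \<le> f (flip x (flip y \<eta>))"
      using up[OF flip_configs[OF c, of x]] y by (simp add: flip_commute[of x y])
    with up[OF c y] show ?thesis unfolding resample_def by simp
  qed
qed

lemma resamples_increasing: "increasing f \<Longrightarrow> increasing (resamples xs f)"
  by (induction xs) (auto intro: resample_increasing)

lemma resamples_product_increasing:
  assumes inc: "increasing f" "increasing g" and c: "\<eta> \<in> configs"
  shows "resamples xs f \<eta> * resamples xs g \<eta> \<le> resamples xs (\<lambda>\<xi>. f \<xi> * g \<xi>) \<eta>"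
  using c
proof (induction xs arbitrary: \<eta>)
  case (Cons a xs)
  let ?F = "resamples xs f" and ?G = "resamples xs g"
  have "0 \<le> (?F (flip a \<eta>) - ?F \<eta>) * (?G (flip a \<eta>) - ?G \<eta>)"
    by (intro increasing_gradients_agree resamples_increasing inc Cons.prems)
  with resample_product[of a ?F ?G \<eta>] have "resample a ?F \<eta> * resample a ?G \<eta> \<le> resample a (\<lambda>\<xi>. ?F \<xi> * ?G \<xi>) \<eta>"
    by linarith
  also have "\<dots> \<le> resample a (resamples xs (\<lambda>\<xi>. f \<xi> * g \<xi>)) \<eta>"
    by (rule resample_mono[OF Cons.prems Cons.IH])
  finally show ?case by simp
qed simp

lemma resamples_product_distant:
  assumes f: "smooth_at z A f" and g: "smooth_at z' B g" and c: "\<eta> \<in> configs" and d: "distinct xs"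
  shows "\<bar>resamples xs (\<lambda>\<xi>. f \<xi> * g \<xi>) \<eta> - resamples xs f \<eta> * resamples xs g \<eta>\<bar>
     \<le> A * B * (\<Sum>x\<in>set xs. wt z x * wt z' x)"
  using c d
proof (induction xs arbitrary: \<eta>)
  case (Cons a xs)
  let ?F = "resamples xs f" and ?G = "resamples xs g" and ?P = "resamples xs (\<lambda>\<xi>. f \<xi> * g \<xi>)"
  let ?s = "A * B * (\<Sum>x\<in>set xs. wt z x * wt z' x)"
  have A: "0 \<le> A" by (rule smooth_atD(1)[OF f])
  have "\<bar>?P \<eta> - ?F \<eta> * ?G \<eta>\<bar> \<le> ?s" "\<bar>?P (flip a \<eta>) - ?F (flip a \<eta>) * ?G (flip a \<eta>)\<bar> \<le> ?s"
    using Cons by auto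
  then have 1: "\<bar>resample a ?P \<eta> - resample a (\<lambda>\<xi>. ?F \<xi> * ?G \<xi>) \<eta>\<bar> \<le> ?s"
    unfolding resample_def by (rule abs_average_le)
  have "\<bar>?F (flip a \<eta>) - ?F \<eta>\<bar> * \<bar>?G (flip a \<eta>) - ?G \<eta>\<bar> \<le> (A * wt z a) * (B * wt z' a)"
    using smooth_atD(2)[OF resamples_smooth[OF f] Cons.prems(1)] smooth_atD(2)[OF resamples_smooth[OF g] Cons.prems(1)] A
    by (intro mult_mono) auto
  moreover have "x / 4 \<le> y" if "x \<le> y" "0 \<le> x" for x y :: real using that by simp
  ultimately have 2: "\<bar>resample a (\<lambda>\<xi>. ?F \<xi> * ?G \<xi>) \<eta> - resample a ?F \<eta> * resample a ?G \<eta>\<bar> \<le> (A * wt z a) * (B * wt z' a)"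
    unfolding resample_product by (simp only: abs_divide abs_mult abs_numeral mult_nonneg_nonneg abs_ge_zero)
  from abs_diff_triangle[OF 1 2] Cons.prems(2) show ?case by (simp add: algebra_simps)
qed simp

lemma resamples_negate: "resamples xs (\<lambda>\<xi>. f (negate \<xi>)) \<eta> = resamples xs f (negate \<eta>)"
  by (induction xs arbitrary: \<eta>) (simp_all add: resample_def negate_flip)

lemma resamples_translate:
  "resamples xs (\<lambda>\<xi>. f (translate l \<xi>)) \<eta> = resamples (map (\<lambda>x. x - l) xs) f (translate l \<eta>)"
  by (induction xs arbitrary: \<eta>) (simp_all add: resample_def translate_flip)

text \<open>
  Invariance under single flips characterizes the distribution of independent fair coins.
\<close>

locale fair_coins = prob_space M for M :: "'w measure" +
  fixes X :: "'w \<Rightarrow> int \<Rightarrow> int"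
  assumes measurable_X: "X \<in> M \<rightarrow>\<^sub>M spin_space"
    and flip_invariant: "bounded_obs f \<Longrightarrow> (\<integral>w. f (flip x (X w)) \<partial>M) = (\<integral>w. f (X w) \<partial>M)"
begin

definition mean :: "((int \<Rightarrow> int) \<Rightarrow> real) \<Rightarrow> real" where
  "mean f = (\<integral>w. f (X w) \<partial>M)"

lemma X_configs: "w \<in> space M \<Longrightarrow> X w \<in> configs"
  using measurable_space[OF measurable_X] by (simp add: space_spin_space)

lemma integrable_obs:
  assumes "bounded_obs f"
  shows "integrable M (\<lambda>w. f (X w))"
proof -
  obtain B where B: "\<And>\<eta>. \<eta>\<in>configs \<Longrightarrow> \<bar>f \<eta>\<bar> \<le> B" using assms unfolding bounded_obs_def by blast
  show ?thesis
  proof (rule integrable_const_bound[of _ B])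
    show "AE w in M. norm (f (X w)) \<le> B" using B X_configs by (intro AE_I2) simp
    show "(\<lambda>w. f (X w)) \<in> borel_measurable M"
      using assms unfolding bounded_obs_def by (intro measurable_compose[OF measurable_X]) blast
  qed
qed

lemma mean_close:
  assumes "bounded_obs f" "bounded_obs g" "\<And>\<eta>. \<eta> \<in> configs \<Longrightarrow> \<bar>f \<eta> - g \<eta>\<bar> \<le> e"
  shows "\<bar>mean f - mean g\<bar> \<le> e"
proof -
  have "\<bar>mean f - mean g\<bar> = \<bar>\<integral>w. f (X w) - g (X w) \<partial>M\<bar>"
    unfolding mean_def using assms integrable_obs by simp
  also have "\<dots> \<le> (\<integral>w. \<bar>f (X w) - g (X w)\<bar> \<partial>M)" by (rule integral_abs_bound)
  also have "\<dots> \<le> (\<integral>w. e \<partial>M)"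
    using assms integrable_obs X_configs by (intro integral_mono) auto
  finally show ?thesis by (simp add: prob_space)
qed

lemma mean_const: "mean (\<lambda>_. a) = a"
  unfolding mean_def by (simp add: prob_space)

lemma mean_mono:
  assumes "bounded_obs f" "bounded_obs g" "\<And>\<eta>. \<eta> \<in> configs \<Longrightarrow> f \<eta> \<le> g \<eta>"
  shows "mean f \<le> mean g"
  unfolding mean_def using assms integrable_obs X_configs by (intro integral_mono) auto

lemma mean_cong:
  assumes "\<And>\<eta>. \<eta> \<in> configs \<Longrightarrow> f \<eta> = g \<eta>"
  shows "mean f = mean g"
  unfolding mean_def using assms X_configs by (intro Bochner_Integration.integral_cong) auto

lemma mean_diff: "bounded_obs f \<Longrightarrow> bounded_obs g \<Longrightarrow> mean (\<lambda>\<eta>. f \<eta> - g \<eta>) = mean f - mean g"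
  unfolding mean_def using integrable_obs by simp

lemma mean_resamples:
  assumes "smooth_at z A f"
  shows "mean (resamples xs f) = mean f"
proof (induction xs)
  case (Cons a xs)
  let ?F = "resamples xs f"
  have F: "bounded_obs ?F" by (rule smooth_at_bounded_obs[OF resamples_smooth[OF assms]])
  have "bounded_obs (\<lambda>\<eta>. 2 * resample a ?F \<eta> - ?F \<eta>)"
    by (intro bounded_obs_diff bounded_obs_mult bounded_obs_const F
        smooth_at_bounded_obs[OF resample_smooth[OF resamples_smooth[OF assms]]])
  moreover have "(\<lambda>\<eta>. 2 * resample a ?F \<eta> - ?F \<eta>) = (\<lambda>\<eta>. ?F (flip a \<eta>))"
    by (simp add: resample_def fun_eq_iff field_simps)
  ultimately have "bounded_obs (\<lambda>\<eta>. ?F (flip a \<eta>))" by simp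
  then have "mean (resample a ?F) = (mean ?F + (\<integral>w. ?F (flip a (X w)) \<partial>M)) / 2"
    unfolding mean_def resample_def[of a ?F]
    using integrable_obs[OF F] integrable_obs[of "\<lambda>\<eta>. ?F (flip a \<eta>)"] by simp
  also have "\<dots> = mean ?F" unfolding flip_invariant[OF F] mean_def by simp
  finally show ?case using Cons by simp
qed simp

text \<open>
  Resampling all spins of a window leaves the mean unchanged and makes a smooth observable nearly
  constant. Product inequalities that hold for one resampled spin thus pass to the mean.
\<close>

lemma resamples_tendsto_mean:
  assumes f: "smooth_at z A f" and xs: "\<And>N. window N \<subseteq> set (xs N)" and c: "\<eta> \<in> configs"
  shows "(\<lambda>N. resamples (xs N) f \<eta>) \<longlonglongrightarrow> mean f"
proof (rule LIM_zero_cancel, rule tendsto_rabs_zero_cancel, rule tendsto_sandwich[OF _ _ tendsto_const])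
  let ?k = "nat \<bar>z\<bar>"
  show "eventually (\<lambda>N. \<bar>resamples (xs N) f \<eta> - mean f\<bar> \<le> A * (2 * (1/2) ^ (N - ?k))) sequentially"
  proof (rule eventually_sequentiallyI[of ?k])
    fix N assume N: "?k \<le> N"
    have "{x. \<bar>x - z\<bar> \<le> int (N - ?k)} \<subseteq> window N" using N by auto
    then have sub: "{x. \<bar>x - z\<bar> \<le> int (N - ?k)} \<subseteq> set (xs N)" using xs by blast
    have "\<bar>mean (\<lambda>_. resamples (xs N) f \<eta>) - mean (resamples (xs N) f)\<bar> \<le> A * (2 * (1/2) ^ (N - ?k))"
      by (intro mean_close bounded_obs_const smooth_at_bounded_obs[OF resamples_smooth[OF f]]
          resamples_oscillation[OF f sub] c)
    then show "\<bar>resamples (xs N) f \<eta> - mean f\<bar> \<le> A * (2 * (1/2) ^ (N - ?k))"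
      unfolding mean_const mean_resamples[OF f] .
  qed
  have "(\<lambda>n. A * (2 * (1/2::real) ^ n)) \<longlonglongrightarrow> A * (2 * 0)"
    by (intro tendsto_intros LIMSEQ_power_zero) auto
  then have "(\<lambda>N. A * (2 * (1/2::real) ^ (N + ?k - ?k))) \<longlonglongrightarrow> 0" by simp
  then show "(\<lambda>N. A * (2 * (1/2::real) ^ (N - ?k))) \<longlonglongrightarrow> 0" by (rule LIMSEQ_offset)
qed auto

abbreviation window_list :: "nat \<Rightarrow> int list" where
  "window_list N \<equiv> [- int N..int N]"

lemma mean_negate:
  assumes f: "smooth_at z A f"
  shows "mean (\<lambda>\<xi>. f (negate \<xi>)) = mean f"
proof -
  obtain \<eta> :: "int \<Rightarrow> int" where c: "\<eta> \<in> configs" using configs_nonempty by blast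
  have "(\<lambda>N. resamples (window_list N) (\<lambda>\<xi>. f (negate \<xi>)) \<eta>) \<longlonglongrightarrow> mean (\<lambda>\<xi>. f (negate \<xi>))"
    by (rule resamples_tendsto_mean[OF smooth_at_negate[OF f] _ c]) simp
  moreover have "(\<lambda>N. resamples (window_list N) f (negate \<eta>)) \<longlonglongrightarrow> mean f"
    by (rule resamples_tendsto_mean[OF f _ negate_configs[OF c]]) simp
  ultimately show ?thesis unfolding resamples_negate by (rule LIMSEQ_unique)
qed

lemma mean_translate:
  assumes f: "smooth_at z A f"
  shows "mean (\<lambda>\<xi>. f (translate l \<xi>)) = mean f"
proof -
  obtain \<eta> :: "int \<Rightarrow> int" where c: "\<eta> \<in> configs" using configs_nonempty by blast
  let ?xs = "\<lambda>N. window_list (N + nat \<bar>l\<bar>)"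
  have "(\<lambda>N. resamples (?xs N) (\<lambda>\<xi>. f (translate l \<xi>)) \<eta>) \<longlonglongrightarrow> mean (\<lambda>\<xi>. f (translate l \<xi>))"
    by (rule resamples_tendsto_mean[OF smooth_at_translate[OF f] _ c]) auto
  moreover have "(\<lambda>N. resamples (map (\<lambda>x. x - l) (?xs N)) f (translate l \<eta>)) \<longlonglongrightarrow> mean f"
  proof (rule resamples_tendsto_mean[OF f _ translate_configs[OF c]])
    fix N
    show "window N \<subseteq> set (map (\<lambda>x. x - l) (?xs N))"
    proof
      fix y assume "y \<in> window N"
      then have "y + l \<in> set (?xs N)" by auto
      then have "y + l - l \<in> (\<lambda>x. x - l) ` set (?xs N)" by (rule imageI)
      then show "y \<in> set (map (\<lambda>x. x - l) (?xs N))" by simp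
    qed
  qed
  ultimately show ?thesis unfolding resamples_translate by (rule LIMSEQ_unique)
qed

lemma mean_product_increasing:
  assumes f: "smooth_at z A f" and g: "smooth_at z B g" and inc: "increasing f" "increasing g"
  shows "mean f * mean g \<le> mean (\<lambda>\<xi>. f \<xi> * g \<xi>)"
proof -
  obtain \<eta> :: "int \<Rightarrow> int" where c: "\<eta> \<in> configs" using configs_nonempty by blast
  obtain a b where ab: "\<And>\<eta>. \<eta>\<in>configs \<Longrightarrow> \<bar>f \<eta>\<bar> \<le> a" "\<And>\<eta>. \<eta>\<in>configs \<Longrightarrow> \<bar>g \<eta>\<bar> \<le> b"
    using smooth_at_bounded[OF f] smooth_at_bounded[OF g] by blast
  have lim: "(\<lambda>N. resamples (window_list N) u \<eta>) \<longlonglongrightarrow> mean u" if "smooth_at z' C u" for z' C u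
    by (rule resamples_tendsto_mean[OF that _ c]) simp
  show ?thesis
  proof (rule LIMSEQ_le)
    show "(\<lambda>N. resamples (window_list N) f \<eta> * resamples (window_list N) g \<eta>) \<longlonglongrightarrow> mean f * mean g"
      by (intro tendsto_mult lim[OF f] lim[OF g])
    show "(\<lambda>N. resamples (window_list N) (\<lambda>\<xi>. f \<xi> * g \<xi>) \<eta>) \<longlonglongrightarrow> mean (\<lambda>\<xi>. f \<xi> * g \<xi>)"
      by (rule lim[OF smooth_at_mult[OF f g ab]])
  qed (use resamples_product_increasing[OF inc c] in blast)
qed

lemma mean_product_distant:
  assumes f: "smooth_at z A f" and g: "smooth_at z' B g"
  shows "\<bar>mean (\<lambda>\<xi>. f \<xi> * g \<xi>) - mean f * mean g\<bar> \<le> A * B * decorrelation z z'"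
proof -
  obtain \<eta> :: "int \<Rightarrow> int" where c: "\<eta> \<in> configs" using configs_nonempty by blast
  obtain a b where ab: "\<And>\<eta>. \<eta>\<in>configs \<Longrightarrow> \<bar>f \<eta>\<bar> \<le> a" "\<And>\<eta>. \<eta>\<in>configs \<Longrightarrow> \<bar>g \<eta>\<bar> \<le> b"
    using smooth_at_bounded[OF f] smooth_at_bounded[OF g] by blast
  have lim: "(\<lambda>N. resamples (window_list N) u \<eta>) \<longlonglongrightarrow> mean u" if "smooth_at z' C u" for z' C u
    by (rule resamples_tendsto_mean[OF that _ c]) simp
  have AB: "0 \<le> A * B" using smooth_atD(1)[OF f] smooth_atD(1)[OF g] by simp
  show ?thesis
  proof (rule LIMSEQ_le[OF _ tendsto_const])
    show "(\<lambda>N. \<bar>resamples (window_list N) (\<lambda>\<xi>. f \<xi> * g \<xi>) \<eta> - resamples (window_list N) f \<eta> * resamples (window_list N) g \<eta>\<bar>)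
        \<longlonglongrightarrow> \<bar>mean (\<lambda>\<xi>. f \<xi> * g \<xi>) - mean f * mean g\<bar>"
      by (intro tendsto_intros lim[OF f] lim[OF g] lim[OF smooth_at_mult[OF f smooth_at_recentre[OF g] ab]])
    have "\<bar>resamples (window_list N) (\<lambda>\<xi>. f \<xi> * g \<xi>) \<eta> - resamples (window_list N) f \<eta> * resamples (window_list N) g \<eta>\<bar>
        \<le> A * B * decorrelation z z'" for N
      using resamples_product_distant[OF f g c, of "window_list N"]
        mult_left_mono[OF sum_wt_mult_le[of "set (window_list N)" z z'] AB]
      unfolding decorrelation_def by simp
    then show "\<exists>N. \<forall>n\<ge>N. \<bar>resamples (window_list n) (\<lambda>\<xi>. f \<xi> * g \<xi>) \<eta> - resamples (window_list n) f \<eta> * resamples (window_list n) g \<eta>\<bar>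
        \<le> A * B * decorrelation z z'" by blast
  qed
qed

end

section \<open>The Markov process at integer times\<close>

definition all_at :: "'v set \<Rightarrow> int \<Rightarrow> ('v \<Rightarrow> int) \<Rightarrow> real" where
  "all_at W s \<xi> = of_bool (\<forall>x\<in>W. \<xi> x = s)"

lemma all_at_bounds: "0 \<le> all_at W s \<xi>" "all_at W s \<xi> \<le> 1" "\<bar>all_at W s \<xi>\<bar> \<le> 1"
  by (auto simp: all_at_def)

lemma all_at_insert: "all_at (insert x W) s = (\<lambda>\<xi>. of_bool (\<xi> x = s) * all_at W s \<xi>)"
  by (auto simp: all_at_def fun_eq_iff)

lemma all_at_smooth:
  assumes "finite W"
  shows "\<exists>A. smooth_at z A (all_at W s)"
  using assms
proof (induction W rule: finite_induct)
  case empty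
  have "smooth_at z 0 (all_at {} s)" by (auto simp: smooth_at_def all_at_def)
  then show ?case by blast
next
  case (insert x W)
  then obtain A where A: "smooth_at z A (all_at W s)" by blast
  have "smooth_at z (1 * A + (1 * 2 ^ nat \<bar>x - z\<bar>) * 1) (\<lambda>\<xi>. of_bool (\<xi> x = s) * all_at W s \<xi>)"
    by (rule smooth_at_mult[OF smooth_at_recentre[OF smooth_at_spin] A]) (simp_all add: all_at_bounds)
  then show ?case unfolding all_at_insert by blast
qed

lemma all_at_increasing: "increasing (all_at W 1)"
  unfolding increasing_def
proof (intro ballI allI impI)
  fix \<eta> :: "'a \<Rightarrow> int" and x assume "\<eta> x = -1"
  then show "all_at W 1 \<eta> \<le> all_at W 1 (flip x \<eta>)"
    by (auto simp: all_at_def flip_def)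
qed

lemma bounded_obs_all_at:
  fixes W :: "int set"
  assumes "finite W"
  shows "bounded_obs (all_at W s)"
  using all_at_smooth[OF assms] smooth_at_bounded_obs by blast

context prob_space
begin

text \<open>
  Chebyshev's inequality: the number of events that occur has mean \<open>card I * \<theta>\<close> and a small
  variance, so it is rarely zero.
\<close>

lemma second_moment_bound:
  assumes fin: "finite I" and G: "\<And>i. i \<in> I \<Longrightarrow> G i \<in> events" and \<theta>: "\<And>i. i \<in> I \<Longrightarrow> prob (G i) = \<theta>"
    and pair: "\<And>i j. i \<in> I \<Longrightarrow> j \<in> I \<Longrightarrow> i \<noteq> j \<Longrightarrow> prob (G i \<inter> G j) \<le> \<theta>\<^sup>2 + \<delta>" and d: "0 \<le> \<delta>"
  shows "(real (card I) * \<theta>)\<^sup>2 * prob (space M - (\<Union>i\<in>I. G i)) \<le> real (card I) * \<theta> + (real (card I))\<^sup>2 * \<delta>"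
proof -
  let ?n = "real (card I)"
  let ?N = "space M - (\<Union>i\<in>I. G i)"
  let ?S = "\<lambda>w. \<Sum>i\<in>I. indicator (G i) w :: real"
  have N: "?N \<in> events" using fin G by (intro sets.Diff sets.top sets.finite_UN) auto
  have int1: "integrable M (\<lambda>w. indicator (G i \<inter> G j) w :: real)" if "i \<in> I" "j \<in> I" for i j
    using G that by (intro integrable_real_indicator sets.Int) (auto simp: emeasure_eq_measure)
  have intS: "integrable M ?S"
    using G by (intro Bochner_Integration.integrable_sum integrable_real_indicator) (auto simp: emeasure_eq_measure)
  have sq: "(?S w)\<^sup>2 = (\<Sum>i\<in>I. \<Sum>j\<in>I. indicator (G i \<inter> G j) w)" for w
    by (simp add: power2_eq_square sum_product indicator_inter_arith)
  have intS2: "integrable M (\<lambda>w. (?S w)\<^sup>2)"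
    unfolding sq by (intro Bochner_Integration.integrable_sum int1)
  have ES: "(\<integral>w. ?S w \<partial>M) = ?n * \<theta>"
    using G \<theta> by (subst Bochner_Integration.integral_sum) (auto simp: emeasure_eq_measure)
  have "(\<integral>w. (?S w)\<^sup>2 \<partial>M) = (\<Sum>i\<in>I. \<Sum>j\<in>I. prob (G i \<inter> G j))"
    unfolding sq using int1 G
    by (subst Bochner_Integration.integral_sum Bochner_Integration.integrable_sum; 
        (intro Bochner_Integration.integrable_sum)?; (simp add: Bochner_Integration.integral_sum)?)
  also have "\<dots> \<le> (\<Sum>i\<in>I. \<Sum>j\<in>I. (\<theta>\<^sup>2 + \<delta>) + (if i = j then \<theta> else 0))"
  proof (intro sum_mono)
    fix i j assume ij: "i \<in> I" "j \<in> I"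
    have "0 \<le> \<theta>\<^sup>2 + \<delta>" using d by simp
    then show "prob (G i \<inter> G j) \<le> (\<theta>\<^sup>2 + \<delta>) + (if i = j then \<theta> else 0)"
      using pair[OF ij] \<theta>[OF ij(1)] by auto
  qed
  also have "\<dots> = ?n\<^sup>2 * (\<theta>\<^sup>2 + \<delta>) + ?n * \<theta>"
    using fin by (simp add: sum.distrib power2_eq_square distrib_left)
  finally have ES2: "(\<integral>w. (?S w)\<^sup>2 \<partial>M) \<le> ?n\<^sup>2 * (\<theta>\<^sup>2 + \<delta>) + ?n * \<theta>" .
  have "(?n * \<theta>)\<^sup>2 * prob ?N = (\<integral>w. (?n * \<theta>)\<^sup>2 * indicator ?N w \<partial>M)"
    using N by (simp add: emeasure_eq_measure)
  also have "\<dots> \<le> (\<integral>w. (?S w)\<^sup>2 - 2 * (?n * \<theta>) * ?S w + (?n * \<theta>)\<^sup>2 \<partial>M)"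
  proof (rule integral_mono)
    show "integrable M (\<lambda>w. (?n * \<theta>)\<^sup>2 * indicator ?N w)"
      using N by (intro integrable_mult_right integrable_real_indicator) (auto simp: emeasure_eq_measure)
    show "integrable M (\<lambda>w. (?S w)\<^sup>2 - 2 * (?n * \<theta>) * ?S w + (?n * \<theta>)\<^sup>2)"
      using intS intS2 by (intro Bochner_Integration.integrable_add Bochner_Integration.integrable_diff integrable_mult_right) auto
    fix w
    have sqr: "(?S w)\<^sup>2 - 2 * (?n * \<theta>) * ?S w + (?n * \<theta>)\<^sup>2 = (?S w - ?n * \<theta>)\<^sup>2"
      by (simp add: power2_eq_square algebra_simps)
    show "(?n * \<theta>)\<^sup>2 * indicator ?N w \<le> (?S w)\<^sup>2 - 2 * (?n * \<theta>) * ?S w + (?n * \<theta>)\<^sup>2"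
    proof (cases "w \<in> ?N")
      case True
      then have "?S w = 0" by (intro sum.neutral) auto
      then show ?thesis using True by simp
    next
      case False
      then show ?thesis unfolding sqr by simp
    qed
  qed
  also have "\<dots> = (\<integral>w. (?S w)\<^sup>2 \<partial>M) - 2 * (?n * \<theta>) * (?n * \<theta>) + (?n * \<theta>)\<^sup>2"
    using intS intS2 unfolding ES[symmetric] by (simp add: prob_space)
  also have "\<dots> \<le> ?n * \<theta> + ?n\<^sup>2 * \<delta>"
    using ES2 by (simp add: power2_eq_square algebra_simps)
  finally show ?thesis .
qed

end

text \<open>
  A process with the given semigroup whose initial spins are independent fair coins.
\<close>

locale fair_process = symmetric_attractive_process K c R
  for K :: "real \<Rightarrow> (int \<Rightarrow> int) \<Rightarrow> (int \<Rightarrow> int) measure" and c R +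
  fixes M :: "'w measure" and \<sigma> :: "real \<Rightarrow> 'w \<Rightarrow> int \<Rightarrow> int"
  assumes markov: "markov_process M spin_space K \<sigma>"
    and initial_flip: "bounded_obs f \<Longrightarrow> (\<integral>w. f (flip x (\<sigma> 0 w)) \<partial>M) = (\<integral>w. f (\<sigma> 0 w) \<partial>M)"
begin

lemma measurable_process: "0 \<le> t \<Longrightarrow> \<sigma> t \<in> M \<rightarrow>\<^sub>M spin_space"
  using markov unfolding markov_process_def by blast

sublocale fair_coins M "\<sigma> 0"
proof -
  interpret prob_space M using markov unfolding markov_process_def by blast
  show "fair_coins M (\<sigma> 0)"
    by unfold_locales (auto intro: measurable_process initial_flip)
qed

lemma process_configs: "0 \<le> t \<Longrightarrow> w \<in> space M \<Longrightarrow> \<sigma> t w \<in> configs"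
  using measurable_space[OF measurable_process] by (simp add: space_spin_space)

abbreviation past :: "real \<Rightarrow> 'w measure" where
  "past \<equiv> natural_filtration M spin_space \<sigma>"

lemma space_past [simp]: "space (past t) = space M"
  by (simp add: natural_filtration_def space_measure_of_conv)

lemma past_event:
  assumes "0 \<le> u" "u \<le> t" "A \<in> sets spin_space"
  shows "{w\<in>space M. \<sigma> u w \<in> A} \<in> sets (past t)"
proof -
  let ?G = "{\<sigma> u -` A \<inter> space M | u A. 0 \<le> u \<and> u \<le> t \<and> A \<in> sets spin_space}"
  have "?G \<subseteq> Pow (space M)" by auto
  then have "sets (past t) = sigma_sets (space M) ?G" unfolding natural_filtration_def by (rule sets_measure_of)
  moreover have "{w\<in>space M. \<sigma> u w \<in> A} \<in> ?G" using assms by auto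
  ultimately show ?thesis by auto
qed

lemma past_subalgebra: "subalgebra M (past t)"
proof -
  let ?G = "{\<sigma> u -` A \<inter> space M | u A. 0 \<le> u \<and> u \<le> t \<and> A \<in> sets spin_space}"
  have "?G \<subseteq> Pow (space M)" by auto
  then have "sets (past t) = sigma_sets (space M) ?G" unfolding natural_filtration_def by (rule sets_measure_of)
  moreover have "?G \<subseteq> sets M" using measurable_sets[OF measurable_process] by auto
  ultimately show ?thesis
    unfolding subalgebra_def using sets.sigma_sets_subset[of ?G M] by simp
qed

lemma past_in_events: "H \<in> sets (past t) \<Longrightarrow> H \<in> events"
  using past_subalgebra unfolding subalgebra_def by blast

lemma markov_event:
  assumes s: "0 \<le> s" and t: "0 \<le> t" and H: "H \<in> sets (past s)" and A: "A \<in> sets spin_space"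
  shows "prob (H \<inter> {w\<in>space M. \<sigma> (s + t) w \<in> A}) = (\<integral>w. indicator H w * measure (K t (\<sigma> s w)) A \<partial>M)"
proof -
  interpret finite_measure_subalgebra M "past s"
    by unfold_locales (rule past_subalgebra)
  let ?E = "{w\<in>space M. \<sigma> (s + t) w \<in> A}"
  have E: "?E \<in> events"
    using measurable_sets[OF measurable_process[of "s + t"] A] s t by (simp add: vimage_def Int_def conj_commute)
  have HE: "H \<in> events" by (rule past_in_events[OF H])
  have "integrable M (indicator ?E :: _ \<Rightarrow> real)"
    using E by (intro integrable_real_indicator) (auto simp: emeasure_eq_measure)
  from real_cond_exp_intA[OF this H]
  have "(\<integral>w. indicator H w * indicator ?E w \<partial>M) = (\<integral>w. indicator H w * real_cond_exp M (past s) (indicator ?E) w \<partial>M)"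
    by (simp add: set_lebesgue_integral_def)
  also have "\<dots> = (\<integral>w. indicator H w * measure (K t (\<sigma> s w)) A \<partial>M)"
  proof (rule integral_cong_AE)
    have "(\<lambda>w. measure (K t (\<sigma> s w)) A) \<in> borel_measurable M"
      using A by (intro measurable_compose[OF measurable_process[OF s]]
          measurable_compose[OF kernel_subprob[OF t] measurable_measure_subprob_algebra])
    then show "(\<lambda>w. indicator H w * measure (K t (\<sigma> s w)) A) \<in> borel_measurable M" using HE by simp
    show "(\<lambda>w. indicator H w * real_cond_exp M (past s) (indicator ?E) w) \<in> borel_measurable M" using HE by simp
    have "AE w in M. real_cond_exp M (past s) (indicator ?E) w = measure (K t (\<sigma> s w)) A"
      using markov s t A unfolding markov_process_def by blast
    then show "AE w in M. indicator H w * real_cond_exp M (past s) (indicator ?E) w = indicator H w * measure (K t (\<sigma> s w)) A"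
      by eventually_elim simp
  qed
  finally have "(\<integral>w. indicator H w * indicator ?E w \<partial>M) = (\<integral>w. indicator H w * measure (K t (\<sigma> s w)) A \<partial>M)" .
  moreover have "(\<integral>w. indicator H w * indicator ?E w \<partial>M) = (\<integral>w. indicator (H \<inter> ?E) w \<partial>M :: real)"
    by (rule Bochner_Integration.integral_cong) (auto split: split_indicator)
  moreover have "\<dots> = prob (H \<inter> ?E)" using HE E by (simp add: sets.Int)
  ultimately show ?thesis by simp
qed

text \<open>
  The Markov property is given for events; it extends to observables because two finite measures on
  configurations, the law of \<open>\<sigma> (s + t)\<close> on \<open>H\<close> and the law of \<open>\<sigma> s\<close> on \<open>H\<close> propagated by \<open>K t\<close>,
  agree on all events.
\<close>

lemma markov_integral:
  assumes s: "0 \<le> s" and t: "0 \<le> t" and H: "H \<in> sets (past s)" and f: "bounded_obs f"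
  shows "(\<integral>w. indicator H w * f (\<sigma> (s + t) w) \<partial>M) = (\<integral>w. indicator H w * act t f (\<sigma> s w) \<partial>M)"
proof -
  define N where "N = density M (\<lambda>w. ennreal (indicator H w))"
  have HE: "H \<in> events" by (rule past_in_events[OF H])
  have st: "0 \<le> s + t" using s t by simp
  have sN: "\<sigma> s \<in> N \<rightarrow>\<^sub>M spin_space" and stN: "\<sigma> (s + t) \<in> N \<rightarrow>\<^sub>M spin_space"
    using measurable_process[OF s] measurable_process[OF st] by (auto simp: N_def)
  let ?D = "distr N spin_space (\<sigma> s)"
  have ne: "space ?D \<noteq> {}" using configs_nonempty by (simp add: space_spin_space)
  have KD: "K t \<in> ?D \<rightarrow>\<^sub>M subprob_algebra spin_space" using kernel_subprob[OF t] by simp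
  have emN: "emeasure N B = emeasure M (H \<inter> B)" if "B \<in> events" for B
  proof -
    have "emeasure N B = (\<integral>\<^sup>+w. ennreal (indicator H w) * indicator B w \<partial>M)"
      unfolding N_def using HE that by (intro emeasure_density) auto
    also have "\<dots> = (\<integral>\<^sup>+w. indicator (H \<inter> B) w \<partial>M)"
      by (rule nn_integral_cong) (auto split: split_indicator)
    finally show ?thesis using HE that by (simp add: sets.Int)
  qed
  have "finite_measure N"
  proof
    show "emeasure N (space N) \<noteq> \<infinity>" using emN[of "space M"] by (simp add: N_def emeasure_eq_measure)
  qed
  then have finD: "finite_measure ?D" using sN by (rule finite_measure.finite_measure_distr)
  have eq: "distr N spin_space (\<sigma> (s + t)) = ?D \<bind> K t"
  proof (rule measure_eqI)
    show "sets (distr N spin_space (\<sigma> (s + t))) = sets (?D \<bind> K t)"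
      using sets_bind[OF sets_kernel[OF KD] ne] by simp
    fix A assume "A \<in> sets (distr N spin_space (\<sigma> (s + t)))"
    then have A: "A \<in> sets spin_space" by simp
    let ?E = "{w\<in>space M. \<sigma> (s + t) w \<in> A}"
    have vim: "\<sigma> (s + t) -` A \<inter> space M = ?E" by auto
    have E: "?E \<in> events" using measurable_sets[OF measurable_process[OF st] A] vim by simp
    have "emeasure (distr N spin_space (\<sigma> (s + t))) A = emeasure M (H \<inter> ?E)"
      using emeasure_distr[OF stN A] emN[OF E] vim by (simp add: N_def)
    also have "\<dots> = ennreal (prob (H \<inter> ?E))" by (rule emeasure_eq_measure)
    also have "\<dots> = ennreal (\<integral>w. indicator H w * measure (K t (\<sigma> s w)) A \<partial>M)"
      unfolding markov_event[OF s t H A] ..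
    also have "\<dots> = (\<integral>\<^sup>+w. ennreal (indicator H w * measure (K t (\<sigma> s w)) A) \<partial>M)"
    proof (rule nn_integral_eq_integral[symmetric])
      have "(\<lambda>w. measure (K t (\<sigma> s w)) A) \<in> borel_measurable M"
        using A by (intro measurable_compose[OF measurable_process[OF s]]
            measurable_compose[OF kernel_subprob[OF t] measurable_measure_subprob_algebra])
      then have meas: "(\<lambda>w. indicator H w * measure (K t (\<sigma> s w)) A) \<in> borel_measurable M" using HE by simp
      show "integrable M (\<lambda>w. indicator H w * measure (K t (\<sigma> s w)) A)"
      proof (rule integrable_const_bound[OF _ meas, of 1])
        show "AE w in M. norm (indicator H w * measure (K t (\<sigma> s w)) A) \<le> 1"
        proof (rule AE_I2)
          fix w assume "w \<in> space M"
          interpret P: prob_space "K t (\<sigma> s w)" by (rule kernel_prob(1)[OF t process_configs[OF s \<open>w \<in> space M\<close>]])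
          show "norm (indicator H w * measure (K t (\<sigma> s w)) A) \<le> 1"
            by (auto split: split_indicator)
        qed
      qed
    qed auto
    also have "\<dots> = (\<integral>\<^sup>+w. emeasure (K t (\<sigma> s w)) A \<partial>N)"
    proof -
      have m: "(\<lambda>w. emeasure (K t (\<sigma> s w)) A) \<in> borel_measurable M"
        using A by (intro measurable_compose[OF measurable_process[OF s]]
            measurable_compose[OF kernel_subprob[OF t] measurable_emeasure_subprob_algebra])
      have "(\<integral>\<^sup>+w. emeasure (K t (\<sigma> s w)) A \<partial>N) = (\<integral>\<^sup>+w. ennreal (indicator H w) * emeasure (K t (\<sigma> s w)) A \<partial>M)"
        unfolding N_def using m HE by (intro nn_integral_density) auto
      also have "\<dots> = (\<integral>\<^sup>+w. ennreal (indicator H w * measure (K t (\<sigma> s w)) A) \<partial>M)"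
      proof (rule nn_integral_cong)
        fix w assume "w \<in> space M"
        interpret P: prob_space "K t (\<sigma> s w)" by (rule kernel_prob(1)[OF t process_configs[OF s \<open>w \<in> space M\<close>]])
        show "ennreal (indicator H w) * emeasure (K t (\<sigma> s w)) A = ennreal (indicator H w * measure (K t (\<sigma> s w)) A)"
          by (simp add: P.emeasure_eq_measure ennreal_mult)
      qed
      finally show ?thesis by simp
    qed
    also have "\<dots> = (\<integral>\<^sup>+x. emeasure (K t x) A \<partial>?D)"
      using A by (intro nn_integral_distr[symmetric] sN
        measurable_compose[OF KD measurable_emeasure_subprob_algebra]) 
    also have "\<dots> = emeasure (?D \<bind> K t) A"
      using emeasure_bind[OF ne KD A] by simp
    finally show "emeasure (distr N spin_space (\<sigma> (s + t))) A = emeasure (?D \<bind> K t) A" .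
  qed
  have fm: "f \<in> borel_measurable spin_space" using f unfolding bounded_obs_def by blast
  have am: "act t f \<in> borel_measurable spin_space" using bounded_obs_act[OF t f] unfolding bounded_obs_def by blast
  obtain B where B: "\<forall>\<eta>\<in>configs. \<bar>f \<eta>\<bar> \<le> B" using f unfolding bounded_obs_def by blast
  have dens: "(\<integral>w. g w \<partial>N) = (\<integral>w. indicator H w * g w \<partial>M)" if "g \<in> borel_measurable M" for g :: "'w \<Rightarrow> real"
    unfolding N_def using that HE by (subst integral_density) auto
  have "(\<integral>w. indicator H w * f (\<sigma> (s + t) w) \<partial>M) = (\<integral>x. f x \<partial>distr N spin_space (\<sigma> (s + t)))"
    using integral_distr[OF stN fm] dens[of "\<lambda>w. f (\<sigma> (s + t) w)"] measurable_compose[OF measurable_process[OF st] fm] by simp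
  also have "\<dots> = (\<integral>x. integral\<^sup>L (K t x) f \<partial>?D)"
    unfolding eq
  proof (rule integral_bind[where K=spin_space and B=B and B'=1, OF fm _ KD finD])
    show "\<bar>f \<xi>\<bar> \<le> B" if "\<xi> \<in> space spin_space" for \<xi> using that B by (simp add: space_spin_space)
    show "AE \<xi> in ?D. emeasure (K t \<xi>) (space (K t \<xi>)) \<le> ennreal 1"
    proof (rule AE_I2)
      fix \<xi> assume "\<xi> \<in> space ?D"
      then have "\<xi> \<in> configs" by (simp add: space_spin_space)
      from prob_space.emeasure_space_1[OF kernel_prob(1)[OF t this]]
      show "emeasure (K t \<xi>) (space (K t \<xi>)) \<le> ennreal 1" by simp
    qed
  qed
  also have "\<dots> = (\<integral>x. act t f x \<partial>?D)" by (simp add: act_def)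
  also have "\<dots> = (\<integral>w. indicator H w * act t f (\<sigma> s w) \<partial>M)"
    using integral_distr[OF sN am] dens[of "\<lambda>w. act t f (\<sigma> s w)"] measurable_compose[OF measurable_process[OF s] am] by simp
  finally show ?thesis .
qed

lemma expectation_process:
  assumes t: "0 \<le> t" and f: "bounded_obs f"
  shows "(\<integral>w. f (\<sigma> t w) \<partial>M) = mean (act t f)"
proof -
  have "space M \<in> sets (past 0)" using sets.top[of "past 0"] by simp
  from markov_integral[OF order_refl t this f]
  have "(\<integral>w. indicator (space M) w * f (\<sigma> t w) \<partial>M) = (\<integral>w. indicator (space M) w * act t f (\<sigma> 0 w) \<partial>M)" by simp
  then show ?thesis
    unfolding mean_def by (simp add: Bochner_Integration.integral_cong[OF refl, of M "\<lambda>w. indicator (space M) w * g w" g for g])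
qed

lemma spins_event_past:
  assumes "0 \<le> u" "u \<le> t" "finite W"
  shows "{w\<in>space M. \<forall>x\<in>W. \<sigma> u w x = s} \<in> sets (past t)"
proof -
  have "{w\<in>space M. \<sigma> u w \<in> {\<xi>\<in>space spin_space. \<forall>x\<in>W. \<xi> x = s}} \<in> sets (past t)"
    using assms by (intro past_event sets_spins_event)
  moreover have "{w\<in>space M. \<sigma> u w \<in> {\<xi>\<in>space spin_space. \<forall>x\<in>W. \<xi> x = s}} = {w\<in>space M. \<forall>x\<in>W. \<sigma> u w x = s}"
    using process_configs[OF assms(1)] by (auto simp: space_spin_space)
  ultimately show ?thesis by simp
qed

lemma spins_event:
  assumes "0 \<le> u" "finite W"
  shows "{w\<in>space M. \<forall>x\<in>W. \<sigma> u w x = s} \<in> events"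
  using spins_event_past[OF assms(1) order_refl assms(2)] by (rule past_in_events)

lemma prob_all_at:
  assumes "0 \<le> t" "finite W"
  shows "prob {w\<in>space M. \<forall>x\<in>W. \<sigma> t w x = s} = mean (act t (all_at W s))"
proof -
  have "prob {w\<in>space M. \<forall>x\<in>W. \<sigma> t w x = s} = (\<integral>w. indicator {w\<in>space M. \<forall>x\<in>W. \<sigma> t w x = s} w \<partial>M)"
    using spins_event[OF assms] by simp
  also have "\<dots> = (\<integral>w. all_at W s (\<sigma> t w) \<partial>M)"
    by (intro Bochner_Integration.integral_cong) (auto simp: all_at_def)
  finally show ?thesis using expectation_process[OF assms(1) bounded_obs_all_at[OF assms(2)]] by simp
qed

text \<open>
  By the Harris inequality, agreement on a block is at least as likely as for independent spins,
  and by symmetry each spin is a fair coin at every time.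
\<close>

lemma block_prob:
  assumes t: "0 \<le> t" and fin: "finite B" and s: "s = 1 \<or> s = -1"
  shows "(1/2) ^ card B \<le> prob {w\<in>space M. \<forall>x\<in>B. \<sigma> t w x = s}"
proof -
  have plus: "(1/2) ^ card B \<le> mean (act t (all_at B 1))"
    using fin
  proof (induction B rule: finite_induct)
    case empty
    have "all_at {} 1 = (\<lambda>_::int \<Rightarrow> int. 1)" by (simp add: all_at_def fun_eq_iff)
    then have "mean (act t (all_at {} 1)) = mean (\<lambda>_. 1)"
      by (intro mean_cong) (simp add: act_const t)
    then show ?case by (simp add: mean_const)
  next
    case (insert x B)
    obtain A where A: "smooth_at 0 A (all_at {x} 1)" using all_at_smooth[of "{x}"] by blast
    obtain A' where A': "smooth_at 0 A' (all_at B 1)" using all_at_smooth[OF insert.hyps(1)] by blast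
    note sm = act_smooth[OF A t] act_smooth[OF A' t]
    have prod: "all_at (insert x B) 1 = (\<lambda>\<xi>. all_at {x} 1 \<xi> * all_at B 1 \<xi>)"
      by (auto simp: all_at_def fun_eq_iff)
    have half: "mean (act t (all_at {x} 1)) = 1/2"
    proof -
      have "mean (act t (all_at {x} 1)) = mean (\<lambda>\<xi>. act t (all_at {x} 1) (negate \<xi>))"
        by (rule mean_negate[OF sm(1), symmetric])
      also have "\<dots> = mean (act t (\<lambda>\<xi>. all_at {x} 1 (negate \<xi>)))"
        by (rule mean_cong) (rule act_negate[OF A t, symmetric])
      also have "\<dots> = mean (\<lambda>\<eta>. 1 - act t (all_at {x} 1) \<eta>)"
      proof (rule mean_cong)
        fix \<eta> :: "int \<Rightarrow> int" assume c: "\<eta> \<in> configs"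
        have "act t (\<lambda>\<xi>. all_at {x} 1 (negate \<xi>)) \<eta> = act t (\<lambda>\<xi>. 1 - all_at {x} 1 \<xi>) \<eta>"
          using configs_cases[of _ x] by (intro act_cong t c) (auto simp: all_at_def negate_def)
        also have "\<dots> = 1 - act t (all_at {x} 1) \<eta>"
          using t c by (simp add: act_diff act_const bounded_obs_const bounded_obs_all_at)
        finally show "act t (\<lambda>\<xi>. all_at {x} 1 (negate \<xi>)) \<eta> = 1 - act t (all_at {x} 1) \<eta>" .
      qed
      also have "\<dots> = 1 - mean (act t (all_at {x} 1))"
        by (simp add: mean_diff mean_const bounded_obs_const smooth_at_bounded_obs[OF sm(1)])
      finally show ?thesis by simp
    qed
    have "(1/2) ^ card (insert x B) = mean (act t (all_at {x} 1)) * (1/2) ^ card B"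
      using insert.hyps half by simp
    also have "\<dots> \<le> mean (act t (all_at {x} 1)) * mean (act t (all_at B 1))"
      using insert.IH half by (intro mult_left_mono) auto
    also have "\<dots> \<le> mean (\<lambda>\<xi>. act t (all_at {x} 1) \<xi> * act t (all_at B 1) \<xi>)"
      by (rule mean_product_increasing[OF sm act_increasing[OF A all_at_increasing t] act_increasing[OF A' all_at_increasing t]])
    also have "\<dots> \<le> mean (act t (all_at (insert x B) 1))"
      unfolding prod
    proof (rule mean_mono)
      show "bounded_obs (\<lambda>\<xi>. act t (all_at {x} 1) \<xi> * act t (all_at B 1) \<xi>)"
        by (intro bounded_obs_mult smooth_at_bounded_obs[OF sm(1)] smooth_at_bounded_obs[OF sm(2)])
      show "bounded_obs (act t (\<lambda>\<xi>. all_at {x} 1 \<xi> * all_at B 1 \<xi>))"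
        using insert.hyps by (intro bounded_obs_act t bounded_obs_mult bounded_obs_all_at) auto
      show "act t (all_at {x} 1) \<eta> * act t (all_at B 1) \<eta> \<le> act t (\<lambda>\<xi>. all_at {x} 1 \<xi> * all_at B 1 \<xi>) \<eta>"
        if "\<eta> \<in> configs" for \<eta>
        by (rule act_product_increasing[OF A A' all_at_increasing all_at_increasing t that])
    qed
    finally show ?case .
  qed
  obtain A where A: "smooth_at 0 A (all_at B 1)" using all_at_smooth[OF fin] by blast
  have "mean (act t (all_at B (-1))) = mean (\<lambda>\<xi>. act t (all_at B 1) (negate \<xi>))"
  proof (rule mean_cong)
    fix \<eta> :: "int \<Rightarrow> int" assume c: "\<eta> \<in> configs"
    have "act t (all_at B (-1)) \<eta> = act t (\<lambda>\<xi>. all_at B 1 (negate \<xi>)) \<eta>"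
      by (intro act_cong t c) (auto simp: all_at_def negate_def)
    also have "\<dots> = act t (all_at B 1) (negate \<eta>)" by (rule act_negate[OF A t c])
    finally show "act t (all_at B (-1)) \<eta> = act t (all_at B 1) (negate \<eta>)" .
  qed
  also have "\<dots> = mean (act t (all_at B 1))" by (rule mean_negate[OF act_smooth[OF A t]])
  finally show ?thesis using plus s unfolding prob_all_at[OF t fin] by auto
qed

end

section \<open>Survival of a spin\<close>

context fair_process
begin

text \<open>
  \<open>survive W s k \<xi>\<close> is the probability, starting from \<open>\<xi>\<close>, that all spins in \<open>W\<close> have the value \<open>s\<close> at
  the times \<open>0, \<dots>, k\<close>.
\<close>

primrec survive :: "int set \<Rightarrow> int \<Rightarrow> nat \<Rightarrow> (int \<Rightarrow> int) \<Rightarrow> real" where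
  "survive W s 0 = all_at W s"
| "survive W s (Suc k) = (\<lambda>\<xi>. all_at W s \<xi> * act 1 (survive W s k) \<xi>)"

primrec survive_decay :: "nat \<Rightarrow> real" where
  "survive_decay 0 = 1"
| "survive_decay (Suc k) = survive_decay k * exp spread + 1"

lemma survive_obs:
  assumes "finite W"
  shows "bounded_obs (survive W s k)" "\<And>\<xi>. \<xi> \<in> configs \<Longrightarrow> 0 \<le> survive W s k \<xi> \<and> survive W s k \<xi> \<le> 1"
proof (induction k)
  case 0
  case 1 show ?case using bounded_obs_all_at[OF assms] by simp
  case 2 show ?case by (simp add: all_at_bounds)
next
  case (Suc k)
  case 1 show ?case
    using Suc by (auto intro!: bounded_obs_mult bounded_obs_all_at assms bounded_obs_act)
  case 2
  have "act 1 (\<lambda>_. 0) \<xi> \<le> act 1 (survive W s k) \<xi>" "act 1 (survive W s k) \<xi> \<le> act 1 (\<lambda>_. 1) \<xi>"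
    using Suc 2 by (auto intro!: act_mono bounded_obs_const)
  then have "0 \<le> act 1 (survive W s k) \<xi>" "act 1 (survive W s k) \<xi> \<le> 1" using 2 by (simp_all add: act_const)
  then show ?case by (simp add: all_at_bounds mult_le_one)
qed

lemma act_survive_bounds:
  assumes "finite W" "0 \<le> t" "\<eta> \<in> configs"
  shows "\<bar>act t (survive W s k) \<eta>\<bar> \<le> 1"
proof -
  have "\<bar>act t (survive W s k) \<eta>\<bar> \<le> act t (\<lambda>_. 1) \<eta>"
    using survive_obs[OF assms(1)] by (intro act_abs_le assms bounded_obs_const) auto
  then show ?thesis using assms by (simp add: act_const)
qed

lemma all_at_singleton: "all_at {v} s = (\<lambda>\<eta>. of_bool (\<eta> v = s))"
  by (simp add: all_at_def fun_eq_iff)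

text \<open>
  The decay constant is the same for all vertices, which makes the decorrelation of distant spins
  uniform.
\<close>

lemma survive_smooth: "smooth_at v (survive_decay k) (survive {v} s k)"
proof (induction k)
  case 0
  then show ?case using smooth_at_spin[of v s] by (simp add: all_at_singleton)
next
  case (Suc k)
  have all: "smooth_at v 1 (all_at {v} s)" using smooth_at_spin[of v s] by (simp add: all_at_singleton)
  have "smooth_at v (1 * (survive_decay k * exp (1 * spread)) + 1 * 1)
      (\<lambda>\<xi>. all_at {v} s \<xi> * act 1 (survive {v} s k) \<xi>)"
    by (rule smooth_at_mult[OF all act_smooth[OF Suc]]) (simp_all add: all_at_bounds act_survive_bounds)
  then show ?case by simp
qed

lemma survive_decay_nonneg [simp]: "0 \<le> survive_decay k"
  by (rule smooth_atD(1)[OF survive_smooth])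

definition stay :: "int set \<Rightarrow> int \<Rightarrow> nat \<Rightarrow> nat \<Rightarrow> 'w set" where
  "stay W s m k = {w\<in>space M. \<forall>i\<in>{m..m + k}. \<forall>x\<in>W. \<sigma> (real i) w x = s}"

lemma stay_past:
  assumes "finite W"
  shows "stay W s m k \<in> sets (past (real (m + k)))"
proof -
  have "{w \<in> space (past (real (m + k))). \<forall>i\<in>{m..m + k}. \<forall>x\<in>W. \<sigma> (real i) w x = s} \<in> sets (past (real (m + k)))"
  proof (rule sets.sets_Collect_finite_All)
    fix i assume "i \<in> {m..m + k}"
    then show "{w \<in> space (past (real (m + k))). \<forall>x\<in>W. \<sigma> (real i) w x = s} \<in> sets (past (real (m + k)))"
      unfolding space_past using assms by (intro spins_event_past) auto
  qed simp
  then show ?thesis by (simp add: stay_def)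
qed

lemma stay_event: "finite W \<Longrightarrow> stay W s m k \<in> events"
  using stay_past past_in_events by blast

lemma stay_Suc: "stay W s m (Suc k) = stay W s m k \<inter> {w\<in>space M. \<forall>x\<in>W. \<sigma> (real (m + k) + 1) w x = s}"
  unfolding stay_def by (auto simp: atLeastAtMostSuc_conv add.commute)

lemma stay_last: "w \<in> stay W s m k \<Longrightarrow> x \<in> W \<Longrightarrow> \<sigma> (real m + real k) w x = s"
  unfolding stay_def by (auto dest: bspec[of _ _ "m + k"])

text \<open>
  The Markov property at the last time of the interval moves one unit of time from the event into
  the observable.
\<close>

lemma stay_prob_aux:
  assumes fin: "finite W"
  shows "(\<integral>w. indicator (stay W s m j) w * survive W s k (\<sigma> (real (m + j)) w) \<partial>M) = mean (act (real m) (survive W s (k + j)))"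
proof (induction j arbitrary: k)
  case 0
  have "(\<integral>w. indicator (stay W s m 0) w * survive W s k (\<sigma> (real (m + 0)) w) \<partial>M) = (\<integral>w. survive W s k (\<sigma> (real m) w) \<partial>M)"
    by (intro Bochner_Integration.integral_cong; cases k) (auto simp: stay_def all_at_def split: split_indicator)
  also have "\<dots> = mean (act (real m) (survive W s k))"
    by (rule expectation_process[OF _ survive_obs(1)[OF fin]]) simp
  finally show ?case by simp
next
  case (Suc j)
  have "(\<integral>w. indicator (stay W s m (Suc j)) w * survive W s k (\<sigma> (real (m + Suc j)) w) \<partial>M)
      = (\<integral>w. indicator (stay W s m j) w * survive W s k (\<sigma> (real (m + j) + 1) w) \<partial>M)"
    unfolding stay_Suc
    by (intro Bochner_Integration.integral_cong; cases k)
       (auto simp: stay_def all_at_def add.commute split: split_indicator)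
  also have "\<dots> = (\<integral>w. indicator (stay W s m j) w * act 1 (survive W s k) (\<sigma> (real (m + j)) w) \<partial>M)"
    by (rule markov_integral[OF _ _ stay_past[OF fin] survive_obs(1)[OF fin]]) auto
  also have "\<dots> = (\<integral>w. indicator (stay W s m j) w * survive W s (Suc k) (\<sigma> (real (m + j)) w) \<partial>M)"
    by (intro Bochner_Integration.integral_cong) (auto simp: all_at_def stay_last split: split_indicator)
  also have "\<dots> = mean (act (real m) (survive W s (Suc k + j)))" by (rule Suc)
  finally show ?case by simp
qed

lemma stay_prob:
  assumes fin: "finite W"
  shows "prob (stay W s m k) = mean (act (real m) (survive W s k))"
proof -
  have "prob (stay W s m k) = (\<integral>w. indicator (stay W s m k) w \<partial>M)"
    using stay_event[OF fin] by simp
  also have "\<dots> = (\<integral>w. indicator (stay W s m k) w * survive W s 0 (\<sigma> (real (m + k)) w) \<partial>M)"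
    by (intro Bochner_Integration.integral_cong) (auto simp: all_at_def stay_last split: split_indicator)
  also have "\<dots> = mean (act (real m) (survive W s (0 + k)))" by (rule stay_prob_aux[OF fin])
  finally show ?thesis by simp
qed

lemma survive_translate:
  assumes per: "\<And>x \<eta>. \<eta> \<in> configs \<Longrightarrow> c x (translate l \<eta>) = c (x + l) \<eta>" and "\<eta> \<in> configs"
  shows "survive {v + l} s k \<eta> = survive {v} s k (translate l \<eta>)"
  using assms(2)
proof (induction k arbitrary: \<eta>)
  case 0
  then show ?case by (simp add: all_at_def translate_def)
next
  case (Suc k)
  have "act 1 (survive {v + l} s k) \<eta> = act 1 (\<lambda>\<xi>. survive {v} s k (translate l \<xi>)) \<eta>"
    using Suc by (intro act_cong) auto
  also have "\<dots> = act 1 (survive {v} s k) (translate l \<eta>)"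
    by (rule act_translate[OF survive_smooth _ Suc.prems per]) auto
  finally show ?case by (simp add: all_at_def translate_def)
qed

lemma stay_prob_translate:
  assumes per: "\<And>x \<eta>. \<eta> \<in> configs \<Longrightarrow> c x (translate l \<eta>) = c (x + l) \<eta>"
  shows "prob (stay {v + l} s m k) = prob (stay {v} s m k)"
proof -
  have "prob (stay {v + l} s m k) = mean (act (real m) (survive {v + l} s k))" by (rule stay_prob) simp
  also have "\<dots> = mean (\<lambda>\<eta>. act (real m) (survive {v} s k) (translate l \<eta>))"
  proof (rule mean_cong)
    fix \<eta> :: "int \<Rightarrow> int" assume c: "\<eta> \<in> configs"
    have "act (real m) (survive {v + l} s k) \<eta> = act (real m) (\<lambda>\<xi>. survive {v} s k (translate l \<xi>)) \<eta>"
      using survive_translate[OF per] c by (intro act_cong) auto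
    also have "\<dots> = act (real m) (survive {v} s k) (translate l \<eta>)"
      by (rule act_translate[OF survive_smooth _ c per]) auto
    finally show "act (real m) (survive {v + l} s k) \<eta> = act (real m) (survive {v} s k) (translate l \<eta>)" .
  qed
  also have "\<dots> = mean (act (real m) (survive {v} s k))"
    by (rule mean_translate[OF act_smooth[OF survive_smooth]]) simp
  also have "\<dots> = prob (stay {v} s m k)" by (rule stay_prob[symmetric]) simp
  finally show ?thesis .
qed

text \<open>
  \<open>survive\<close> alternates multiplication by indicators, which factorize, with the action of the
  semigroup, which factorizes up to \<open>decorrelation v v'\<close>.
\<close>

lemma survive_distant:
  "\<exists>D\<ge>0. \<forall>(v::int) v' \<eta>. v \<noteq> v' \<longrightarrow> \<eta> \<in> configs \<longrightarrow>
     \<bar>survive {v, v'} s k \<eta> - survive {v} s k \<eta> * survive {v'} s k \<eta>\<bar> \<le> D * decorrelation v v'"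
proof (induction k)
  case 0
  show ?case by (intro exI[of _ 0]) (auto simp: all_at_def)
next
  case (Suc k)
  then obtain D where D: "0 \<le> D" "\<And>(v::int) v' \<eta>. v \<noteq> v' \<Longrightarrow> \<eta> \<in> configs \<Longrightarrow>
     \<bar>survive {v, v'} s k \<eta> - survive {v} s k \<eta> * survive {v'} s k \<eta>\<bar> \<le> D * decorrelation v v'" by blast
  let ?A = "survive_decay k * exp (1 * spread)"
  have A: "0 \<le> ?A * ?A" by simp
  show ?case
  proof (intro exI[of _ "D + ?A * ?A"] conjI allI impI)
    show "0 \<le> D + ?A * ?A" using D(1) A by linarith
    fix v v' :: int and \<eta> :: "int \<Rightarrow> int" assume ne: "v \<noteq> v'" and c: "\<eta> \<in> configs"
    let ?f = "survive {v} s k" and ?g = "survive {v'} s k"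
    note bo = survive_obs(1)[of "{v}"] survive_obs(1)[of "{v'}"] survive_obs(1)[of "{v,v'}"]
    have 1: "\<bar>act 1 (survive {v, v'} s k) \<eta> - act 1 (\<lambda>\<xi>. ?f \<xi> * ?g \<xi>) \<eta>\<bar> \<le> D * decorrelation v v'"
      using bo by (intro act_close c D(2) ne bounded_obs_mult) auto
    have 2: "\<bar>act 1 (\<lambda>\<xi>. ?f \<xi> * ?g \<xi>) \<eta> - act 1 ?f \<eta> * act 1 ?g \<eta>\<bar> \<le> 1 * (?A * ?A * decorrelation v v')"
      by (rule act_product_distant[OF survive_smooth survive_smooth _ c]) simp
    have 3: "\<bar>act 1 (survive {v, v'} s k) \<eta> - act 1 ?f \<eta> * act 1 ?g \<eta>\<bar> \<le> (D + ?A * ?A) * decorrelation v v'"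
      using abs_diff_triangle[OF 1 2] by (simp only: distrib_right mult_1)
    have prod: "all_at {v, v'} s \<eta> = all_at {v} s \<eta> * all_at {v'} s \<eta>" by (simp add: all_at_def)
    have "survive {v, v'} s (Suc k) \<eta> - survive {v} s (Suc k) \<eta> * survive {v'} s (Suc k) \<eta>
        = all_at {v, v'} s \<eta> * (act 1 (survive {v, v'} s k) \<eta> - act 1 ?f \<eta> * act 1 ?g \<eta>)"
      by (simp add: prod algebra_simps)
    then have "\<bar>survive {v, v'} s (Suc k) \<eta> - survive {v} s (Suc k) \<eta> * survive {v'} s (Suc k) \<eta>\<bar>
        = \<bar>all_at {v, v'} s \<eta>\<bar> * \<bar>act 1 (survive {v, v'} s k) \<eta> - act 1 ?f \<eta> * act 1 ?g \<eta>\<bar>"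
      by (simp only: abs_mult)
    also have "\<dots> \<le> 1 * \<bar>act 1 (survive {v, v'} s k) \<eta> - act 1 ?f \<eta> * act 1 ?g \<eta>\<bar>"
      by (intro mult_right_mono all_at_bounds) simp
    also have "\<dots> \<le> (D + ?A * ?A) * decorrelation v v'" using 3 by (simp only: mult_1)
    finally show "\<bar>survive {v, v'} s (Suc k) \<eta> - survive {v} s (Suc k) \<eta> * survive {v'} s (Suc k) \<eta>\<bar>
        \<le> (D + ?A * ?A) * decorrelation v v'" .
  qed
qed

lemma stay_distant:
  "\<exists>D\<ge>0. \<forall>(v::int) v'. v \<noteq> v' \<longrightarrow>
     prob (stay {v} s m k \<inter> stay {v'} s m k) \<le> prob (stay {v} s m k) * prob (stay {v'} s m k) + D * decorrelation v v'"
proof -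
  obtain D where D: "0 \<le> D" "\<And>(v::int) v' \<eta>. v \<noteq> v' \<Longrightarrow> \<eta> \<in> configs \<Longrightarrow>
     \<bar>survive {v, v'} s k \<eta> - survive {v} s k \<eta> * survive {v'} s k \<eta>\<bar> \<le> D * decorrelation v v'"
    using survive_distant by blast
  let ?A = "survive_decay k * exp (real m * spread)"
  have A: "0 \<le> ?A * ?A" by simp
  show ?thesis
  proof (intro exI[of _ "(D + real m * (?A * ?A)) + ?A * ?A"] conjI allI impI)
    have "0 \<le> real m * (?A * ?A)" using A by simp
    then show "0 \<le> (D + real m * (?A * ?A)) + ?A * ?A" using D(1) A by linarith
    fix v v' :: int assume ne: "v \<noteq> v'"
    let ?f = "survive {v} s k" and ?g = "survive {v'} s k" and ?h = "survive {v, v'} s k"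
    let ?d = "decorrelation v v'"
    have bo: "bounded_obs ?f" "bounded_obs ?g" "bounded_obs ?h" by (auto intro: survive_obs)
    have close: "\<bar>act (real m) ?h \<eta> - act (real m) ?f \<eta> * act (real m) ?g \<eta>\<bar> \<le> (D + real m * (?A * ?A)) * ?d"
      if c: "\<eta> \<in> configs" for \<eta>
    proof -
      have 1: "\<bar>act (real m) ?h \<eta> - act (real m) (\<lambda>\<xi>. ?f \<xi> * ?g \<xi>) \<eta>\<bar> \<le> D * ?d"
        using bo by (intro act_close c D(2) ne bounded_obs_mult) auto
      have 2: "\<bar>act (real m) (\<lambda>\<xi>. ?f \<xi> * ?g \<xi>) \<eta> - act (real m) ?f \<eta> * act (real m) ?g \<eta>\<bar> \<le> real m * (?A * ?A * ?d)"
        by (rule act_product_distant[OF survive_smooth survive_smooth _ c]) simp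
      show ?thesis using abs_diff_triangle[OF 1 2] by (simp only: distrib_right mult.assoc)
    qed
    have 1: "\<bar>mean (act (real m) ?h) - mean (\<lambda>\<eta>. act (real m) ?f \<eta> * act (real m) ?g \<eta>)\<bar> \<le> (D + real m * (?A * ?A)) * ?d"
      using bo by (intro mean_close close bounded_obs_mult bounded_obs_act) auto
    have 2: "\<bar>mean (\<lambda>\<eta>. act (real m) ?f \<eta> * act (real m) ?g \<eta>) - mean (act (real m) ?f) * mean (act (real m) ?g)\<bar> \<le> ?A * ?A * ?d"
      by (intro mean_product_distant act_smooth survive_smooth) auto
    have "stay {v} s m k \<inter> stay {v'} s m k = stay {v, v'} s m k" by (auto simp: stay_def)
    then have "prob (stay {v} s m k \<inter> stay {v'} s m k) - prob (stay {v} s m k) * prob (stay {v'} s m k)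
        = mean (act (real m) ?h) - mean (act (real m) ?f) * mean (act (real m) ?g)"
      by (simp add: stay_prob)
    also have "\<dots> \<le> \<bar>mean (act (real m) ?h) - mean (act (real m) ?f) * mean (act (real m) ?g)\<bar>" by (rule abs_ge_self)
    also have "\<dots> \<le> (D + real m * (?A * ?A)) * ?d + ?A * ?A * ?d" by (rule abs_diff_triangle[OF 1 2])
    finally show "prob (stay {v} s m k \<inter> stay {v'} s m k)
        \<le> prob (stay {v} s m k) * prob (stay {v'} s m k) + ((D + real m * (?A * ?A)) + ?A * ?A) * ?d"
      by (simp add: distrib_right)
  qed
qed

section \<open>No spin survives forever\<close>

definition stay_forever :: "int \<Rightarrow> int \<Rightarrow> nat \<Rightarrow> 'w set" where
  "stay_forever v s m = (\<Inter>k. stay {v} s m k)"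

lemma stay_forever_event: "stay_forever v s m \<in> events"
  unfolding stay_forever_def by (intro sets.countable_INT') (auto intro: stay_event)

lemma stay_decseq: "decseq (stay W s m)"
  unfolding decseq_def stay_def by auto

lemma stay_tendsto: "(\<lambda>k. prob (stay {v} s m k)) \<longlonglongrightarrow> prob (stay_forever v s m)"
  unfolding stay_forever_def
  by (rule finite_Lim_measure_decseq[OF _ stay_decseq]) (auto intro: stay_event)

text \<open>
  A spin that survives until time \<open>n\<close> with a favourable neighbourhood at time \<open>n\<close> dies within the
  next unit of time with probability at least \<open>\<delta>\<close>. The probability of dying at that time tends to
  \<open>0\<close>, so a surviving spin almost never has a favourable neighbourhood.
\<close>

lemma survival_avoids_turning:
  assumes fin: "finite B" and d: "0 < \<delta>"
    and turn: "\<And>\<eta>. \<eta> \<in> configs \<Longrightarrow> \<forall>x\<in>B. \<eta> x = - s \<Longrightarrow> \<delta> \<le> act 1 (all_at {v} (- s)) \<eta>"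
    and s: "s \<noteq> 0"
  shows "(\<lambda>j. prob (stay {v} s m j \<inter> {w\<in>space M. \<forall>x\<in>B. \<sigma> (real (m + j)) w x = - s})) \<longlonglongrightarrow> 0"
proof -
  let ?p = "\<lambda>j. prob (stay {v} s m j)"
  let ?A = "\<lambda>j. {w\<in>space M. \<forall>x\<in>B. \<sigma> (real (m + j)) w x = - s}"
  have bound: "prob (stay {v} s m j \<inter> ?A j) \<le> (?p j - ?p (Suc j)) / \<delta>" for j
  proof -
    let ?H = "stay {v} s m j \<inter> ?A j"
    let ?T = "{w\<in>space M. \<forall>x\<in>{v}. \<sigma> (real (m + j) + 1) w x = - s}"
    have H: "?H \<in> sets (past (real (m + j)))"
      using fin by (intro sets.Int stay_past spins_event_past) auto
    have HE: "?H \<in> events" by (rule past_in_events[OF H])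
    have TE: "?T \<in> events" by (rule spins_event) auto
    have "\<delta> * prob ?H = (\<integral>w. indicator ?H w * \<delta> \<partial>M)" using HE by simp
    also have "\<dots> \<le> (\<integral>w. indicator ?H w * act 1 (all_at {v} (- s)) (\<sigma> (real (m + j)) w) \<partial>M)"
    proof (rule integral_mono)
      show "integrable M (\<lambda>w. indicator ?H w * \<delta>)"
        using HE by (intro integrable_mult_left integrable_real_indicator) (auto simp: emeasure_eq_measure)
      have bo: "bounded_obs (act 1 (all_at {v} (- s)))" by (intro bounded_obs_act bounded_obs_all_at) auto
      have "integrable M (\<lambda>w. act 1 (all_at {v} (- s)) (\<sigma> (real (m + j)) w))"
      proof -
        obtain b where b: "\<forall>\<eta>\<in>configs. \<bar>act 1 (all_at {v} (- s)) \<eta>\<bar> \<le> b" using bo unfolding bounded_obs_def by blast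
        show ?thesis
        proof (rule integrable_const_bound[of _ b])
          show "AE w in M. norm (act 1 (all_at {v} (- s)) (\<sigma> (real (m + j)) w)) \<le> b"
            using b process_configs[of "real (m + j)"] by (intro AE_I2) simp
          show "(\<lambda>w. act 1 (all_at {v} (- s)) (\<sigma> (real (m + j)) w)) \<in> borel_measurable M"
            using bo unfolding bounded_obs_def by (intro measurable_compose[OF measurable_process]) auto
        qed
      qed
      from integrable_mult_indicator[OF HE this]
      show "integrable M (\<lambda>w. indicator ?H w * act 1 (all_at {v} (- s)) (\<sigma> (real (m + j)) w))" by simp
      fix w assume "w \<in> space M"
      then show "indicator ?H w * \<delta> \<le> indicator ?H w * act 1 (all_at {v} (- s)) (\<sigma> (real (m + j)) w)"
        using turn[OF process_configs[of "real (m + j)" w]] by (auto split: split_indicator)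
    qed
    also have "\<dots> = (\<integral>w. indicator ?H w * all_at {v} (- s) (\<sigma> (real (m + j) + 1) w) \<partial>M)"
      by (rule markov_integral[OF _ _ H bounded_obs_all_at, symmetric]) auto
    also have "\<dots> = (\<integral>w. indicator (?H \<inter> ?T) w \<partial>M)"
      by (intro Bochner_Integration.integral_cong) (auto simp: all_at_def stay_def split: split_indicator)
    also have "\<dots> = prob (?H \<inter> ?T)" using HE TE by (simp add: sets.Int)
    also have "\<dots> \<le> prob (stay {v} s m j - stay {v} s m (Suc j))"
    proof (rule finite_measure_mono)
      show "?H \<inter> ?T \<subseteq> stay {v} s m j - stay {v} s m (Suc j)" unfolding stay_Suc using s by auto
    qed (auto intro: stay_event)
    also have "\<dots> = ?p j - ?p (Suc j)"
      by (intro finite_measure_Diff stay_event finite.intros) (auto simp: stay_Suc)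
    finally show ?thesis using d by (simp add: field_simps)
  qed
  have "(\<lambda>j. (?p j - ?p (Suc j)) / \<delta>) \<longlonglongrightarrow> (prob (stay_forever v s m) - prob (stay_forever v s m)) / \<delta>"
    using d by (intro tendsto_divide tendsto_diff stay_tendsto LIMSEQ_Suc[OF stay_tendsto] tendsto_const) auto
  then have "(\<lambda>j. (?p j - ?p (Suc j)) / \<delta>) \<longlonglongrightarrow> 0" by simp
  then show ?thesis
    by (rule tendsto_sandwich[OF _ _ tendsto_const, rotated 2])
       (intro always_eventually allI measure_nonneg bound)+
qed

text \<open>
  By the Harris inequality the spins of \<open>B\<close> all oppose \<open>s\<close> at a given time with probability at least
  \<open>(1/2) ^ b\<close>, however large the time is. At late times this event almost excludes survivors in \<open>I\<close>. The
  bound does not depend on the size of \<open>I\<close>.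
\<close>

lemma some_survivor_prob_le:
  assumes finB: "finite B" and card: "card B \<le> b" and d: "0 < \<delta>" and s: "s = 1 \<or> s = -1" and finI: "finite I"
    and turn: "\<And>v \<eta>. v \<in> I \<Longrightarrow> \<eta> \<in> configs \<Longrightarrow> \<forall>x\<in>B. \<eta> x = - s \<Longrightarrow> \<delta> \<le> act 1 (all_at {v} (- s)) \<eta>"
  shows "prob (\<Union>v\<in>I. stay_forever v s m) \<le> 1 - (1/2) ^ b"
proof -
  let ?A = "\<lambda>j. {w\<in>space M. \<forall>x\<in>B. \<sigma> (real (m + j)) w x = - s}"
  let ?U = "\<Union>v\<in>I. stay_forever v s m"
  have A: "?A j \<in> events" for j by (rule spins_event[OF _ finB]) simp
  have U: "?U \<in> events" using finI by (intro sets.finite_UN stay_forever_event)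
  have lim: "(\<lambda>j. \<Sum>v\<in>I. prob (stay {v} s m j \<inter> ?A j)) \<longlonglongrightarrow> (\<Sum>v\<in>I. 0)"
    using s turn by (intro tendsto_sum survival_avoids_turning[OF finB d]) auto
  have bound: "prob ?U \<le> (\<Sum>v\<in>I. prob (stay {v} s m j \<inter> ?A j)) + (1 - (1/2) ^ b)" for j
  proof -
    have "prob ?U = prob (?U \<inter> ?A j) + prob (?U - ?A j)"
      using finite_measure_Diff'[OF U A[of j]] by simp
    moreover have "prob (?U \<inter> ?A j) \<le> prob (\<Union>v\<in>I. stay {v} s m j \<inter> ?A j)"
    proof (rule finite_measure_mono)
      show "?U \<inter> ?A j \<subseteq> (\<Union>v\<in>I. stay {v} s m j \<inter> ?A j)" unfolding stay_forever_def by blast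
    qed (use finI A in \<open>auto intro: stay_event\<close>)
    moreover have "prob (\<Union>v\<in>I. stay {v} s m j \<inter> ?A j) \<le> (\<Sum>v\<in>I. prob (stay {v} s m j \<inter> ?A j))"
      using finI A by (intro finite_measure_subadditive_finite) (auto intro: stay_event)
    moreover have "prob (?U - ?A j) \<le> 1 - (1/2) ^ b"
    proof -
      have "prob (?U - ?A j) \<le> prob (space M - ?A j)"
        using A sets.sets_into_space[OF U] by (intro finite_measure_mono sets.Diff) auto
      also have "\<dots> = 1 - prob (?A j)" by (rule prob_compl[OF A])
      also have "\<dots> \<le> 1 - (1/2) ^ card B" using block_prob[OF _ finB, of "real (m + j)" "- s"] s by auto
      also have "\<dots> \<le> 1 - (1/2) ^ b" using power_decreasing[OF card, of "1/2::real"] by simp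
      finally show ?thesis .
    qed
    ultimately show ?thesis by linarith
  qed
  have "(\<lambda>j. (\<Sum>v\<in>I. prob (stay {v} s m j \<inter> ?A j)) + (1 - (1/2) ^ b)) \<longlonglongrightarrow> (\<Sum>v\<in>I. 0) + (1 - (1/2) ^ b)"
    by (intro tendsto_add lim tendsto_const)
  then have "(\<lambda>j. (\<Sum>v\<in>I. prob (stay {v} s m j \<inter> ?A j)) + (1 - (1/2) ^ b)) \<longlonglongrightarrow> 1 - (1/2) ^ b" by simp
  then show ?thesis by (rule LIMSEQ_le_const) (use bound in blast)
qed

lemma decorrelation_small:
  assumes "0 < \<epsilon>"
  obtains D :: nat where "\<And>v v'. int D \<le> \<bar>v - v'\<bar> \<Longrightarrow> decorrelation v v' \<le> \<epsilon>"
proof -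
  obtain n where n: "(1/2::real) ^ n < \<epsilon> / 6" using real_arch_pow_inv[of "\<epsilon> / 6" "1/2"] assms by auto
  show thesis
  proof (rule that[of "2 * n"])
    fix v v' :: int assume "int (2 * n) \<le> \<bar>v - v'\<bar>"
    then have "n \<le> nat \<bar>v - v'\<bar> div 2" by linarith
    then have "(1/2::real) ^ (nat \<bar>v - v'\<bar> div 2) \<le> (1/2) ^ n" by (intro power_decreasing) auto
    then show "decorrelation v v' \<le> \<epsilon>" using n unfolding decorrelation_def by linarith
  qed
qed

text \<open>
  Ergodicity: if one spin had a chance of surviving forever, then so would its translates by
  multiples of a large period, almost independently, and one of them would survive almost surely.
\<close>

lemma some_survivor_prob_ge:
  assumes L: "L \<ge> (1::int)" and per: "\<And>j x \<eta>. \<eta> \<in> configs \<Longrightarrow> c x (translate (j * L) \<eta>) = c (x + j * L) \<eta>"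
    and pos: "0 < prob (stay_forever v s m)" and e: "0 < \<epsilon>"
  obtains I where "finite I" "1 - \<epsilon> \<le> prob (\<Union>u\<in>I. stay_forever u s m)"
proof -
  define \<theta> where "\<theta> = prob (stay_forever v s m)"
  have th: "0 < \<theta>" using pos by (simp add: \<theta>_def)
  have shift_eq: "prob (stay {v + j * L} s m k) = prob (stay {v} s m k)" for j k
    by (rule stay_prob_translate[OF per])
  have forever_eq: "prob (stay_forever (v + j * L) s m) = \<theta>" for j
    using LIMSEQ_unique[OF stay_tendsto[of "v + j * L" s m, unfolded shift_eq] stay_tendsto] unfolding \<theta>_def .
  \<comment> \<open>One half of \<epsilon> covers the covariances, the other one the variances of the single indicators.\<close>
  define \<delta> where "\<delta> = \<theta>\<^sup>2 * \<epsilon> / 2"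
  have d: "0 < \<delta>" using th e by (simp add: \<delta>_def)
  have "(\<lambda>k. (prob (stay {v} s m k))\<^sup>2) \<longlonglongrightarrow> \<theta>\<^sup>2" unfolding \<theta>_def by (intro tendsto_power stay_tendsto)
  then have "eventually (\<lambda>k. (prob (stay {v} s m k))\<^sup>2 < \<theta>\<^sup>2 + \<delta> / 2) sequentially"
    using d by (intro order_tendstoD(2)) auto
  then obtain k where k: "(prob (stay {v} s m k))\<^sup>2 < \<theta>\<^sup>2 + \<delta> / 2" unfolding eventually_sequentially by blast
  obtain C where C: "0 \<le> C" "\<And>u u'. u \<noteq> u' \<Longrightarrow>
     prob (stay {u} s m k \<inter> stay {u'} s m k) \<le> prob (stay {u} s m k) * prob (stay {u'} s m k) + C * decorrelation u u'"
    using stay_distant by blast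
  have "0 < \<delta> / (2 * (C + 1))" using d C(1) by simp
  then obtain D :: nat where D: "\<And>u u'. int D \<le> \<bar>u - u'\<bar> \<Longrightarrow> decorrelation u u' \<le> \<delta> / (2 * (C + 1))"
    by (rule decorrelation_small) blast
  obtain J :: nat where J: "2 / (\<theta> * \<epsilon>) < real J" using reals_Archimedean2 by blast
  moreover have "0 < 2 / (\<theta> * \<epsilon>)" using th e by simp
  ultimately have J0: "0 < real J" by linarith
  \<comment> \<open>D + 1 instead of D keeps the vertices distinct if D = 0.\<close>
  define u where "u i = v + (int i * int (D + 1)) * L" for i :: nat
  have far: "int (D + 1) \<le> \<bar>u i - u j\<bar>" if "i \<noteq> j" for i j
  proof -
    have "u i - u j = ((int i - int j) * L) * int (D + 1)" by (simp add: u_def algebra_simps)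
    then have "\<bar>u i - u j\<bar> = \<bar>(int i - int j) * L\<bar> * int (D + 1)" by (simp add: abs_mult)
    moreover have "1 \<le> \<bar>(int i - int j) * L\<bar>" using that L by (simp add: abs_mult int_one_le_iff_zero_less)
    ultimately show ?thesis by (metis mult.left_neutral mult_right_mono of_nat_0_le_iff)
  qed
  have pair: "prob (stay_forever (u i) s m \<inter> stay_forever (u j) s m) \<le> \<theta>\<^sup>2 + \<delta>" if "i \<noteq> j" for i j
  proof -
    have ne: "u i \<noteq> u j" using far[OF that] by auto
    have "prob (stay_forever (u i) s m \<inter> stay_forever (u j) s m) \<le> prob (stay {u i} s m k \<inter> stay {u j} s m k)"
    proof (rule finite_measure_mono)
      show "stay_forever (u i) s m \<inter> stay_forever (u j) s m \<subseteq> stay {u i} s m k \<inter> stay {u j} s m k"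
        unfolding stay_forever_def by blast
    qed (auto intro: stay_event)
    also have "\<dots> \<le> prob (stay {u i} s m k) * prob (stay {u j} s m k) + C * decorrelation (u i) (u j)"
      by (rule C(2)[OF ne])
    also have "prob (stay {u i} s m k) * prob (stay {u j} s m k) = (prob (stay {v} s m k))\<^sup>2"
      unfolding u_def shift_eq by (simp add: power2_eq_square)
    also have "C * decorrelation (u i) (u j) \<le> C * (\<delta> / (2 * (C + 1)))"
      using far[OF that] C(1) by (intro mult_left_mono D) auto
    also have "C * (\<delta> / (2 * (C + 1))) \<le> \<delta> / 2"
      using C(1) d by (simp add: field_simps)
    finally show ?thesis using k by linarith
  qed
  let ?U = "\<Union>i\<in>{..<J}. stay_forever (u i) s m"
  have "(real (card {..<J}) * \<theta>)\<^sup>2 * prob (space M - ?U) \<le> real (card {..<J}) * \<theta> + (real (card {..<J}))\<^sup>2 * \<delta>"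
  proof (rule second_moment_bound)
    show "prob (stay_forever (u i) s m) = \<theta>" for i unfolding u_def by (rule forever_eq)
  qed (use pair d stay_forever_event in auto)
  then have main: "(real J * \<theta>)\<^sup>2 * prob (space M - ?U) \<le> real J * \<theta> + (real J)\<^sup>2 * \<delta>" by simp
  have "real J * \<theta> + (real J)\<^sup>2 * \<delta> \<le> (real J * \<theta>)\<^sup>2 * \<epsilon>"
  proof -
    have "2 \<le> real J * \<theta> * \<epsilon>" using J th e by (simp add: field_simps)
    then have "(real J * \<theta>) * 2 \<le> (real J * \<theta>) * (real J * \<theta> * \<epsilon>)" using th by (intro mult_left_mono) auto
    then show ?thesis unfolding \<delta>_def by (simp add: power2_eq_square algebra_simps)
  qed
  with main have "(real J * \<theta>)\<^sup>2 * prob (space M - ?U) \<le> (real J * \<theta>)\<^sup>2 * \<epsilon>" by linarith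
  then have "prob (space M - ?U) \<le> \<epsilon>" using J0 th by simp
  moreover have "prob (space M - ?U) = 1 - prob ?U"
    by (intro prob_compl sets.finite_UN stay_forever_event) auto
  ultimately have "1 - \<epsilon> \<le> prob (\<Union>x\<in>u ` {..<J}. stay_forever x s m)" by simp
  then show thesis by (intro that[of "u ` {..<J}"]) auto
qed

text \<open>
  In a large window some spin survives with a probability close to one, if survival is possible at
  all, but also with a probability of at most \<open>1 - (1/2) ^ b\<close>.
\<close>

theorem no_survivor:
  assumes L: "L \<ge> (1::int)" and per: "\<And>j x \<eta>. \<eta> \<in> configs \<Longrightarrow> c x (translate (j * L) \<eta>) = c (x + j * L) \<eta>"
    and s: "s = 1 \<or> s = -1"
    and turn: "\<And>k::nat. \<exists>B \<delta>. finite B \<and> card B \<le> b \<and> 0 < \<delta> \<and>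
      (\<forall>v\<in>window k. \<forall>\<eta>\<in>configs. (\<forall>x\<in>B. \<eta> x = - s) \<longrightarrow> \<delta> \<le> act 1 (all_at {v} (- s)) \<eta>)"
  shows "prob (stay_forever v s m) = 0"
proof (rule ccontr)
  assume "prob (stay_forever v s m) \<noteq> 0"
  then have pos: "0 < prob (stay_forever v s m)" by (simp add: zero_less_measure_iff)
  have e: "0 < (1/2::real) ^ b / 2" by simp
  obtain I where I: "finite I" "1 - (1/2) ^ b / 2 \<le> prob (\<Union>u\<in>I. stay_forever u s m)"
    by (rule some_survivor_prob_ge[OF L per pos e]) blast
  obtain k where k: "\<forall>x\<in>I. nat \<bar>x\<bar> \<le> k"
    using finite_nat_set_iff_bounded_le[of "(\<lambda>x. nat \<bar>x\<bar>) ` I"] I(1) by auto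
  then have sub: "I \<subseteq> window k" by force
  obtain B \<delta> where B: "finite B" "card B \<le> b" "0 < \<delta>"
    "\<And>v \<eta>. v \<in> window k \<Longrightarrow> \<eta> \<in> configs \<Longrightarrow> \<forall>x\<in>B. \<eta> x = - s \<Longrightarrow> \<delta> \<le> act 1 (all_at {v} (- s)) \<eta>"
    using turn[of k] by blast
  have "prob (\<Union>u\<in>I. stay_forever u s m) \<le> 1 - (1/2) ^ b"
    using sub B(4) by (intro some_survivor_prob_le[OF B(1-3) s I(1)]) blast
  with I(2) e show False by linarith
qed

end

section \<open>Short-time behaviour on a finite set of vertices\<close>

lemma bounded_obs_matches:
  assumes "finite J"
  shows "bounded_obs (\<lambda>\<xi>. of_bool (\<forall>x\<in>J. \<xi> x = \<zeta> x))"
proof (rule bounded_obsI[of _ 1])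
  have "(\<lambda>\<xi>. indicator {\<xi>\<in>space spin_space. \<forall>x\<in>J. \<xi> x = \<zeta> x} \<xi> :: real) \<in> borel_measurable spin_space"
    using assms by (intro borel_measurable_indicator sets_spins_event)
  then show "(\<lambda>\<xi>. of_bool (\<forall>x\<in>J. \<xi> x = \<zeta> x) :: real) \<in> borel_measurable spin_space"
    by (rule measurable_cong[THEN iffD1, rotated]) (auto simp: indicator_def)
qed auto

context spin_flip_process
begin

text \<open>
  That \<open>u\<close> flips and nothing else in \<open>J\<close> does has at least the probability of a flip at \<open>u\<close>, about
  \<open>h * c u \<eta>\<close>, minus those of a simultaneous flip elsewhere, which are \<open>o(h)\<close>.
\<close>

lemma single_flip_prob_ge:
  assumes fin: "finite J"
  obtains h\<^sub>0 where "h\<^sub>0 > 0"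
    "\<And>h u \<eta>. 0 < h \<Longrightarrow> h < h\<^sub>0 \<Longrightarrow> \<eta> \<in> configs \<Longrightarrow> u \<in> J \<Longrightarrow> 1/2 \<le> c u \<eta> \<Longrightarrow>
       h / 4 \<le> act h (\<lambda>\<xi>. of_bool (\<forall>x\<in>J. \<xi> x = flip u \<eta> x)) \<eta>"
    "\<And>h \<eta>. 0 < h \<Longrightarrow> h < h\<^sub>0 \<Longrightarrow> \<eta> \<in> configs \<Longrightarrow>
       1/2 \<le> act h (\<lambda>\<xi>. of_bool (\<forall>x\<in>J. \<xi> x = \<eta> x)) \<eta>"
proof -
  define n where "n = real (card J) + 1"
  have n: "1 \<le> n" by (simp add: n_def)
  define \<epsilon> where "\<epsilon> = 1 / (4 * n)"
  have e: "0 < \<epsilon>" "n * \<epsilon> = 1/4" using n by (auto simp: \<epsilon>_def)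
  have "eventually (\<lambda>h. \<forall>u\<in>J. \<forall>\<eta>\<in>configs. \<bar>flip_prob h u \<eta> - h * c u \<eta>\<bar> \<le> h * \<epsilon>) (at_right 0)"
    by (intro eventually_ball_finite fin ballI flip_prob_limit e)
  moreover have "eventually (\<lambda>h. \<forall>u\<in>J. \<forall>x\<in>J - {u}. \<forall>\<eta>\<in>configs. pair_flip_prob h u x \<eta> \<le> h * \<epsilon>) (at_right 0)"
    using fin by (intro eventually_ball_finite ballI pair_flip_prob_limit e) auto
  ultimately have "eventually (\<lambda>h. (\<forall>u\<in>J. \<forall>\<eta>\<in>configs. \<bar>flip_prob h u \<eta> - h * c u \<eta>\<bar> \<le> h * \<epsilon>) \<and>
      (\<forall>u\<in>J. \<forall>x\<in>J - {u}. \<forall>\<eta>\<in>configs. pair_flip_prob h u x \<eta> \<le> h * \<epsilon>)) (at_right 0)"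
    by (rule eventually_conj)
  then obtain h\<^sub>1 where h1: "h\<^sub>1 > 0"
    "\<And>h. 0 < h \<Longrightarrow> h < h\<^sub>1 \<Longrightarrow> (\<forall>u\<in>J. \<forall>\<eta>\<in>configs. \<bar>flip_prob h u \<eta> - h * c u \<eta>\<bar> \<le> h * \<epsilon>) \<and>
      (\<forall>u\<in>J. \<forall>x\<in>J - {u}. \<forall>\<eta>\<in>configs. pair_flip_prob h u x \<eta> \<le> h * \<epsilon>)"
    unfolding eventually_at_right_field by auto
  show thesis
  proof (rule that[of "min h\<^sub>1 \<epsilon>"])
    show "0 < min h\<^sub>1 \<epsilon>" using h1 e by simp
  next
    fix h u and \<eta> :: "int \<Rightarrow> int"
    assume h: "0 < h" "h < min h\<^sub>1 \<epsilon>" and c: "\<eta> \<in> configs" and u: "u \<in> J" and rate: "1/2 \<le> c u \<eta>"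
    have h': "0 \<le> h" "h < h\<^sub>1" using h by auto
    let ?I = "\<lambda>x \<xi>. of_bool (\<xi> x \<noteq> \<eta> x) :: real"
    let ?m = "\<lambda>\<xi>. of_bool (\<forall>x\<in>J. \<xi> x = flip u \<eta> x) :: real"
    let ?L = "J - {u}"
    have finL: "finite ?L" using fin by simp
    note bo = bounded_obs_diff bounded_obs_sum bounded_obs_mult bounded_obs_neq
    have "act h (\<lambda>\<xi>. ?I u \<xi> - (\<Sum>x\<in>?L. ?I u \<xi> * ?I x \<xi>)) \<eta> \<le> act h ?m \<eta>"
    proof (intro act_mono h' c bo finL bounded_obs_matches fin)
      fix \<xi> :: "int \<Rightarrow> int" assume x: "\<xi> \<in> configs"
      show "?I u \<xi> - (\<Sum>x\<in>?L. ?I u \<xi> * ?I x \<xi>) \<le> ?m \<xi>"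
      proof (cases "\<xi> u \<noteq> \<eta> u \<and> (\<forall>x\<in>?L. \<xi> x = \<eta> x)")
        case True
        then have "\<xi> u = - \<eta> u" using configs_neq_iff[OF c x] by blast
        then have "?m \<xi> = 1" using True by (auto simp: flip_def)
        moreover have "0 \<le> (\<Sum>x\<in>?L. ?I u \<xi> * ?I x \<xi>)" by (intro sum_nonneg) auto
        moreover have "?I u \<xi> \<le> 1" by simp
        ultimately show ?thesis by linarith
      next
        case False
        have "?I u \<xi> \<le> (\<Sum>x\<in>?L. ?I u \<xi> * ?I x \<xi>)"
        proof (cases "\<xi> u = \<eta> u")
          case True
          then show ?thesis by (simp add: sum_nonneg)
        next
          case neq: False
          then obtain y where y: "y \<in> ?L" "\<xi> y \<noteq> \<eta> y" using False by blast
          have "?I u \<xi> * ?I y \<xi> \<le> (\<Sum>x\<in>?L. ?I u \<xi> * ?I x \<xi>)"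
            using y finL by (intro member_le_sum) auto
          then show ?thesis using y by simp
        qed
        moreover have "0 \<le> ?m \<xi>" by simp
        ultimately show ?thesis by linarith
      qed
    qed
    also have "act h (\<lambda>\<xi>. ?I u \<xi> - (\<Sum>x\<in>?L. ?I u \<xi> * ?I x \<xi>)) \<eta> = flip_prob h u \<eta> - (\<Sum>x\<in>?L. pair_flip_prob h u x \<eta>)"
      unfolding flip_prob_def pair_flip_prob_def
      by (simp only: act_diff act_sum bo h' c finL)
    finally have 1: "flip_prob h u \<eta> - (\<Sum>x\<in>?L. pair_flip_prob h u x \<eta>) \<le> act h ?m \<eta>" .
    have "(\<Sum>x\<in>?L. pair_flip_prob h u x \<eta>) \<le> (\<Sum>x\<in>?L. h * \<epsilon>)"
      using h1(2)[OF h(1) h'(2)] u c by (intro sum_mono) blast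
    also have "\<dots> \<le> (n - 1) * (h * \<epsilon>)"
      using fin u h e unfolding n_def by (simp add: card_Diff_singleton mult_right_mono)
    finally have 2: "(\<Sum>x\<in>?L. pair_flip_prob h u x \<eta>) \<le> (n - 1) * (h * \<epsilon>)" .
    have "\<bar>flip_prob h u \<eta> - h * c u \<eta>\<bar> \<le> h * \<epsilon>" using h1(2)[OF h(1) h'(2)] u c by blast
    moreover have "h * (1/2) \<le> h * c u \<eta>" using rate h by (intro mult_left_mono) auto
    moreover have "(n - 1) * (h * \<epsilon>) + h * \<epsilon> = h * (n * \<epsilon>)" by (simp add: algebra_simps)
    then have "(n - 1) * (h * \<epsilon>) + h * \<epsilon> = h / 4" unfolding e(2) by simp
    ultimately show "h / 4 \<le> act h ?m \<eta>" using 1 2 by linarith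
  next
    fix h and \<eta> :: "int \<Rightarrow> int"
    assume h: "0 < h" "h < min h\<^sub>1 \<epsilon>" and c: "\<eta> \<in> configs"
    have h': "0 \<le> h" "h \<le> \<epsilon>" using h by auto
    let ?I = "\<lambda>x \<xi>. of_bool (\<xi> x \<noteq> \<eta> x) :: real"
    let ?m = "\<lambda>\<xi>. of_bool (\<forall>x\<in>J. \<xi> x = \<eta> x) :: real"
    note bo = bounded_obs_diff bounded_obs_sum bounded_obs_neq bounded_obs_const
    have "act h (\<lambda>\<xi>. 1 - (\<Sum>x\<in>J. ?I x \<xi>)) \<eta> \<le> act h ?m \<eta>"
    proof (intro act_mono h' c bo bounded_obs_matches fin)
      fix \<xi> :: "int \<Rightarrow> int" assume "\<xi> \<in> configs"
      show "1 - (\<Sum>x\<in>J. ?I x \<xi>) \<le> ?m \<xi>"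
      proof (cases "\<forall>x\<in>J. \<xi> x = \<eta> x")
        case True
        then show ?thesis by (simp add: sum_nonneg)
      next
        case False
        then obtain y where y: "y \<in> J" "\<xi> y \<noteq> \<eta> y" by blast
        have "?I y \<xi> \<le> (\<Sum>x\<in>J. ?I x \<xi>)" using y fin by (intro member_le_sum) auto
        moreover have "?I y \<xi> = 1" using y by simp
        moreover have "0 \<le> ?m \<xi>" by simp
        ultimately show ?thesis by linarith
      qed
    qed
    also have "act h (\<lambda>\<xi>. 1 - (\<Sum>x\<in>J. ?I x \<xi>)) \<eta> = 1 - (\<Sum>x\<in>J. flip_prob h x \<eta>)"
      unfolding flip_prob_def by (simp only: act_diff act_sum act_const bo h' c fin)
    finally have 1: "1 - (\<Sum>x\<in>J. flip_prob h x \<eta>) \<le> act h ?m \<eta>" .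
    have "(\<Sum>x\<in>J. flip_prob h x \<eta>) \<le> (\<Sum>x\<in>J. 2 * h)" using h' c by (intro sum_mono flip_prob_le) auto
    also have "\<dots> = (n - 1) * (2 * h)" by (simp add: n_def)
    also have "\<dots> \<le> n * (2 * \<epsilon>)" using h' n by (intro mult_mono) auto
    also have "\<dots> = 1/2" using e(2) by simp
    finally show "1/2 \<le> act h ?m \<eta>" using 1 by linarith
  qed
qed

text \<open>
  If from every configuration that agrees with \<open>s\<close> on \<open>J - I\<close> some spin in \<open>I\<close> opposed to \<open>s\<close> may
  flip, then one possible history of the next unit of time erases the opposed spins in \<open>I\<close> one by
  one while no other spin in \<open>J\<close> flips.
\<close>

lemma erase_prob_pos:
  assumes fin: "finite J" and sub: "I \<subseteq> J"
    and erase: "\<And>\<eta>. \<eta> \<in> configs \<Longrightarrow> \<forall>x\<in>J - I. \<eta> x = s \<Longrightarrow> \<exists>x\<in>I. \<eta> x \<noteq> s \<Longrightarrow> \<exists>u\<in>I. \<eta> u \<noteq> s \<and> 1/2 \<le> c u \<eta>"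
    and s: "s = 1 \<or> s = -1"
  obtains \<delta> where "0 < \<delta>" "\<And>\<eta>. \<eta> \<in> configs \<Longrightarrow> \<forall>x\<in>J - I. \<eta> x = s \<Longrightarrow> \<delta> \<le> act 1 (all_at J s) \<eta>"
proof -
  obtain h\<^sub>0 where h0: "h\<^sub>0 > 0"
    and flip_ge: "\<And>h u \<eta>. 0 < h \<Longrightarrow> h < h\<^sub>0 \<Longrightarrow> \<eta> \<in> configs \<Longrightarrow> u \<in> J \<Longrightarrow> 1/2 \<le> c u \<eta> \<Longrightarrow>
       h / 4 \<le> act h (\<lambda>\<xi>. of_bool (\<forall>x\<in>J. \<xi> x = flip u \<eta> x)) \<eta>"
    and keep_ge: "\<And>h \<eta>. 0 < h \<Longrightarrow> h < h\<^sub>0 \<Longrightarrow> \<eta> \<in> configs \<Longrightarrow>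
       1/2 \<le> act h (\<lambda>\<xi>. of_bool (\<forall>x\<in>J. \<xi> x = \<eta> x)) \<eta>"
    by (rule single_flip_prob_ge[OF fin]) blast
  have finI: "finite I" using fin sub by (rule finite_subset[rotated])
  obtain N :: nat where N: "1 / h\<^sub>0 + real (card I) + 2 < real N" using reals_Archimedean2 by blast
  have pos: "0 < 1 / h\<^sub>0" using h0 by simp
  have N1: "1 / h\<^sub>0 < real N" "card I \<le> N" "2 < real N" using N pos by linarith+
  define h where "h = 1 / real N"
  have h: "0 < h" "h < h\<^sub>0" "h \<le> 1" "real N * h = 1" using N1 h0 by (auto simp: h_def field_simps)
  let ?bad = "\<lambda>\<eta>. {x\<in>I. \<eta> x \<noteq> s}"
  have bo: "bounded_obs (all_at J s)" by (rule bounded_obs_all_at[OF fin])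
  have chain: "(h / 4) ^ n \<le> act (real n * h) (all_at J s) \<eta>"
    if "\<eta> \<in> configs" "\<forall>x\<in>J - I. \<eta> x = s" "card (?bad \<eta>) \<le> n" for n \<eta>
    using that
  proof (induction n arbitrary: \<eta>)
    case 0
    then have "?bad \<eta> = {}" using finI by simp
    then have "all_at J s \<eta> = 1" using 0 sub by (auto simp: all_at_def)
    then show ?case using act_0[OF 0(1) bo] by simp
  next
    case (Suc n)
    note c = Suc.prems(1)
    obtain \<zeta> where z: "\<forall>x\<in>J - I. \<zeta> x = s" "card (?bad \<zeta>) \<le> n"
      and match: "h / 4 \<le> act h (\<lambda>\<xi>. of_bool (\<forall>x\<in>J. \<xi> x = \<zeta> x)) \<eta>"
    proof (cases "?bad \<eta> = {}")
      case True
      have "h / 4 \<le> act h (\<lambda>\<xi>. of_bool (\<forall>x\<in>J. \<xi> x = \<eta> x)) \<eta>"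
        using keep_ge[OF h(1,2) c] h by linarith
      then show thesis by (rule that[OF Suc.prems(2), rotated]) (simp only: True card.empty le0)
    next
      case False
      then obtain u where u: "u \<in> I" "\<eta> u \<noteq> s" "1/2 \<le> c u \<eta>" using erase[OF c Suc.prems(2)] by blast
      have "flip u \<eta> u = s" using configs_cases[OF c, of u] u(2) s by auto
      then have "?bad (flip u \<eta>) = ?bad \<eta> - {u}" by (auto simp: flip_def)
      then have "card (?bad (flip u \<eta>)) \<le> n" using Suc.prems(3) u finI by (simp add: card_Diff_singleton)
      moreover have "\<forall>x\<in>J - I. flip u \<eta> x = s" using Suc.prems(2) u(1) by (auto simp: flip_def)
      moreover have "h / 4 \<le> act h (\<lambda>\<xi>. of_bool (\<forall>x\<in>J. \<xi> x = flip u \<eta> x)) \<eta>"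
        using u sub by (intro flip_ge h c) auto
      ultimately show thesis by (intro that)
    qed
    let ?m = "\<lambda>\<xi>. of_bool (\<forall>x\<in>J. \<xi> x = \<zeta> x) :: real"
    have nh: "0 \<le> real n * h" "0 \<le> h" using h by auto
    have "(h / 4) ^ Suc n \<le> (h / 4) ^ n * act h ?m \<eta>" using match h by (simp add: mult_right_mono)
    also have "\<dots> = act h (\<lambda>\<xi>. (h / 4) ^ n * ?m \<xi>) \<eta>" by (rule act_cmult[symmetric])
    also have "\<dots> \<le> act h (act (real n * h) (all_at J s)) \<eta>"
    proof (intro act_mono nh c bounded_obs_act bo bounded_obs_mult bounded_obs_const bounded_obs_matches fin)
      fix \<xi> :: "int \<Rightarrow> int" assume x: "\<xi> \<in> configs"
      show "(h / 4) ^ n * ?m \<xi> \<le> act (real n * h) (all_at J s) \<xi>"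
      proof (cases "\<forall>x\<in>J. \<xi> x = \<zeta> x")
        case True
        then have eq: "\<xi> x = \<zeta> x" if "x \<in> J" for x using that by blast
        have "?bad \<xi> = ?bad \<zeta>"
        proof (rule Collect_cong)
          show "(x \<in> I \<and> \<xi> x \<noteq> s) = (x \<in> I \<and> \<zeta> x \<noteq> s)" for x
            using eq[of x] subsetD[OF sub, of x] by metis
        qed
        then have "card (?bad \<xi>) \<le> n" using z(2) by simp
        moreover have "\<forall>x\<in>J - I. \<xi> x = s"
        proof
          fix x assume "x \<in> J - I"
          then show "\<xi> x = s" using eq[of x] z(1) by simp
        qed
        ultimately have "(h / 4) ^ n \<le> act (real n * h) (all_at J s) \<xi>" by (intro Suc.IH x)
        then show ?thesis using True by simp
      next
        case False
        have "act (real n * h) (\<lambda>_. 0) \<xi> \<le> act (real n * h) (all_at J s) \<xi>"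
          by (intro act_mono nh x bo bounded_obs_const all_at_bounds)
        moreover have "?m \<xi> = 0" using False by (simp only: of_bool_eq)
        ultimately show ?thesis using act_const[OF nh(1) x, of 0] by (simp only: mult_zero_right)
      qed
    qed
    also have "\<dots> = act (h + real n * h) (all_at J s) \<eta>" by (rule act_semigroup[OF nh(2,1) c bo, symmetric])
    also have "h + real n * h = real (Suc n) * h" by (simp add: algebra_simps)
    finally show ?case .
  qed
  show thesis
  proof (rule that[of "(h / 4) ^ N"])
    show "0 < (h / 4) ^ N" using h by simp
    fix \<eta> :: "int \<Rightarrow> int" assume c: "\<eta> \<in> configs" and b: "\<forall>x\<in>J - I. \<eta> x = s"
    have "card (?bad \<eta>) \<le> card I" using finI by (intro card_mono) auto
    then have "card (?bad \<eta>) \<le> N" using N1 by simp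
    from chain[OF c b this] show "(h / 4) ^ N \<le> act 1 (all_at J s) \<eta>" unfolding h(4) .
  qed
qed

text \<open>
  A set of configurations in which the spins of \<open>S\<close> cannot flip is absorbing: the probability of
  leaving it within time \<open>h\<close> is \<open>o(h)\<close>, so over \<open>n\<close> intervals of length \<open>t / n\<close> it is as small as desired.
\<close>

lemma frozen_stays:
  assumes fin: "finite S" and frozen: "\<And>\<eta> u. \<eta> \<in> configs \<Longrightarrow> \<forall>x\<in>S. \<eta> x = s \<Longrightarrow> u \<in> S \<Longrightarrow> c u \<eta> = 0"
    and c: "\<eta> \<in> configs" and S: "\<forall>x\<in>S. \<eta> x = s" and t: "0 < t"
  shows "act t (\<lambda>\<xi>. 1 - all_at S s \<xi>) \<eta> \<le> 0"
proof (rule field_le_epsilon)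
  fix e :: real assume e: "0 < e"
  let ?g = "\<lambda>\<xi>. 1 - all_at S s \<xi>"
  define n where "n = real (card S) + 1"
  have n: "0 < n" by (simp add: n_def)
  define \<epsilon> where "\<epsilon> = e / (n * t)"
  have eps: "0 < \<epsilon>" using e n t by (simp add: \<epsilon>_def)
  have bo: "bounded_obs ?g" by (intro bounded_obs_diff bounded_obs_const bounded_obs_all_at fin)
  have "eventually (\<lambda>h. \<forall>x\<in>S. \<forall>\<eta>\<in>configs. \<bar>flip_prob h x \<eta> - h * c x \<eta>\<bar> \<le> h * \<epsilon>) (at_right 0)"
    by (intro eventually_ball_finite fin ballI flip_prob_limit eps)
  then obtain h\<^sub>0 where h0: "h\<^sub>0 > 0"
    "\<And>h. 0 < h \<Longrightarrow> h < h\<^sub>0 \<Longrightarrow> \<forall>x\<in>S. \<forall>\<eta>\<in>configs. \<bar>flip_prob h x \<eta> - h * c x \<eta>\<bar> \<le> h * \<epsilon>"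
    unfolding eventually_at_right_field by auto
  have leave: "act h ?g \<eta> \<le> n * (h * \<epsilon>)" if h: "0 < h" "h < h\<^sub>0" and c: "\<eta> \<in> configs" and S: "\<forall>x\<in>S. \<eta> x = s" for h \<eta>
  proof -
    have h': "0 \<le> h" using h by simp
    let ?I = "\<lambda>x \<xi>. of_bool (\<xi> x \<noteq> \<eta> x) :: real"
    have "act h ?g \<eta> \<le> act h (\<lambda>\<xi>. \<Sum>x\<in>S. ?I x \<xi>) \<eta>"
    proof (intro act_mono h' c bo bounded_obs_sum bounded_obs_neq fin)
      fix \<xi> :: "int \<Rightarrow> int"
      show "?g \<xi> \<le> (\<Sum>x\<in>S. ?I x \<xi>)"
      proof (cases "\<forall>x\<in>S. \<xi> x = s")
        case True
        then show ?thesis by (simp add: all_at_def sum_nonneg)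
      next
        case False
        then obtain y where y: "y \<in> S" "\<xi> y \<noteq> \<eta> y" using S by auto
        have "?I y \<xi> \<le> (\<Sum>x\<in>S. ?I x \<xi>)" using y fin by (intro member_le_sum) auto
        then show ?thesis using y all_at_bounds(1)[of S s \<xi>] by simp
      qed
    qed
    also have "\<dots> = (\<Sum>x\<in>S. flip_prob h x \<eta>)"
      unfolding flip_prob_def by (simp only: act_sum bounded_obs_neq h' c)
    also have "\<dots> \<le> (\<Sum>x\<in>S. h * \<epsilon>)"
    proof (intro sum_mono)
      fix x assume "x \<in> S"
      then have "\<bar>flip_prob h x \<eta> - h * c x \<eta>\<bar> \<le> h * \<epsilon>" using h0(2)[OF h] c by blast
      moreover have "c x \<eta> = 0" by (rule frozen[OF c S \<open>x \<in> S\<close>])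
      ultimately show "flip_prob h x \<eta> \<le> h * \<epsilon>" by simp
    qed
    also have "\<dots> \<le> n * (h * \<epsilon>)" using h eps by (simp add: n_def mult_right_mono)
    finally show ?thesis .
  qed
  have iter: "act (real k * h) ?g \<eta> \<le> real k * (n * (h * \<epsilon>))"
    if h: "0 < h" "h < h\<^sub>0" and c: "\<eta> \<in> configs" and S: "\<forall>x\<in>S. \<eta> x = s" for k h \<eta>
    using c S
  proof (induction k arbitrary: \<eta>)
    case 0
    then show ?case using act_0[OF 0(1) bo] by (simp add: all_at_def)
  next
    case (Suc k)
    have kh: "0 \<le> h" "0 \<le> real k * h" using h by auto
    have nn: "0 \<le> real k * (n * (h * \<epsilon>))" using h n eps by simp
    have "act (real (Suc k) * h) ?g \<eta> = act (h + real k * h) ?g \<eta>" by (simp add: algebra_simps)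
    also have "\<dots> = act h (act (real k * h) ?g) \<eta>" by (rule act_semigroup[OF kh Suc.prems(1) bo])
    also have "\<dots> \<le> act h (\<lambda>\<xi>. ?g \<xi> + real k * (n * (h * \<epsilon>))) \<eta>"
    proof (intro act_mono kh Suc.prems(1) bounded_obs_act bo bounded_obs_add bounded_obs_const)
      fix \<xi> :: "int \<Rightarrow> int" assume x: "\<xi> \<in> configs"
      show "act (real k * h) ?g \<xi> \<le> ?g \<xi> + real k * (n * (h * \<epsilon>))"
      proof (cases "\<forall>x\<in>S. \<xi> x = s")
        case True
        have "act (real k * h) ?g \<xi> \<le> real k * (n * (h * \<epsilon>))" by (rule Suc.IH[OF x True])
        then show ?thesis using all_at_bounds(2)[of S s \<xi>] by linarith
      next
        case False
        then have "?g \<xi> = 1" by (simp add: all_at_def)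
        moreover have "act (real k * h) ?g \<xi> \<le> act (real k * h) (\<lambda>_. 1) \<xi>"
          by (intro act_mono kh x bo bounded_obs_const) (simp add: all_at_bounds)
        ultimately show ?thesis using kh x nn by (simp add: act_const)
      qed
    qed
    also have "\<dots> = act h ?g \<eta> + real k * (n * (h * \<epsilon>))"
      by (simp only: act_add act_const bo bounded_obs_const kh Suc.prems(1))
    also have "\<dots> \<le> n * (h * \<epsilon>) + real k * (n * (h * \<epsilon>))" using leave[OF h Suc.prems] by simp
    finally show ?case by (simp add: distrib_right)
  qed
  obtain N :: nat where N: "t / h\<^sub>0 < real N" using reals_Archimedean2 by blast
  moreover have "0 < t / h\<^sub>0" using t h0 by simp
  ultimately have N0: "0 < real N" by linarith
  have h: "0 < t / real N" "t / real N < h\<^sub>0" "real N * (t / real N) = t" using N N0 t h0(1) by (auto simp: field_simps)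
  have "act t ?g \<eta> \<le> real N * (n * (t / real N * \<epsilon>))" using iter[OF h(1,2) c S, of N] unfolding h(3) .
  also have "\<dots> = e" using N0 n t by (simp add: \<epsilon>_def field_simps)
  finally show "act t ?g \<eta> \<le> 0 + e" by simp
qed

end

section \<open>Trajectories\<close>

text \<open>
  After the last flip the trajectory is continuous from both sides and has integer values.
\<close>

lemma fixates_imp_eventually_constant:
  assumes cad: "cadlag x" and fixed: "fixates x"
  shows "\<exists>m::nat. \<forall>i\<ge>m. x (real i) = x (real m)"
proof -
  have fin: "finite (flip_times x)" using fixed by (simp add: fixates_def)
  obtain m :: nat where m: "Max (insert 0 (flip_times x)) + 1 \<le> real m" using real_arch_simple by blast
  have no_flip: "t \<notin> flip_times x" if "real m \<le> t" for t
  proof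
    assume "t \<in> flip_times x"
    then have "t \<le> Max (insert 0 (flip_times x))" using fin by simp
    then show False using m that by linarith
  qed
  have m0: "0 < real m"
  proof -
    have "0 \<le> Max (insert 0 (flip_times x))" using fin by simp
    then show ?thesis using m by linarith
  qed
  have cont: "isCont (\<lambda>t. real_of_int (x t)) t" if t: "real m \<le> t" for t
  proof -
    have "(x \<longlongrightarrow> x t) (at_left t)" using no_flip[OF t] m0 t by (simp add: flip_times_def)
    moreover have "(x \<longlongrightarrow> x t) (at_right t)" using cad m0 t by (simp add: cadlag_def)
    ultimately have "(x \<longlongrightarrow> x t) (at t)" by (simp add: filterlim_at_split)
    then have "((\<lambda>t. real_of_int (x t)) \<longlongrightarrow> real_of_int (x t)) (at t)"
      unfolding tendsto_discrete by (intro tendsto_eventually) (auto elim: eventually_mono)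
    then show ?thesis by (simp add: isCont_def)
  qed
  have "(\<lambda>t. real_of_int (x t)) constant_on {real m..}"
  proof (rule continuous_discrete_range_constant)
    show "connected {real m..}" by simp
    show "continuous_on {real m..} (\<lambda>t. real_of_int (x t))"
      using cont by (intro continuous_at_imp_continuous_on) auto
    fix t
    show "\<exists>e>0. \<forall>y. y \<in> {real m..} \<and> real_of_int (x y) \<noteq> real_of_int (x t) \<longrightarrow>
        e \<le> norm (real_of_int (x y) - real_of_int (x t))"
    proof (intro exI[of _ 1] conjI allI impI)
      fix y assume "y \<in> {real m..} \<and> real_of_int (x y) \<noteq> real_of_int (x t)"
      then have "x y \<noteq> x t" by simp
      then have "1 \<le> \<bar>x y - x t\<bar>" by arith
      then have "real_of_int 1 \<le> real_of_int \<bar>x y - x t\<bar>" by (simp only: of_int_le_iff)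
      then show "1 \<le> norm (real_of_int (x y) - real_of_int (x t))" by simp
    qed simp
  qed
  then obtain a where a: "\<And>t. real m \<le> t \<Longrightarrow> real_of_int (x t) = a" unfolding constant_on_def by auto
  show ?thesis
  proof (intro exI[of _ m] allI impI)
    fix i assume "m \<le> i"
    then have "real_of_int (x (real i)) = real_of_int (x (real m))" using a by simp
    then show "x (real i) = x (real m)" by simp
  qed
qed

text \<open>
  Right-continuity extends the constant value from the rational times to all times.
\<close>

lemma constant_on_rationals_imp_fixates:
  assumes cad: "cadlag x" and rat: "\<And>q. q \<in> \<rat> \<Longrightarrow> 0 \<le> q \<Longrightarrow> x q = a"
  shows "fixates x"
proof -
  have const: "x t = a" if t: "0 \<le> t" for t
  proof -
    have "(x \<longlongrightarrow> x t) (at_right t)" using cad t by (simp add: cadlag_def)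
    then have "eventually (\<lambda>s. x s = x t) (at_right t)" by (simp add: tendsto_discrete)
    then obtain b where b: "t < b" "\<And>s. t < s \<Longrightarrow> s < b \<Longrightarrow> x s = x t"
      unfolding eventually_at_right_field by blast
    obtain q where q: "q \<in> \<rat>" "t < q" "q < b" using Rats_dense_in_real[OF b(1)] by blast
    then show ?thesis using b(2)[of q] rat[of q] t by simp
  qed
  have "flip_times x = {}"
  proof (rule ccontr)
    assume "flip_times x \<noteq> {}"
    then obtain t where t: "0 < t" "\<not> (x \<longlongrightarrow> x t) (at_left t)" by (auto simp: flip_times_def)
    have "eventually (\<lambda>s. s \<in> {0<..<t}) (at_left t)" using t(1) by (rule eventually_at_left_real)
    then have "eventually (\<lambda>s. x s = x t) (at_left t)"
      by eventually_elim (use const t(1) in auto)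
    then have "(x \<longlongrightarrow> x t) (at_left t)" by (simp add: tendsto_discrete)
    with t(2) show False by simp
  qed
  then show ?thesis by (simp add: fixates_def)
qed

section \<open>The Ising dynamics on a periodic graph\<close>

lemma flip_rate_antimono:
  "energy_change E x \<xi> \<le> energy_change E y \<eta> \<Longrightarrow> flip_rate E y \<eta> \<le> flip_rate E x \<xi>"
  unfolding flip_rate_def by auto

lemma flip_rate_bounds: "0 \<le> flip_rate E x \<eta>" "flip_rate E x \<eta> \<le> 1"
  by (auto simp: flip_rate_def)

text \<open>
  If \<open>S\<close> contains exactly the neighbours of \<open>v\<close> that agree with \<open>v\<close>, then a flip at \<open>v\<close> costs energy for
  the edges into \<open>S\<close> and gains it for the others.
\<close>

lemma energy_change_eq_degrees:
  assumes fin: "finite {u. {u, v} \<in> E}" and S: "\<And>u. {u, v} \<in> E \<Longrightarrow> \<eta> u * \<eta> v = (if u \<in> S then 1 else -1)"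
  shows "energy_change E v \<eta> = 2 * (int (deg_in E S v) - int (deg_in E (- S) v))"
proof -
  let ?N = "{u. {u, v} \<in> E}"
  have deg: "deg_in E T v = card (?N \<inter> T)" for T
    unfolding deg_in_def by (rule arg_cong[where f=card]) (auto simp: insert_commute)
  have "(\<Sum>u\<in>?N. \<eta> u * \<eta> v) = (\<Sum>u\<in>?N. if u \<in> S then 1 else -1)" using S by (intro sum.cong) auto
  also have "\<dots> = (\<Sum>u\<in>?N \<inter> S. 1) + (\<Sum>u\<in>?N \<inter> - S. -1)"
    using fin by (subst sum.If_cases) (auto simp: Collect_mem_eq)
  also have "\<dots> = int (deg_in E S v) - int (deg_in E (- S) v)" unfolding deg by simp
  finally show ?thesis unfolding energy_change_def by simp
qed

text \<open>
  The worst case for \<open>v\<close> is that all its neighbours outside \<open>S\<close> oppose it.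
\<close>

lemma energy_change_ge_degrees:
  assumes fin: "finite {u. {u, v} \<in> E}" and c: "\<eta> \<in> configs" and S: "\<forall>x\<in>S. \<eta> x = 1" and v: "v \<in> S"
  shows "2 * (int (deg_in E S v) - int (deg_in E (- S) v)) \<le> energy_change E v \<eta>"
proof -
  let ?N = "{u. {u, v} \<in> E}"
  have deg: "deg_in E T v = card (?N \<inter> T)" for T
    unfolding deg_in_def by (rule arg_cong[where f=card]) (auto simp: insert_commute)
  have "int (deg_in E S v) - int (deg_in E (- S) v) = (\<Sum>u\<in>?N \<inter> S. 1) + (\<Sum>u\<in>?N \<inter> - S. -1)"
    unfolding deg by simp
  also have "\<dots> = (\<Sum>u\<in>?N. if u \<in> S then 1 else -1)"
    using fin by (subst sum.If_cases) (auto simp: Collect_mem_eq)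
  also have "\<dots> \<le> (\<Sum>u\<in>?N. \<eta> u * \<eta> v)"
  proof (rule sum_mono)
    fix u
    show "(if u \<in> S then 1 else -1) \<le> \<eta> u * \<eta> v" using S v configs_cases[OF c, of u] by auto
  qed
  finally show ?thesis unfolding energy_change_def by simp
qed

text \<open>
  What the class of graphs provides for the dynamics: finite degrees, invariance under all multiples
  of \<open>L\<close>, and edges of bounded length.
\<close>

locale periodic_ising =
  fixes E :: "int set set" and L :: int and R :: nat
  assumes finite_neighbours: "finite {u. {u, v} \<in> E}"
    and L_pos: "1 \<le> L"
    and periodic: "{x + j * L, y + j * L} \<in> E \<longleftrightarrow> {x, y} \<in> E"
    and edge_length: "{x, y} \<in> E \<Longrightarrow> \<bar>x - y\<bar> \<le> int R"
begin

lemma flip_rate_local: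
  assumes "\<And>y. \<bar>y - x\<bar> \<le> int R \<Longrightarrow> \<xi> y = \<eta> y"
  shows "flip_rate E x \<xi> = flip_rate E x \<eta>"
proof -
  have "\<xi> u * \<xi> x = \<eta> u * \<eta> x" if "{u, x} \<in> E" for u
    using assms[of x] assms[of u] edge_length[OF that] by simp
  then have "energy_change E x \<xi> = energy_change E x \<eta>"
    unfolding energy_change_def by (intro arg_cong[where f="\<lambda>s. 2 * s"] sum.cong) auto
  then show ?thesis by (simp add: flip_rate_def)
qed

lemma flip_rate_minus:
  assumes "y \<noteq> x" "\<eta> y = -1" "\<eta> x = -1"
  shows "flip_rate E x \<eta> \<le> flip_rate E x (flip y \<eta>)"
proof (rule flip_rate_antimono)
  show "energy_change E x (flip y \<eta>) \<le> energy_change E x \<eta>"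
    unfolding energy_change_def using assms by (intro mult_left_mono sum_mono) (auto simp: flip_def)
qed

lemma flip_rate_plus:
  assumes "y \<noteq> x" "\<eta> y = -1" "\<eta> x = 1"
  shows "flip_rate E x (flip y \<eta>) \<le> flip_rate E x \<eta>"
proof (rule flip_rate_antimono)
  show "energy_change E x \<eta> \<le> energy_change E x (flip y \<eta>)"
    unfolding energy_change_def using assms by (intro mult_left_mono sum_mono) (auto simp: flip_def)
qed

lemma flip_rate_negate: "flip_rate E x (negate \<eta>) = flip_rate E x \<eta>"
  by (simp add: flip_rate_def energy_change_def negate_def)

lemma flip_rate_translate: "flip_rate E x (translate (j * L) \<eta>) = flip_rate E (x + j * L) \<eta>"
proof -
  have "(\<Sum>u\<in>{u. {u, x} \<in> E}. \<eta> (u + j * L) * \<eta> (x + j * L)) = (\<Sum>u\<in>{u. {u, x + j * L} \<in> E}. \<eta> u * \<eta> (x + j * L))"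
  proof (rule sum.reindex_bij_witness[of _ "\<lambda>u. u - j * L" "\<lambda>u. u + j * L"])
    fix u assume "u \<in> {u. {u, x + j * L} \<in> E}"
    then show "u - j * L \<in> {u. {u, x} \<in> E}" using periodic[of "u - j * L" j x] by simp
  qed (use periodic in auto)
  then show ?thesis by (simp add: flip_rate_def energy_change_def translate_def)
qed

text \<open>
  The block around the window, of width \<open>R\<close> on either side, screens the window from the outside: each
  neighbour of an opposed spin is itself opposed, or agrees with \<open>s\<close>. The shrink property for the set
  of opposed spins thus yields a spin whose flip does not increase the energy.
\<close>

lemma erase_step:
  assumes shrink: "shrink_property E" and c: "\<eta> \<in> configs" and s: "s = 1 \<or> s = -1"
    and out: "\<forall>x\<in>window (k + R) - window k. \<eta> x = s" and ex: "\<exists>x\<in>window k. \<eta> x \<noteq> s"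
  shows "\<exists>u\<in>window k. \<eta> u \<noteq> s \<and> 1/2 \<le> flip_rate E u \<eta>"
proof -
  let ?S = "{x\<in>window k. \<eta> x \<noteq> s}"
  have "finite ?S" by (rule finite_subset[of _ "window k"]) auto
  moreover have "?S \<noteq> {}" using ex by blast
  ultimately obtain u where u: "u \<in> ?S" "deg_in E ?S u \<le> deg_in E (- ?S) u"
    using shrink unfolding shrink_property_def by meson
  have "energy_change E u \<eta> = 2 * (int (deg_in E ?S u) - int (deg_in E (- ?S) u))"
  proof (rule energy_change_eq_degrees[OF finite_neighbours])
    fix v assume "{v, u} \<in> E"
    then have "\<bar>v - u\<bar> \<le> int R" by (rule edge_length)
    then have v: "v \<in> window (k + R)" using u(1) by auto
    have opp: "\<eta> x = - s" if "\<eta> x \<noteq> s" for x using configs_cases[OF c, of x] s that by auto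
    show "\<eta> v * \<eta> u = (if v \<in> ?S then 1 else -1)"
    proof (cases "v \<in> ?S")
      case True
      then have "\<eta> v = - s" "\<eta> u = - s" using opp u(1) by blast+
      then show ?thesis using True s by auto
    next
      case False
      then have "\<eta> v = s" "\<eta> u = - s" using v out opp u(1) by blast+
      then show ?thesis using False s by auto
    qed
  qed
  then have "energy_change E u \<eta> \<le> 0" using u(2) by simp
  then show ?thesis using u(1) by (intro bexI[of _ u]) (auto simp: flip_rate_def)
qed

end

text \<open>
  Up to translation there are only finitely many edges, since \<open>0, \<dots>, L - 1\<close> have finitely many
  neighbours.
\<close>

lemma graph_class_periodic_ising:
  assumes "E \<in> graph_class"
  obtains L R where "periodic_ising E L R"
proof -
  have per: "periodic_graph E" and deg: "bounded_degree E"
    using assms by (auto simp: graph_class_def)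
  obtain L where L: "1 \<le> L" "\<And>x y. {x, y} \<in> E \<longleftrightarrow> {x + L, y + L} \<in> E"
    using per unfolding periodic_graph_def by blast
  have fin: "finite {u. {u, v} \<in> E}" for v
    using deg unfolding bounded_degree_def by (auto simp: insert_commute)
  have nat_per: "{x + int n * L, y + int n * L} \<in> E \<longleftrightarrow> {x, y} \<in> E" for x y n
  proof (induction n)
    case (Suc n)
    have "{x + int (Suc n) * L, y + int (Suc n) * L} = {(x + int n * L) + L, (y + int n * L) + L}"
      by (simp add: algebra_simps)
    then show ?case using L(2)[of "x + int n * L" "y + int n * L"] Suc by simp
  qed simp
  have int_per: "{x + j * L, y + j * L} \<in> E \<longleftrightarrow> {x, y} \<in> E" for x y j
  proof (cases "0 \<le> j")
    case True
    then show ?thesis using nat_per[of x "nat j" y] by simp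
  next
    case False
    then show ?thesis using nat_per[of "x + j * L" "nat (- j)" "y + j * L"] by simp
  qed
  let ?D = "(\<Union>r\<in>{0..<L}. (\<lambda>u. nat \<bar>u - r\<bar>) ` {u. {u, r} \<in> E})"
  have "finite ?D" using fin by auto
  then obtain R where R: "\<forall>d\<in>?D. d \<le> R" using finite_nat_set_iff_bounded_le by blast
  have "periodic_ising E L R"
  proof
    fix x y assume e: "{x, y} \<in> E"
    let ?r = "y mod L" and ?u = "x + (- (y div L)) * L"
    have r: "y + (- (y div L)) * L = ?r" by (simp add: minus_div_mult_eq_mod)
    have "{?u, ?r} \<in> E" using int_per[of x "- (y div L)" y] e unfolding r by simp
    moreover have "?r \<in> {0..<L}" using L(1) by simp
    ultimately have "nat \<bar>?u - ?r\<bar> \<in> ?D" by blast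
    then have "nat \<bar>?u - ?r\<bar> \<le> R" using R by blast
    moreover have "?u - ?r = x - y" unfolding r[symmetric] by simp
    ultimately show "\<bar>x - y\<bar> \<le> int R" by simp
  qed (use fin L int_per in auto)
  then show thesis by (rule that)
qed

text \<open>
  Changing the sign of one fair coin changes neither the marginal distributions nor the
  independence, and these determine the joint distribution.
\<close>

lemma iid_spins_flip_invariant:
  assumes "prob_space M" and iid: "iid_spins M (1/2) X" and meas: "X \<in> M \<rightarrow>\<^sub>M spin_space" and f: "bounded_obs f"
  shows "(\<integral>w. f (flip x (X w)) \<partial>M) = (\<integral>w. f (X w) \<partial>M)"
proof -
  interpret prob_space M by fact
  let ?N = "\<lambda>_::'b. count_space spins"
  let ?g = "\<lambda>v a. if v = x then - a else a :: int"
  have ind: "indep_vars ?N (\<lambda>v w. X w v) UNIV"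
    and p: "\<And>v. prob {w\<in>space M. X w v = 1} = 1/2" "\<And>v. prob {w\<in>space M. X w v = -1} = 1/2"
    using iid unfolding iid_spins_def by auto
  have rv: "(\<lambda>w. X w v) \<in> M \<rightarrow>\<^sub>M count_space spins" for v
    using ind unfolding indep_vars_def by auto
  have flip_eq: "flip x (X w) v = ?g v (X w v)" for w v by (simp add: flip_def)
  have g: "?g v \<in> count_space spins \<rightarrow>\<^sub>M count_space spins" for v by auto
  have ind': "indep_vars ?N (\<lambda>v w. flip x (X w) v) UNIV"
    unfolding flip_eq by (rule indep_vars_compose2[OF ind g])
  have rv': "(\<lambda>w. flip x (X w) v) \<in> M \<rightarrow>\<^sub>M count_space spins" for v
    using ind' unfolding indep_vars_def by auto
  have marg: "distr M (count_space spins) (\<lambda>w. flip x (X w) v) = distr M (count_space spins) (\<lambda>w. X w v)" for v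
  proof (rule measure_eqI_finite[of _ spins])
    fix a :: int assume a: "a \<in> spins"
    have "{w\<in>space M. flip x (X w) v = a} = (if v = x then {w\<in>space M. X w v = - a} else {w\<in>space M. X w v = a})"
      by (auto simp: flip_def)
    moreover have half: "prob {w\<in>space M. X w v = b} = 1/2" if "b \<in> spins" for b using p that by blast
    moreover have "- a \<in> spins" using a by auto
    ultimately have "prob {w\<in>space M. flip x (X w) v = a} = prob {w\<in>space M. X w v = a}"
      using half[OF a] by presburger
    then show "emeasure (distr M (count_space spins) (\<lambda>w. flip x (X w) v)) {a} = emeasure (distr M (count_space spins) (\<lambda>w. X w v)) {a}"
      using a by (simp add: emeasure_distr[OF rv] emeasure_distr[OF rv'] vimage_def Int_def emeasure_eq_measure conj_commute)
  qed auto
  have meas': "(\<lambda>w. flip x (X w)) \<in> M \<rightarrow>\<^sub>M spin_space"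
    unfolding spin_space_def
  proof (rule measurable_PiM_single')
    show "(\<lambda>w. flip x (X w)) \<in> space M \<rightarrow> (\<Pi>\<^sub>E i\<in>UNIV. space (count_space spins))"
    proof
      fix w assume "w \<in> space M"
      then have "flip x (X w) \<in> space spin_space" using measurable_space[OF meas] by (simp add: space_spin_space)
      then show "flip x (X w) \<in> (\<Pi>\<^sub>E i\<in>UNIV. space (count_space spins))"
        by (simp add: spin_space_def space_PiM)
    qed
  qed (rule rv')
  have "distr M spin_space (\<lambda>w. flip x (X w)) = (\<Pi>\<^sub>M v\<in>UNIV. distr M (count_space spins) (\<lambda>w. flip x (X w) v))"
    using indep_vars_iff_distr_eq_PiM[OF UNIV_not_empty rv', THEN iffD1, OF ind']
    by (simp add: spin_space_def restrict_UNIV)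
  also have "\<dots> = (\<Pi>\<^sub>M v\<in>UNIV. distr M (count_space spins) (\<lambda>w. X w v))" unfolding marg ..
  also have "\<dots> = distr M spin_space X"
    using indep_vars_iff_distr_eq_PiM[OF UNIV_not_empty rv, THEN iffD1, OF ind]
    by (simp add: spin_space_def restrict_UNIV)
  finally have eq: "distr M spin_space (\<lambda>w. flip x (X w)) = distr M spin_space X" .
  have fm: "f \<in> borel_measurable spin_space" using f unfolding bounded_obs_def by blast
  show ?thesis using integral_distr[OF meas' fm] integral_distr[OF meas fm] unfolding eq by simp
qed

theorem theorem1:
  fixes E :: "int set set"
    and M :: "'w measure"
    and \<sigma> :: "real \<Rightarrow> 'w \<Rightarrow> int \<Rightarrow> int"
  assumes "E \<in> graph_class"
    and "I_model E (1 / 2) M \<sigma>"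
  shows "type_I M \<sigma> \<longleftrightarrow> shrink_property E"
proof -
  obtain K where markov: "markov_process M spin_space K \<sigma>" and rates: "flips_at_rate K (flip_rate E)"
    using assms(2) unfolding I_model_def by blast
  have cad: "AE w in M. \<forall>v. cadlag (\<lambda>t. \<sigma> t w v)" and iid: "iid_spins M (1/2) (\<sigma> 0)"
    using assms(2) unfolding I_model_def by auto
  obtain L R where "periodic_ising E L R" by (rule graph_class_periodic_ising[OF assms(1)])
  then interpret periodic_ising E L R .
  interpret fair_process K "flip_rate E" R M \<sigma>
  proof
    show "transition_semigroup spin_space K" using markov unfolding markov_process_def by blast
    show "(\<integral>w. f (flip x (\<sigma> 0 w)) \<partial>M) = (\<integral>w. f (\<sigma> 0 w) \<partial>M)" if "bounded_obs f" for f x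
      using markov by (intro iid_spins_flip_invariant iid that) (auto simp: markov_process_def)
    show "flips_at_rate K (flip_rate E)" by (rule rates)
    show "markov_process M spin_space K \<sigma>" by (rule markov)
    show "0 \<le> flip_rate E x \<eta>" "flip_rate E x \<eta> \<le> 1" for x \<eta> by (rule flip_rate_bounds)+
    show "flip_rate E x \<xi> = flip_rate E x \<eta>" if "\<And>y. \<bar>y - x\<bar> \<le> int R \<Longrightarrow> \<xi> y = \<eta> y" for x \<xi> \<eta>
      by (rule flip_rate_local[OF that])
    show "flip_rate E x \<eta> \<le> flip_rate E x (flip y \<eta>)" if "y \<noteq> x" "\<eta> y = -1" "\<eta> x = -1" for x y \<eta>
      by (rule flip_rate_minus[OF that])
    show "flip_rate E x (flip y \<eta>) \<le> flip_rate E x \<eta>" if "y \<noteq> x" "\<eta> y = -1" "\<eta> x = 1" for x y \<eta>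
      by (rule flip_rate_plus[OF that])
    show "flip_rate E x (negate \<eta>) = flip_rate E x \<eta>" for x \<eta> by (rule flip_rate_negate)
  qed
  show ?thesis
  proof
    \<comment> \<open>A set that violates the shrink property stays frozen if its spins agree initially.\<close>
    assume type: "type_I M \<sigma>"
    show "shrink_property E"
    proof (rule ccontr)
      assume "\<not> shrink_property E"
      then obtain S where fin: "finite S" and ne: "S \<noteq> {}" and deg: "\<And>u. u \<in> S \<Longrightarrow> deg_in E (- S) u < deg_in E S u"
        unfolding shrink_property_def by (meson not_le)
      have frozen: "flip_rate E u \<eta> = 0" if "\<eta> \<in> configs" "\<forall>x\<in>S. \<eta> x = 1" "u \<in> S" for \<eta> u
        using energy_change_ge_degrees[OF finite_neighbours that] deg[OF that(3)] by (simp add: flip_rate_def)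
      let ?A = "\<lambda>t. {w\<in>space M. \<forall>x\<in>S. \<sigma> t w x = 1}"
      have A: "?A t \<in> events" if "0 \<le> t" for t by (rule spins_event[OF that fin])
      have null: "prob (?A 0 - ?A t) = 0" if t: "0 < t" for t
      proof -
        have t': "0 \<le> t" using t by simp
        let ?g = "\<lambda>\<xi>. 1 - all_at S 1 \<xi>"
        have bo: "bounded_obs ?g" by (intro bounded_obs_diff bounded_obs_const bounded_obs_all_at fin)
        have "prob (?A 0 - ?A t) = (\<integral>w. indicator (?A 0 - ?A t) w \<partial>M)" using A t' by simp
        also have "\<dots> = (\<integral>w. indicator (?A 0) w * ?g (\<sigma> (0 + t) w) \<partial>M)"
          by (intro Bochner_Integration.integral_cong) (auto simp: all_at_def split: split_indicator)
        also have "\<dots> = (\<integral>w. indicator (?A 0) w * act t ?g (\<sigma> 0 w) \<partial>M)"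
          by (rule markov_integral[OF order_refl t' spins_event_past[OF order_refl order_refl fin] bo])
        also have "\<dots> \<le> (\<integral>w. 0 \<partial>M)"
        proof (rule integral_mono')
          fix w assume w: "w \<in> space M"
          show "indicator (?A 0) w * act t ?g (\<sigma> 0 w) \<le> 0"
          proof (cases "w \<in> ?A 0")
            case True
            then have "\<forall>x\<in>S. \<sigma> 0 w x = 1" by blast
            from frozen_stays[OF fin frozen process_configs[OF order_refl w] this t] True show ?thesis
              by (simp only: indicator_simps mult_1)
          next
            case False
            then have "indicator (?A 0) w = (0::real)" by (rule indicator_simps(2))
            then show ?thesis by simp
          qed
        qed auto
        also have "(\<integral>w. 0 \<partial>M) = (0::real)" by simp
        finally show ?thesis using measure_nonneg[of M "?A 0 - ?A t"] by linarith
      qed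
      have "AE w in M. w \<in> ?A 0 \<longrightarrow> (\<forall>q\<in>{q\<in>\<rat>. 0 \<le> q}. w \<in> ?A q)"
      proof -
        have "AE w in M. \<forall>q\<in>{q\<in>\<rat>. 0 \<le> q}. w \<notin> ?A 0 - ?A q"
        proof (subst AE_ball_countable)
          show "countable {q\<in>\<rat>. 0 \<le> (q::real)}" by (rule countable_subset[OF _ countable_rat]) auto
          show "\<forall>q\<in>{q\<in>\<rat>. 0 \<le> q}. AE w in M. w \<notin> ?A 0 - ?A q"
          proof
            fix q :: real assume "q \<in> {q\<in>\<rat>. 0 \<le> q}"
            then consider "q = 0" | "0 < q" by fastforce
            then show "AE w in M. w \<notin> ?A 0 - ?A q"
            proof cases
              case 2
              have "?A 0 - ?A q \<in> events" using A[of 0] A[of q] 2 by (intro sets.Diff) auto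
              then show ?thesis using null[OF 2] by (simp add: prob_eq_0)
            qed simp
          qed
        qed
        then show ?thesis by eventually_elim blast
      qed
      moreover have "AE w in M. \<forall>v. \<not> fixates (\<lambda>t. \<sigma> t w v)" using type unfolding type_I_def .
      ultimately have "AE w in M. w \<notin> ?A 0"
        using cad
      proof eventually_elim
        case (elim w)
        show ?case
        proof
          assume w: "w \<in> ?A 0"
          \<comment> \<open>The spins of S never leave the value 1, so they fixate.\<close>
          obtain v where v: "v \<in> S" using ne by blast
          have "\<sigma> q w v = 1" if "q \<in> \<rat>" "0 \<le> q" for q using elim(1) w v that by blast
          then have "fixates (\<lambda>t. \<sigma> t w v)"
            using elim(3) by (intro constant_on_rationals_imp_fixates[of _ 1]) auto
          then show False using elim(2) by blast
        qed
      qed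
      then have "prob (?A 0) = 0" using prob_eq_0[OF A[of 0]] by simp
      moreover have "(1/2) ^ card S \<le> prob (?A 0)" by (rule block_prob[OF order_refl fin]) simp
      moreover have "0 < (1/2::real) ^ card S" by simp
      ultimately show False by linarith
    qed
  next
    assume shrink: "shrink_property E"
    \<comment> \<open>The block consists of the vertices at distance at most R from the window.\<close>
    have turn: "\<exists>B \<delta>. finite B \<and> card B \<le> 2 * R \<and> 0 < \<delta> \<and>
      (\<forall>v\<in>window k. \<forall>\<eta>\<in>configs. (\<forall>x\<in>B. \<eta> x = s) \<longrightarrow> \<delta> \<le> act 1 (all_at {v} s) \<eta>)"
      if s: "s = 1 \<or> s = -1" for k :: nat and s
    proof -
      let ?J = "window (k + R)" and ?I = "window k"
      have sub: "?I \<subseteq> ?J" by auto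
      obtain \<delta> where d: "0 < \<delta>" "\<And>\<eta>. \<eta> \<in> configs \<Longrightarrow> \<forall>x\<in>?J - ?I. \<eta> x = s \<Longrightarrow> \<delta> \<le> act 1 (all_at ?J s) \<eta>"
      proof (rule erase_prob_pos[OF _ sub _ s])
        show "\<exists>u\<in>?I. \<eta> u \<noteq> s \<and> 1/2 \<le> flip_rate E u \<eta>"
          if "\<eta> \<in> configs" "\<forall>x\<in>?J - ?I. \<eta> x = s" "\<exists>x\<in>?I. \<eta> x \<noteq> s" for \<eta>
          by (rule erase_step[OF shrink that(1) s that(2,3)])
      qed (simp, blast)
      have "card (?J - ?I) = 2 * R"
        using card_Diff_subset[OF _ sub] by (simp add: nat_add_distrib)
      moreover have "\<delta> \<le> act 1 (all_at {v} s) \<eta>" if "v \<in> ?I" "\<eta> \<in> configs" "\<forall>x\<in>?J - ?I. \<eta> x = s" for v \<eta>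
      proof -
        have "\<delta> \<le> act 1 (all_at ?J s) \<eta>" by (rule d(2)[OF that(2,3)])
        also have "\<dots> \<le> act 1 (all_at {v} s) \<eta>"
          using that sub by (intro act_mono bounded_obs_all_at) (auto simp: all_at_def)
        finally show ?thesis .
      qed
      ultimately show ?thesis using d(1) by (intro exI[of _ "?J - ?I"] exI[of _ \<delta>]) auto
    qed
    have survivor: "prob (stay_forever v s m) = 0" if s: "s = 1 \<or> s = -1" for v s m
      by (rule no_survivor[OF L_pos flip_rate_translate s turn]) (use s in auto)
    \<comment> \<open>There are countably many ways to survive: a fixating spin is constant at all large integer times.\<close>
    have "AE w in M. \<forall>(v, s, m)\<in>UNIV \<times> {1, -1} \<times> UNIV. w \<notin> stay_forever v s m"
    proof (subst AE_ball_countable)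
      show "\<forall>p\<in>UNIV \<times> {1, -1} \<times> UNIV. AE w in M. case p of (v, s, m) \<Rightarrow> w \<notin> stay_forever v s m"
      proof
        fix p :: "int \<times> int \<times> nat" assume "p \<in> UNIV \<times> {1, -1} \<times> UNIV"
        then obtain v s m where p: "p = (v, s, m)" "s = 1 \<or> s = -1" by auto
        then show "AE w in M. case p of (v, s, m) \<Rightarrow> w \<notin> stay_forever v s m"
          using survivor[OF p(2)] prob_eq_0[OF stay_forever_event] by simp
      qed
    qed auto
    with cad AE_space have "AE w in M. \<forall>v. \<not> fixates (\<lambda>t. \<sigma> t w v)"
    proof eventually_elim
      case (elim w)
      show ?case
      proof (intro allI notI)
        fix v assume "fixates (\<lambda>t. \<sigma> t w v)"
        then obtain m :: nat where m: "\<And>i. m \<le> i \<Longrightarrow> \<sigma> (real i) w v = \<sigma> (real m) w v"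
          using fixates_imp_eventually_constant[of "\<lambda>t. \<sigma> t w v"] elim(1) by blast
        define s where "s = \<sigma> (real m) w v"
        have "s = 1 \<or> s = -1" using configs_cases[OF process_configs[OF _ elim(2), of "real m"], of v] by (auto simp: s_def)
        moreover have "\<sigma> (real i) w v = s" if "m \<le> i" for i unfolding s_def by (rule m[OF that])
        then have "w \<in> stay_forever v s m" using elim(2) unfolding stay_forever_def stay_def by simp
        ultimately show False using elim(3) by auto
      qed
    qed
    then show "type_I M \<sigma>" unfolding type_I_def .
  qed
qed

end
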